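(* Let $P\subset\mathbb{R}^n$ be a Delzant polytope with vertices in $\mathbb{Z}^n$, let $\varphi\in C^\infty_{g_P}(P)$, and for $s\geq 0$ let $\mathcal{P}^s_{\mathbb{C}}$ be the holomorphic polarization on $X_P$ determined by the symplectic potential $g_s=g_P+\varphi+s\psi$. For any $\psi\in C^\infty_{\mathrm{Hess}>0}(P)$, $$C^\infty\Big(\lim_{s\to\infty}\mathcal{P}^s_{\mathbb{C}}\Big)=C^\infty(\mathcal{P}_{\mathbb{R}}),$$ where the limit is taken in the positive Lagrangian Grassmannian of the complexified tangent space at each point of $X_P$.
   Context: **Toric manifold.** $P=\{x\in\mathbb{R}^n:\ell_r(x)={}^t\nu_r x-\lambda_r\ge 0,\ r=1,\dots,d\}$ is a (compact) Delzant polytope with vertices in $\mathbb{Z}^n$: $\lambda_r\in\mathbb{Z}$, $\nu_r\in\mathbb{Z}^n$ is the primitive inward-pointing normal of the $r$-th facet, and at each vertex exactly $n$ facets meet and their normals form a $\mathbb{Z}$-basis of $\mathbb{Z}^n$. $\breve P$ is the interior of $P$. $(X_P,\omega,\mathbb{T}^n,\mu_P)$ is the associated compact symplectic toric manifold, $\mathbb{T}^n=\mathbb{R}^n/2\pi\mathbb{Z}^n$, with moment map $\mu_P:X_P\to P$. On $\breve X_P=\mu_P^{-1}(\breve P)\cong\breve P\times\mathbb{T}^n$ one has coordinates $(x,\theta)$ with $\omega=\sum_i dx_i\wedge d\theta_i$ and $\mu_P(x,\theta)=x$. **Symplectic potentials.** $g_P(x)=\frac12\sum_{r=1}^d\ell_r(x)\log\ell_r(x)$.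 $C^\infty_{g_P}(P)$ is the set of $\varphi\in C^\infty(P)$ such that $\mathrm{Hess}_x(g_P+\varphi)$ is positive definite on $\breve P$ and $\det\mathrm{Hess}_x(g_P+\varphi)=[\alpha(x)\prod_{r=1}^d\ell_r(x)]^{-1}$ with $\alpha$ smooth and strictly positive on $P$. $C^\infty_{\mathrm{Hess}>0}(P)$ is the set of smooth functions on $P$ with positive definite Hessian on $P$. A potential $g=g_P+\varphi$ with $\varphi\in C^\infty_{g_P}(P)$ defines an $\omega$-compatible complex structure $J$ on $X_P$; on $\breve X_P$, $J=\begin{pmatrix}0&-G^{-1}\\ G&0\end{pmatrix}$ in the coordinates $(x,\theta)$, with $G=\mathrm{Hess}_x g$, and $e^{y+i\theta}$, $y=\partial g/\partial x$, are holomorphic coordinates. The functions $g_s=g_P+\varphi+s\psi$, $s\ge0$, are such potentials. **Vertex charts.** For a vertex $v$ of $P$, with an ordering of the $n$ facets containing $v$, let $A$ be the matrix whose rows are their normals, $\lambda$ the vector of the corresponding $\lambda_r$, $l=Ax-\lambda$ and $\vartheta={}^tA^{-1}\theta$. Let $V_v=\mu_P^{-1}(\breve P_v)$, with $\breve P_v$ the union of the relative interiors of all faces of $P$ containing $v$ (including $\{v\}$ and $\breve P$). The functions $w^s_j=e^{\partial g_s/\partial l_j+i\vartheta_j}$, $j=1,\dots,n$, extend from $\breve X_P$ to a holomorphic chart $V_v\to\mathbb{C}^n$ for the complex structure $J_s$ defined by $g_s$; the $V_v$ cover $X_P$. **Polarizations.** $\mathcal{P}^s_{\mathbb{C}}=\mathrm{span}_{\mathbb{C}}\{\partial/\partial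 w^s_j:j=1,\dots,n\}$ on $V_v$. $\mathcal{P}_{\mathbb{R}}\subset(TX_P)_{\mathbb{C}}$ is the complexified (singular) distribution of tangent spaces to the $\mathbb{T}^n$-orbits; on $\breve X_P$ it equals $\ker d\mu_P$. For a (possibly singular) complex distribution $\mathcal{P}\subset (TX_P)_{\mathbb{C}}$, $C^\infty(\mathcal{P})$ denotes the sheaf of smooth complex vector fields with values in $\mathcal{P}$ at each point. *)

theory Defs
  imports "HOL-Analysis.Analysis"
begin

section \<open>Smooth functions and Hessians\<close>

primrec Ck_on :: "nat \<Rightarrow> 'a::euclidean_space set \<Rightarrow> ('a \<Rightarrow> 'b::real_normed_vector) \<Rightarrow> bool" where
  "Ck_on 0 S f \<longleftrightarrow> continuous_on S f"
| "Ck_on (Suc k) S f \<longleftrightarrow> f differentiable_on S \<and>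
     (\<forall>v. Ck_on k S (\<lambda>x. frechet_derivative f (at x) v))"

text \<open>Only used for open \<open>S\<close>.\<close>
definition smooth_on :: "'a::euclidean_space set \<Rightarrow> ('a \<Rightarrow> 'b::real_normed_vector) \<Rightarrow> bool" where
  "smooth_on S f \<longleftrightarrow> (\<forall>k. Ck_on k S f)"

definition smooth_extension ::
  "'a::euclidean_space set \<Rightarrow> ('a \<Rightarrow> 'b::real_normed_vector) \<Rightarrow> ('a \<Rightarrow> 'b) \<Rightarrow> bool" where
  "smooth_extension K f F \<longleftrightarrow>
     (\<exists>U. open U \<and> K \<subseteq> U \<and> smooth_on U F) \<and> (\<forall>x\<in>K. F x = f x)"

text \<open>\<open>C\<^sup>\<infinity>(K)\<close> for a closed set \<open>K\<close>: smooth extension to a neighbourhood of \<open>K\<close>. The values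
  of \<open>f\<close> outside \<open>K\<close> are irrelevant.\<close>
definition smooth_functions :: "'a::euclidean_space set \<Rightarrow> ('a \<Rightarrow> real) set" where
  "smooth_functions K = {f. \<exists>F. smooth_extension K f F}"

definition Hess :: "(real^'n \<Rightarrow> real) \<Rightarrow> real^'n \<Rightarrow> real^'n^'n" where
  "Hess f x = (\<chi> i j.
     frechet_derivative (\<lambda>y. frechet_derivative f (at y) (axis j 1)) (at x) (axis i 1))"

definition positive_definite :: "real^'n^'n \<Rightarrow> bool" where
  "positive_definite H \<longleftrightarrow> (\<forall>v. v \<noteq> 0 \<longrightarrow> v \<bullet> (H *v v) > 0)"

text \<open>At boundary points of \<open>K\<close> the Hessian is that of a smooth extension. When \<open>K\<close> is the closure
  of its interior, as for the polytopes below, it does not depend on the extension.\<close>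
definition smooth_Hess_pos :: "(real^'n) set \<Rightarrow> (real^'n \<Rightarrow> real) set" where
  "smooth_Hess_pos K =
     {f. \<exists>F. smooth_extension K f F \<and> (\<forall>x\<in>K. positive_definite (Hess F x))}"

definition real_vec :: "int^'n \<Rightarrow> real^'n" where
  "real_vec m = (\<chi> i. real_of_int (m $ i))"

definition complex_vec :: "real^'n \<Rightarrow> complex^'n" where
  "complex_vec a = (\<chi> i. complex_of_real (a $ i))"

text \<open>The identification of \<open>\<complex>\<^sup>n\<close> with \<open>\<real>\<^sup>2\<^sup>n\<close>.\<close>
definition realify :: "complex^'n \<Rightarrow> real^('n + 'n)" where
  "realify z = (\<chi> k. case k of Inl j \<Rightarrow> Re (z $ j) | Inr j \<Rightarrow> Im (z $ j))"

text \<open>Jacobian matrix, viewed as a complex matrix acting on complexified vectors.\<close>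
definition complex_jacobian :: "(real^'m \<Rightarrow> real^'k) \<Rightarrow> real^'m \<Rightarrow> complex^'m^'k" where
  "complex_jacobian F u =
     (\<chi> i j. complex_of_real (matrix (frechet_derivative F (at u)) $ i $ j))"


section \<open>Delzant polytopes and their toric manifolds\<close>

text \<open>A point of the toric manifold is an equivalence class of pairs \<open>(x, \<theta>)\<close>.\<close>
type_synonym 'n toric_point = "((real^'n) \<times> (real^'n)) set"

text \<open>A complexified tangent vector is recorded by all its components in all the vertex charts:
  the entry \<open>(k, \<sigma>)\<close> is the \<open>k\<close>-th component in the chart given by the ordered vertex \<open>\<sigma>\<close>
  (zero if the base point is not in the domain of that chart). The index type is finite, so that
  every complexified tangent space is a complex linear subspace of one vector space.\<close>
type_synonym ('n, 'd) tangent_vector = "complex^(('n + 'n) \<times> ('n \<Rightarrow> 'd))"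

definition component ::
  "('n::finite \<Rightarrow> 'd::finite) \<Rightarrow> ('n, 'd) tangent_vector \<Rightarrow> complex^('n + 'n)" where
  "component \<sigma> \<xi> = (\<chi> k. \<xi> $ (k, \<sigma>))"

context
  fixes nu :: "'d::finite \<Rightarrow> int^'n::finite"
    and lam :: "'d \<Rightarrow> int"
begin

definition ell :: "'d \<Rightarrow> real^'n \<Rightarrow> real" where
  "ell r x = real_vec (nu r) \<bullet> x - real_of_int (lam r)"

definition polytope_of :: "(real^'n) set" where
  "polytope_of = {x. \<forall>r. ell r x \<ge> 0}"

definition tight :: "real^'n \<Rightarrow> 'd set" where
  "tight x = {r. ell r x = 0}"

definition integral_basis :: "'d set \<Rightarrow> bool" where
  "integral_basis I \<longleftrightarrow>
     (\<forall>m. \<exists>!c. (\<forall>r. r \<notin> I \<longrightarrow> c r = 0) \<and> m = (\<Sum>r\<in>I. c r *s nu r))"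

definition delzant :: bool where
  "delzant \<longleftrightarrow>
     compact polytope_of \<and> interior polytope_of \<noteq> {} \<and>
     (\<forall>r. Gcd (range (($) (nu r))) = 1 \<and> {x \<in> polytope_of. ell r x = 0} facet_of polytope_of) \<and>
     (\<forall>v. v extreme_point_of polytope_of \<longrightarrow>
        (\<forall>i. v $ i \<in> \<int>) \<and> card (tight v) = CARD('n) \<and> integral_basis (tight v))"

definition guillemin_potential :: "real^'n \<Rightarrow> real" where
  "guillemin_potential x = 1/2 * (\<Sum>r\<in>UNIV. ell r x * ln (ell r x))"

text \<open>The functions \<open>\<phi>\<close> for which \<open>g\<^sub>P + \<phi>\<close> is a symplectic potential.\<close>
definition admissible_functions :: "(real^'n \<Rightarrow> real) set" where
  "admissible_functions =
     {\<phi> \<in> smooth_functions polytope_of.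
        (\<forall>x \<in> interior polytope_of. positive_definite (Hess (\<lambda>y. guillemin_potential y + \<phi> y) x)) \<and>
        (\<exists>\<alpha> \<in> smooth_functions polytope_of.
           (\<forall>x \<in> polytope_of. \<alpha> x > 0) \<and>
           (\<forall>x \<in> interior polytope_of.
              det (Hess (\<lambda>y. guillemin_potential y + \<phi> y) x) = inverse (\<alpha> x * (\<Prod>r\<in>UNIV. ell r x))))}"

definition potential_path ::
  "(real^'n \<Rightarrow> real) \<Rightarrow> (real^'n \<Rightarrow> real) \<Rightarrow> real \<Rightarrow> real^'n \<Rightarrow> real" where
  "potential_path \<phi> \<psi> s x = guillemin_potential x + \<phi> x + s * \<psi> x"


subsection \<open>The underlying space\<close>

text \<open>The toric manifold is \<open>P \<times> \<real>\<^sup>n\<close> modulo \<open>(x, \<theta>) \<sim> (x, \<theta>')\<close> iff \<open>\<theta>' - \<theta>\<close> lies in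
  \<open>2\<pi>\<int>\<^sup>n\<close> plus the Lie algebra of the stabiliser of the points over \<open>x\<close>; the latter is spanned by
  the normals of the facets containing \<open>x\<close>.\<close>
definition stabiliser :: "real^'n \<Rightarrow> (real^'n) set" where
  "stabiliser x =
     {(2 * pi) *\<^sub>R real_vec m + u | m u. u \<in> span (real_vec ` nu ` tight x)}"

definition toric_class :: "real^'n \<Rightarrow> real^'n \<Rightarrow> 'n toric_point" where
  "toric_class x \<theta> = {x} \<times> {\<theta>'. \<theta>' - \<theta> \<in> stabiliser x}"

definition toric_manifold :: "'n toric_point set" where
  "toric_manifold = {toric_class x \<theta> | x \<theta>. x \<in> polytope_of}"

definition moment_map :: "'n toric_point \<Rightarrow> real^'n" where
  "moment_map p = (THE x. \<exists>\<theta>. p = toric_class x \<theta>)"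

text \<open>Some representative of the angle coordinate; only used in expressions which do not depend on
  the choice.\<close>
definition angle :: "'n toric_point \<Rightarrow> real^'n" where
  "angle p = (SOME \<theta>. p = toric_class (moment_map p) \<theta>)"

definition torus_action :: "real^'n \<Rightarrow> 'n toric_point \<Rightarrow> 'n toric_point" where
  "torus_action t p = (\<lambda>(x, \<theta>). (x, \<theta> + t)) ` p"

definition open_stratum :: "'n toric_point set" where
  "open_stratum = {p \<in> toric_manifold. moment_map p \<in> interior polytope_of}"


subsection \<open>Vertex charts\<close>

text \<open>The vertex \<open>v\<close> together with an ordering \<open>\<sigma>\<close> of the facets containing it.\<close>
definition ordered_vertex :: "('n \<Rightarrow> 'd) \<Rightarrow> real^'n \<Rightarrow> bool" where
  "ordered_vertex \<sigma> v \<longleftrightarrow> v extreme_point_of polytope_of \<and> bij_betw \<sigma> UNIV (tight v)"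

definition vertex_star :: "real^'n \<Rightarrow> (real^'n) set" where
  "vertex_star v = \<Union> {rel_interior F | F. F face_of polytope_of \<and> v \<in> F}"

text \<open>The set \<open>V\<^sub>v\<close>, empty if \<open>\<sigma>\<close> is not an ordering of the facets at some vertex; \<open>v\<close> is
  determined by \<open>\<sigma>\<close>.\<close>
definition chart_domain :: "('n \<Rightarrow> 'd) \<Rightarrow> 'n toric_point set" where
  "chart_domain \<sigma> =
     {p \<in> toric_manifold. \<exists>v. ordered_vertex \<sigma> v \<and> moment_map p \<in> vertex_star v}"

definition normal_matrix :: "('n \<Rightarrow> 'd) \<Rightarrow> real^'n^'n" where
  "normal_matrix \<sigma> = (\<chi> j. real_vec (nu (\<sigma> j)))"

definition vertex_angle :: "('n \<Rightarrow> 'd) \<Rightarrow> 'n toric_point \<Rightarrow> real^'n" where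
  "vertex_angle \<sigma> p = transpose (matrix_inv (normal_matrix \<sigma>)) *v angle p"

text \<open>The equivariant Darboux charts \<open>z\<^sub>j = sqrt (2 l\<^sub>j) e\<^bsup>i\<vartheta>\<^sub>j\<^esup>\<close> form a smooth atlas of the manifold. Writing
  \<open>z\<^sub>j = q\<^sub>j + i p\<^sub>j\<close>, one has \<open>dq\<^sub>j \<and> dp\<^sub>j = dl\<^sub>j \<and> d\<vartheta>\<^sub>j\<close>, and \<open>\<Sum>\<^sub>j dl\<^sub>j \<and> d\<vartheta>\<^sub>j = \<Sum>\<^sub>i dx\<^sub>i \<and> d\<theta>\<^sub>i\<close>.\<close>
definition darboux_chart :: "('n \<Rightarrow> 'd) \<Rightarrow> 'n toric_point \<Rightarrow> real^('n + 'n)" where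
  "darboux_chart \<sigma> p =
     realify (\<chi> j. complex_of_real (sqrt (2 * ell (\<sigma> j) (moment_map p))) * cis (vertex_angle \<sigma> p $ j))"

definition chart_inverse :: "('n \<Rightarrow> 'd) \<Rightarrow> real^('n + 'n) \<Rightarrow> 'n toric_point" where
  "chart_inverse \<sigma> = inv_into (chart_domain \<sigma>) (darboux_chart \<sigma>)"

definition manifold_open :: "'n toric_point set \<Rightarrow> bool" where
  "manifold_open U \<longleftrightarrow>
     U \<subseteq> toric_manifold \<and> (\<forall>\<sigma>. open (darboux_chart \<sigma> ` (U \<inter> chart_domain \<sigma>)))"


subsection \<open>Complexified tangent spaces\<close>

text \<open>The complexified differential at \<open>p\<close> of \<open>F\<close>, computed in the Darboux chart \<open>\<sigma>\<close>.\<close>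
definition differential ::
  "('n \<Rightarrow> 'd) \<Rightarrow> ('n toric_point \<Rightarrow> real^('n + 'n)) \<Rightarrow> 'n toric_point \<Rightarrow>
     ('n, 'd) tangent_vector \<Rightarrow> complex^('n + 'n)" where
  "differential \<sigma> F p \<xi> =
     complex_jacobian (\<lambda>u. F (chart_inverse \<sigma> u)) (darboux_chart \<sigma> p) *v component \<sigma> \<xi>"

definition tangent_space :: "'n toric_point \<Rightarrow> ('n, 'd) tangent_vector set" where
  "tangent_space p =
     {\<xi>. (\<forall>\<sigma>. p \<notin> chart_domain \<sigma> \<longrightarrow> component \<sigma> \<xi> = 0) \<and>
         (\<forall>\<sigma> \<tau>. p \<in> chart_domain \<sigma> \<and> p \<in> chart_domain \<tau> \<longrightarrow>
            component \<tau> \<xi> = differential \<sigma> (darboux_chart \<tau>) p \<xi>)}"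

definition velocity :: "(real \<Rightarrow> 'n toric_point) \<Rightarrow> ('n, 'd) tangent_vector" where
  "velocity c = (\<chi> i. case i of (k, \<sigma>) \<Rightarrow>
     if c 0 \<in> chart_domain \<sigma>
     then complex_of_real (vector_derivative (\<lambda>t. darboux_chart \<sigma> (c t)) (at 0) $ k)
     else 0)"

text \<open>The value of \<open>\<omega>\<close> (extended complex bilinearly), computed in the Darboux chart \<open>\<sigma>\<close>.\<close>
definition omega ::
  "('n \<Rightarrow> 'd) \<Rightarrow> ('n, 'd) tangent_vector \<Rightarrow> ('n, 'd) tangent_vector \<Rightarrow> complex" where
  "omega \<sigma> \<xi> \<eta> = (\<Sum>j\<in>UNIV. component \<sigma> \<xi> $ Inl j * component \<sigma> \<eta> $ Inr j
                          - component \<sigma> \<xi> $ Inr j * component \<sigma> \<eta> $ Inl j)"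

definition conjugate :: "('n, 'd) tangent_vector \<Rightarrow> ('n, 'd) tangent_vector" where
  "conjugate \<xi> = (\<chi> k. cnj (\<xi> $ k))"


subsection \<open>The positive Lagrangian Grassmannian\<close>

definition grassmannian :: "'n toric_point \<Rightarrow> ('n, 'd) tangent_vector set set" where
  "grassmannian p = {L. vec.subspace L \<and> L \<subseteq> tangent_space p \<and> vec.dim L = CARD('n)}"

definition frames :: "'n toric_point \<Rightarrow> (complex^'n^(('n + 'n) \<times> ('n \<Rightarrow> 'd))) set" where
  "frames p = {M. columns M \<subseteq> tangent_space p \<and> vec.dim (columns M) = CARD('n)}"

text \<open>The quotient topology along the map sending an \<open>n\<close>-frame to its complex span.\<close>
definition grassmannian_topology :: "'n toric_point \<Rightarrow> ('n, 'd) tangent_vector set topology" where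
  "grassmannian_topology p = topology (\<lambda>W. W \<subseteq> grassmannian p \<and>
     openin (top_of_set (frames p)) {M \<in> frames p. vec.span (columns M) \<in> W})"

lemma openin_grassmannian_topology:
  "openin (grassmannian_topology p) W \<longleftrightarrow> W \<subseteq> grassmannian p \<and>
     openin (top_of_set (frames p)) {M \<in> frames p. vec.span (columns M) \<in> W}"
proof -
  have "istopology (\<lambda>W. W \<subseteq> grassmannian p \<and>
     openin (top_of_set (frames p)) {M \<in> frames p. vec.span (columns M) \<in> W})"
    unfolding istopology_def
  proof (intro conjI allI impI)
    fix S T
    assume a: "S \<subseteq> grassmannian p \<and>
        openin (top_of_set (frames p)) {M \<in> frames p. vec.span (columns M) \<in> S}"
      and b: "T \<subseteq> grassmannian p \<and>
        openin (top_of_set (frames p)) {M \<in> frames p. vec.span (columns M) \<in> T}"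
    show "S \<inter> T \<subseteq> grassmannian p"
      using a by blast
    have "{M \<in> frames p. vec.span (columns M) \<in> S \<inter> T} =
        {M \<in> frames p. vec.span (columns M) \<in> S} \<inter> {M \<in> frames p. vec.span (columns M) \<in> T}"
      by blast
    then show "openin (top_of_set (frames p)) {M \<in> frames p. vec.span (columns M) \<in> S \<inter> T}"
      using openin_Int a b by (metis (no_types, lifting))
  next
    fix K
    assume a: "\<forall>W\<in>K. W \<subseteq> grassmannian p \<and>
        openin (top_of_set (frames p)) {M \<in> frames p. vec.span (columns M) \<in> W}"
    show "\<Union>K \<subseteq> grassmannian p"
      using a by blast
    have "{M \<in> frames p. vec.span (columns M) \<in> \<Union>K} =
        (\<Union>W\<in>K. {M \<in> frames p. vec.span (columns M) \<in> W})"
      by blast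
    moreover have "openin (top_of_set (frames p)) (\<Union>W\<in>K. {M \<in> frames p. vec.span (columns M) \<in> W})"
      using a by (intro openin_Union) blast
    ultimately show "openin (top_of_set (frames p)) {M \<in> frames p. vec.span (columns M) \<in> \<Union>K}"
      by simp
  qed
  then show ?thesis
    by (simp add: grassmannian_topology_def topology_inverse')
qed

text \<open>Positive means that the Hermitian form \<open>-i\<omega>(\<xi>, cnj \<xi>)\<close>, which is positive definite on the
  holomorphic tangent spaces of compatible complex structures, is nonnegative on \<open>L\<close>. Real
  Lagrangian subspaces are thus included.\<close>
definition positive_lagrangians :: "'n toric_point \<Rightarrow> ('n, 'd) tangent_vector set set" where
  "positive_lagrangians p =
     {L \<in> grassmannian p. \<forall>\<sigma>. p \<in> chart_domain \<sigma> \<longrightarrow>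
        (\<forall>\<xi>\<in>L. \<forall>\<eta>\<in>L. omega \<sigma> \<xi> \<eta> = 0) \<and>
        (\<forall>\<xi>\<in>L. 0 \<le> Re (- \<i> * omega \<sigma> \<xi> (conjugate \<xi>)))}"

definition positive_lagrangian_grassmannian ::
  "'n toric_point \<Rightarrow> ('n, 'd) tangent_vector set topology" where
  "positive_lagrangian_grassmannian p =
     subtopology (grassmannian_topology p) (positive_lagrangians p)"


subsection \<open>Polarizations\<close>

text \<open>\<open>w\<^sub>j = exp (\<partial>g/\<partial>l\<^sub>j + i\<vartheta>\<^sub>j)\<close> on the open stratum; since \<open>x = A\<^sup>-\<^sup>1(l + \<lambda>)\<close>, the derivative
  \<open>\<partial>/\<partial>l\<^sub>j\<close> is the derivative in the direction of the \<open>j\<close>-th column of \<open>A\<^sup>-\<^sup>1\<close>.\<close>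
definition holomorphic_coords_open ::
  "(real^'n \<Rightarrow> real) \<Rightarrow> ('n \<Rightarrow> 'd) \<Rightarrow> 'n toric_point \<Rightarrow> complex^'n" where
  "holomorphic_coords_open g \<sigma> p = (\<chi> j. exp (
     complex_of_real (frechet_derivative g (at (moment_map p)) (matrix_inv (normal_matrix \<sigma>) *v axis j 1))
     + \<i> * complex_of_real (vertex_angle \<sigma> p $ j)))"

text \<open>The continuous extension of these functions to the whole chart domain.\<close>
definition holomorphic_coords ::
  "(real^'n \<Rightarrow> real) \<Rightarrow> ('n \<Rightarrow> 'd) \<Rightarrow> 'n toric_point \<Rightarrow> complex^'n" where
  "holomorphic_coords g \<sigma> p =
     Lim (at (darboux_chart \<sigma> p) within darboux_chart \<sigma> ` open_stratum)
         (\<lambda>u. holomorphic_coords_open g \<sigma> (chart_inverse \<sigma> u))"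

text \<open>The coordinate vector field \<open>\<partial>/\<partial>w\<^sub>j = (\<partial>/\<partial>Re w\<^sub>j - i \<partial>/\<partial>Im w\<^sub>j)/2\<close> at \<open>p\<close>: the preimage of the
  corresponding constant vector of \<open>\<complex>\<^sup>n\<close> under the differential of the chart \<open>w\<close>.\<close>
definition holomorphic_coord_vector ::
  "(real^'n \<Rightarrow> real) \<Rightarrow> ('n \<Rightarrow> 'd) \<Rightarrow> 'n \<Rightarrow> 'n toric_point \<Rightarrow> ('n, 'd) tangent_vector" where
  "holomorphic_coord_vector g \<sigma> j p =
     (THE \<xi>. \<xi> \<in> tangent_space p \<and>
        differential \<sigma> (\<lambda>q. realify (holomorphic_coords g \<sigma> q)) p \<xi>
          = (1/2) *s (axis (Inl j) 1 - \<i> *s axis (Inr j) 1))"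

text \<open>The charts \<open>w\<close> at different vertices are holomorphically related, so all the vertex charts
  around \<open>p\<close> contribute the same subspace.\<close>
definition holomorphic_polarization ::
  "(real^'n \<Rightarrow> real) \<Rightarrow> 'n toric_point \<Rightarrow> ('n, 'd) tangent_vector set" where
  "holomorphic_polarization g p =
     vec.span {holomorphic_coord_vector g \<sigma> j p | \<sigma> j. p \<in> chart_domain \<sigma>}"

text \<open>The complex span of the fundamental vector fields of the torus action.\<close>
definition real_polarization :: "'n toric_point \<Rightarrow> ('n, 'd) tangent_vector set" where
  "real_polarization p = vec.span {velocity (\<lambda>t. torus_action (t *\<^sub>R \<eta>) p) | \<eta>. True}"

definition polarization_tends_to ::
  "(real \<Rightarrow> 'n toric_point \<Rightarrow> ('n, 'd) tangent_vector set) \<Rightarrow> 'n toric_point \<Rightarrow>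
     ('n, 'd) tangent_vector set \<Rightarrow> bool" where
  "polarization_tends_to D p L \<longleftrightarrow>
     limitin (positive_lagrangian_grassmannian p) (\<lambda>s. D s p) L at_top"

definition limit_polarization ::
  "(real \<Rightarrow> 'n toric_point \<Rightarrow> ('n, 'd) tangent_vector set) \<Rightarrow> 'n toric_point \<Rightarrow>
     ('n, 'd) tangent_vector set" where
  "limit_polarization D p = (THE L. polarization_tends_to D p L)"

text \<open>Sections over \<open>U\<close> of the sheaf \<open>C\<^sup>\<infinity>(D)\<close>.\<close>
definition smooth_sections ::
  "('n toric_point \<Rightarrow> ('n, 'd) tangent_vector set) \<Rightarrow> 'n toric_point set \<Rightarrow>
     ('n toric_point \<Rightarrow> ('n, 'd) tangent_vector) set" where
  "smooth_sections D U =
     {X \<in> (\<Pi>\<^sub>E p\<in>U. D p \<inter> tangent_space p). \<forall>\<sigma>.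
        smooth_on (darboux_chart \<sigma> ` (U \<inter> chart_domain \<sigma>))
          (\<lambda>u. component \<sigma> (X (chart_inverse \<sigma> u)))}"

end

end

theory Submission
  imports Defs
begin

text \<open>
  In a vertex chart write \<open>z\<^sub>j\<close> for the complex Darboux coordinates and \<open>l\<^sub>j = |z\<^sub>j|\<^sup>2 / 2\<close>. The
  derivative of the potential along \<open>l\<^sub>j\<close> is \<open>1/2 ln l\<^sub>j + h\<^sub>j\<close> with \<open>h\<^sub>j\<close> smooth over the whole star of
  the vertex, so the holomorphic coordinates are \<open>w\<^sub>j = z\<^sub>j exp h\<^sub>j / sqrt 2\<close>. A complexified tangent vector
  belongs to the holomorphic polarization iff the differentials of all \<open>cnj w\<^sub>j\<close> vanish on it, i.e. iff
  \<open>dzbar\<^sub>j + cnj z\<^sub>j \<Sum>\<^sub>m H\<^sub>j\<^sub>m dl\<^sub>m = 0\<close> for all \<open>j\<close>, where \<open>H = dh/dl = H\<^sub>0 + s K\<close> and \<open>K\<close> is the Hessian of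
  \<open>\<psi>\<close>. This description has no singularity on the facets, and reduces the limit at a point to
  linear algebra.

  The substitution \<open>dl\<^sub>j = cnj z\<^sub>j k\<^sub>j\<close> parametrises that space without dividing by \<open>z\<^sub>j\<close>:
  \<open>dz = 2k + z H (cnj z k)\<close> and \<open>dzbar = - cnj z H (cnj z k)\<close>. Symmetry of \<open>H\<close> makes it Lagrangian, and its
  Hermitian form is twice the energy \<open>|k|\<^sup>2 + \<langle>cnj z k, H (cnj z k)\<rangle>\<close>. At \<open>s = 0\<close> this energy is
  nonnegative: in the interior because of the positive Hessian of the potential, at the boundary by a limit along
  directions in which the singular terms vanish (\<open>hessian_form_nonneg\<close>, \<open>energy_nonneg\<close>).
  If \<open>dz\<close> is kept fixed, pairing the first equation with \<open>k\<close> bounds \<open>s \<langle>cnj z k, K (cnj z k)\<rangle>\<close>, so that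
  \<open>dl = cnj z k\<close> tends to zero as \<open>s\<close> grows and \<open>dzbar\<^sub>j\<close> tends to \<open>- (cnj z\<^sub>j / z\<^sub>j) dz\<^sub>j\<close>, or to \<open>0\<close> where
  \<open>z\<^sub>j = 0\<close> (\<open>tendsto_holomorphic_lift\<close>). Thus frames converge, which gives convergence in the Grassmannian.
  The limit is unique because the subspaces that miss a given closed ball form an open set
  (\<open>limit_in_positive_lagrangian_grassmannian_unique\<close>).

  The limit is given by \<open>dl\<^sub>j = 0\<close> where \<open>z\<^sub>j \<noteq> 0\<close> and \<open>dzbar\<^sub>j = 0\<close> where \<open>z\<^sub>j = 0\<close>. It contains the
  tangent space of the torus orbit, and equals it over the interior of the polytope, but at a boundary point it
  also contains the vectors \<open>\<partial>/\<partial>z\<^sub>j\<close> with \<open>z\<^sub>j = 0\<close>. No continuous section of the limit reaches these: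
  at the nearby points where \<open>z\<^sub>j\<close> is real and nonzero the component of the section along the real part of \<open>z\<^sub>j\<close>
  vanishes, hence also in the limit (\<open>continuous_section_mem_real_polarization\<close>). So both sheaves have the
  same sections.

  Different vertex charts are related by \<open>w'\<^sub>k = \<Prod>\<^sub>m w\<^sub>m powi B\<^sub>k\<^sub>m\<close> with integer exponents that are \<open>0\<close> or \<open>1\<close>
  wherever \<open>w\<^sub>m = 0\<close> (\<open>w_coord_transition\<close>). Solved for \<open>z\<close>, this shows that the transition maps are
  differentiable, so that every chart identifies the tangent space with \<open>\<complex>\<^sup>2\<^sup>n\<close>; and as the relation is
  holomorphic, all charts define the same polarization (\<open>hol_set_chart_independent\<close>).
\<close>

section \<open>Functions of class \<open>C\<^sup>2\<close>\<close>

abbreviation D where "D F x v \<equiv> frechet_derivative F (at x) v"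
abbreviation D2 where "D2 F x v w \<equiv> frechet_derivative (\<lambda>y. D F y v) (at x) w"

lemma Ck_on_2D:
  fixes F :: "'a::euclidean_space \<Rightarrow> 'b::real_normed_vector"
  assumes "open U" "Ck_on 2 U F" "x \<in> U"
  shows "F differentiable (at x)"
    and "(\<lambda>y. D F y v) differentiable (at x)"
    and "isCont (\<lambda>y. D2 F y v w) x"
  using assms
  by (auto simp: numeral_2_eq_2 differentiable_on_eq_differentiable_at continuous_on_eq_continuous_at)

lemma has_derivative_D:
  "F differentiable (at x) \<Longrightarrow> (F has_derivative D F x) (at x)"
  using frechet_derivative_works by blast

lemma linear_D: "F differentiable (at x) \<Longrightarrow> linear (D F x)"
  using has_derivative_D has_derivative_linear by blast

lemma D_eqI: "(F has_derivative F') (at x) \<Longrightarrow> D F x = F'"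
  using frechet_derivative_at by metis

lemma has_field_derivative_along_line:
  fixes F :: "'a::euclidean_space \<Rightarrow> real"
  assumes "F differentiable (at (a + t *\<^sub>R v))"
  shows "((\<lambda>t. F (a + t *\<^sub>R v)) has_real_derivative D F (a + t *\<^sub>R v) v) (at t)"
proof -
  have "((\<lambda>t. F (a + t *\<^sub>R v)) has_derivative (\<lambda>h. D F (a + t *\<^sub>R v) (h *\<^sub>R v))) (at t)"
    by (rule has_derivative_compose[of "\<lambda>t. a + t *\<^sub>R v" "\<lambda>h. h *\<^sub>R v"])
       (auto intro!: derivative_eq_intros has_derivative_D assms)
  moreover have "D F (a + t *\<^sub>R v) (h *\<^sub>R v) = D F (a + t *\<^sub>R v) v * h" for h
    using linear_D[OF assms] by (simp add: linear_cmul)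
  ultimately show ?thesis
    by (simp add: has_field_derivative_def)
qed

text \<open>The mean value theorem is applied first along \<open>v\<close>, to the difference of \<open>F\<close> at points differing
  by \<open>t w\<close>, and then along \<open>w\<close>, to the derivative of \<open>F\<close> in the direction \<open>v\<close>.\<close>
lemma second_difference_mean_value:
  fixes F :: "'a::euclidean_space \<Rightarrow> real"
  assumes U: "open U" "Ck_on 2 U F" and t: "t > 0"
    and box: "\<And>a b. 0 \<le> a \<Longrightarrow> a \<le> t \<Longrightarrow> 0 \<le> b \<Longrightarrow> b \<le> t \<Longrightarrow> x + a *\<^sub>R v + b *\<^sub>R w \<in> U"
  obtains a b where "0 < a" "a < t" "0 < b" "b < t"
    "F (x + t *\<^sub>R v + t *\<^sub>R w) - F (x + t *\<^sub>R v) - F (x + t *\<^sub>R w) + F x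
      = t * t * D2 F (x + a *\<^sub>R v + b *\<^sub>R w) v w"
proof -
  define f where "f = (\<lambda>a. F (x + t *\<^sub>R w + a *\<^sub>R v) - F (x + a *\<^sub>R v))"
  have mem: "x + t *\<^sub>R w + a *\<^sub>R v \<in> U" "x + a *\<^sub>R v \<in> U" if "0 \<le> a" "a \<le> t" for a
    using box[of a t] box[of a 0] that t by (auto simp: algebra_simps)
  have "(f has_real_derivative
      (D F (x + t *\<^sub>R w + a *\<^sub>R v) v - D F (x + a *\<^sub>R v) v)) (at a)" if "0 \<le> a" "a \<le> t" for a
    unfolding f_def
    by (intro DERIV_diff has_field_derivative_along_line Ck_on_2D(1)[OF U] mem that)
  from MVT2[OF t this] obtain a where a: "0 < a" "a < t"
    and fa: "f t - f 0 = t * (D F (x + t *\<^sub>R w + a *\<^sub>R v) v - D F (x + a *\<^sub>R v) v)"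
    by auto
  have "((\<lambda>b. D F (x + a *\<^sub>R v + b *\<^sub>R w) v) has_real_derivative D2 F (x + a *\<^sub>R v + b *\<^sub>R w) v w) (at b)"
    if "0 \<le> b" "b \<le> t" for b
    by (rule has_field_derivative_along_line, rule Ck_on_2D(2)[OF U])
       (use box[of a b] a that in auto)
  from MVT2[OF t this] obtain b where b: "0 < b" "b < t"
    and fb: "D F (x + a *\<^sub>R v + t *\<^sub>R w) v - D F (x + a *\<^sub>R v + 0 *\<^sub>R w) v
        = t * D2 F (x + a *\<^sub>R v + b *\<^sub>R w) v w"
    by auto
  have "f t - f 0 = t * t * D2 F (x + a *\<^sub>R v + b *\<^sub>R w) v w"
    using fa fb by (simp add: algebra_simps)
  then show ?thesis
    using a b that by (simp add: f_def algebra_simps)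
qed

text \<open>The second difference is symmetric in \<open>v\<close> and \<open>w\<close>, so both iterated derivatives take a common
  value at points arbitrarily close to \<open>x\<close>; continuity does the rest.\<close>
lemma second_derivative_symmetric:
  fixes F :: "'a::euclidean_space \<Rightarrow> real"
  assumes U: "open U" "Ck_on 2 U F" "x \<in> U"
  shows "D2 F x v w = D2 F x w v"
proof (rule ccontr)
  assume neq: "D2 F x v w \<noteq> D2 F x w v"
  define e where "e = \<bar>D2 F x v w - D2 F x w v\<bar> / 2"
  have e: "e > 0" using neq by (simp add: e_def)
  obtain d1 where d1: "d1 > 0" "\<And>y. dist y x < d1 \<Longrightarrow> dist (D2 F y v w) (D2 F x v w) < e"
    using Ck_on_2D(3)[OF U, of v w] e unfolding continuous_at_eps_delta by (metis dist_commute)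
  obtain d2 where d2: "d2 > 0" "\<And>y. dist y x < d2 \<Longrightarrow> dist (D2 F y w v) (D2 F x w v) < e"
    using Ck_on_2D(3)[OF U, of w v] e unfolding continuous_at_eps_delta by (metis dist_commute)
  obtain d3 where d3: "d3 > 0" "ball x d3 \<subseteq> U"
    using U open_contains_ball by blast
  define d where "d = min d1 (min d2 d3)"
  \<comment> \<open>The choice \<open>t K = d / 2\<close> keeps the whole parallelogram inside the ball of radius \<open>d\<close>.\<close>
  define K where "K = norm v + norm w + 1"
  define t where "t = d / (2 * K)"
  have d: "d > 0" using d1 d2 d3 by (simp add: d_def)
  have pos: "K > 0"
    by (simp add: K_def add_nonneg_pos)
  have t: "t > 0" using d pos by (simp add: t_def)
  have near: "dist (x + a *\<^sub>R v + b *\<^sub>R w) x < d" if "0 \<le> a" "a \<le> t" "0 \<le> b" "b \<le> t" for a b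
  proof -
    have "dist (x + a *\<^sub>R v + b *\<^sub>R w) x = norm (a *\<^sub>R v + b *\<^sub>R w)"
      by (simp add: dist_norm algebra_simps)
    also have "\<dots> \<le> norm (a *\<^sub>R v) + norm (b *\<^sub>R w)" by (rule norm_triangle_ineq)
    also have "\<dots> \<le> t * norm v + t * norm w"
      using that by (auto intro!: add_mono mult_right_mono)
    also have "\<dots> \<le> t * K"
      using t by (simp add: K_def algebra_simps)
    also have "\<dots> = d / 2" using pos by (simp add: t_def)
    also have "\<dots> < d" using d by simp
    finally show ?thesis .
  qed
  have box: "x + a *\<^sub>R v + b *\<^sub>R w \<in> U" if "0 \<le> a" "a \<le> t" "0 \<le> b" "b \<le> t" for a b
    using near[OF that] d3 by (auto simp: d_def dist_commute)
  obtain a b where ab: "0 < a" "a < t" "0 < b" "b < t"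
    "F (x + t *\<^sub>R v + t *\<^sub>R w) - F (x + t *\<^sub>R v) - F (x + t *\<^sub>R w) + F x
      = t * t * D2 F (x + a *\<^sub>R v + b *\<^sub>R w) v w"
    using second_difference_mean_value[OF U(1,2) t box] by blast
  have box': "x + a *\<^sub>R w + b *\<^sub>R v \<in> U" if "0 \<le> a" "a \<le> t" "0 \<le> b" "b \<le> t" for a b
    using box[of b a] that by (simp add: algebra_simps)
  obtain a' b' where ab': "0 < a'" "a' < t" "0 < b'" "b' < t"
    "F (x + t *\<^sub>R w + t *\<^sub>R v) - F (x + t *\<^sub>R w) - F (x + t *\<^sub>R v) + F x
      = t * t * D2 F (x + a' *\<^sub>R w + b' *\<^sub>R v) w v"
    using second_difference_mean_value[OF U(1,2) t box'] by blast
  have "t * t * D2 F (x + a *\<^sub>R v + b *\<^sub>R w) v w = t * t * D2 F (x + a' *\<^sub>R w + b' *\<^sub>R v) w v"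
    using ab(5) ab'(5) by (simp add: algebra_simps)
  then have eq: "D2 F (x + a *\<^sub>R v + b *\<^sub>R w) v w = D2 F (x + a' *\<^sub>R w + b' *\<^sub>R v) w v"
    using t by simp
  have 1: "dist (D2 F (x + a *\<^sub>R v + b *\<^sub>R w) v w) (D2 F x v w) < e"
    using near[of a b] ab by (intro d1) (auto simp: d_def)
  have 2: "dist (D2 F (x + a' *\<^sub>R w + b' *\<^sub>R v) w v) (D2 F x w v) < e"
    using near[of b' a'] ab' by (intro d2) (auto simp: d_def algebra_simps)
  show False
    using 1 2 eq unfolding e_def dist_real_def by (auto simp: abs_if split: if_splits)
qed

lemma linear_D2:
  fixes F :: "'a::euclidean_space \<Rightarrow> real"
  assumes "open U" "Ck_on 2 U F" "x \<in> U"
  shows "linear (D2 F x v)" "linear (\<lambda>v. D2 F x v w)"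
proof -
  show *: "linear (D2 F x v)" for v
    by (intro linear_D Ck_on_2D(2)[OF assms])
  have "(\<lambda>v. D2 F x v w) = D2 F x w"
    using second_derivative_symmetric[OF assms] by blast
  then show "linear (\<lambda>v. D2 F x v w)" using * by simp
qed

text \<open>Stated for bilinear second derivatives, because this property is read off from the explicit formula
  for Guillemin's potential, while it follows from symmetry for functions of class \<open>C\<^sup>2\<close>.\<close>
lemma Hess_quadratic_form:
  fixes F :: "real^'n \<Rightarrow> real"
  assumes "\<And>v. linear (D2 F x v)" "\<And>w. linear (\<lambda>v. D2 F x v w)"
  shows "v \<bullet> (Hess F x *v v) = D2 F x v v"
proof -
  have v: "v = (\<Sum>i\<in>UNIV. (v $ i) *\<^sub>R axis i 1)"
    by (simp add: vec_eq_iff axis_def if_distrib cong: if_cong)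
  have expand: "f v = (\<Sum>i\<in>UNIV. v $ i * f (axis i 1))" if "linear f" for f :: "real^'n \<Rightarrow> real"
    by (subst v) (simp add: linear_sum[OF that] linear_cmul[OF that])
  have "D2 F x v v = (\<Sum>i\<in>UNIV. v $ i * (\<Sum>j\<in>UNIV. v $ j * D2 F x (axis j 1) (axis i 1)))"
    using expand[OF assms(1)[of v]] expand[OF assms(2)] by simp
  then show ?thesis
    by (simp add: inner_vec_def matrix_vector_mult_def Hess_def mult.commute)
qed

lemma Ck_on_subset: "Ck_on k U F \<Longrightarrow> V \<subseteq> U \<Longrightarrow> Ck_on k V F"
  by (induction k arbitrary: F) (auto intro: continuous_on_subset differentiable_on_subset)

lemma Ck_on_2_zero: "Ck_on 2 UNIV (\<lambda>_. 0 :: 'b::real_normed_vector)"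
  by (simp add: numeral_2_eq_2 frechet_derivative_const)

lemma D_add_scaleR:
  fixes F :: "'a::euclidean_space \<Rightarrow> real"
  assumes "F differentiable (at x)" "G differentiable (at x)"
  shows "D (\<lambda>y. F y + s * G y) x v = D F x v + s * D G x v"
proof -
  have "((\<lambda>y. F y + s * G y) has_derivative (\<lambda>v. D F x v + s * D G x v)) (at x)"
    by (auto intro!: derivative_eq_intros has_derivative_D assms)
  then show ?thesis by (simp add: D_eqI)
qed

lemma frechet_derivative_cong_open:
  assumes "open U" "x \<in> U" "\<And>y. y \<in> U \<Longrightarrow> F y = G y"
  shows "D F x = D G x"
proof -
  have "(F has_derivative F') (at x) \<longleftrightarrow> (G has_derivative F') (at x)" for F'
    using has_derivative_transform_within_open[OF _ assms(1,2)] assms(3) by metis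
  then show ?thesis by (simp add: frechet_derivative_def)
qed

lemma D2_add_scaleR:
  fixes F :: "'a::euclidean_space \<Rightarrow> real"
  assumes U: "open U" "Ck_on 2 U F" "Ck_on 2 U G" "x \<in> U"
  shows "D2 (\<lambda>y. F y + s * G y) x v w = D2 F x v w + s * D2 G x v w"
proof -
  have "D (\<lambda>y. D (\<lambda>y. F y + s * G y) y v) x = D (\<lambda>y. D F y v + s * D G y v) x"
    by (rule frechet_derivative_cong_open[OF U(1,4)])
       (auto intro!: D_add_scaleR Ck_on_2D(1)[OF U(1)] U)
  then have "D2 (\<lambda>y. F y + s * G y) x v w = D (\<lambda>y. D F y v + s * D G y v) x w"
    by simp
  also have "\<dots> = D2 F x v w + s * D2 G x v w"
    by (auto intro!: D_add_scaleR Ck_on_2D(2)[OF U(1)] U)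
  finally show ?thesis .
qed

lemma Ck_on_2_add_scaleR:
  fixes F :: "'a::euclidean_space \<Rightarrow> real"
  assumes U: "open U" "Ck_on 2 U F" "Ck_on 2 U G"
  shows "Ck_on 2 U (\<lambda>y. F y + s * G y)"
proof -
  note c = Ck_on_2D[OF U(1,2)] Ck_on_2D[OF U(1,3)]
  have 1: "(\<lambda>y. F y + s * G y) differentiable_on U"
    using U c by (auto simp: differentiable_on_eq_differentiable_at intro!: differentiable_add differentiable_mult)
  have 2: "(\<lambda>y. D (\<lambda>y. F y + s * G y) y v) differentiable_on U" for v
  proof -
    have "(\<lambda>y. D F y v + s * D G y v) differentiable (at x)" if "x \<in> U" for x
      using that c by (intro differentiable_add differentiable_mult) auto
    then have *: "(\<lambda>y. D F y v + s * D G y v) differentiable (at x within U)" if "x \<in> U" for x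
      using that differentiable_at_withinI by blast
    show ?thesis
      unfolding differentiable_on_def
    proof
      fix x assume "x \<in> U"
      show "(\<lambda>y. D (\<lambda>y. F y + s * G y) y v) differentiable (at x within U)"
        by (rule differentiable_transform_within[OF *[OF \<open>x \<in> U\<close>] zero_less_one \<open>x \<in> U\<close>])
           (rule D_add_scaleR[symmetric]; use c in blast)
    qed
  qed
  have 3: "continuous_on U (\<lambda>y. D2 (\<lambda>y. F y + s * G y) y v w)" for v w
  proof -
    have "continuous_on U (\<lambda>y. D2 F y v w + s * D2 G y v w)"
      using U(1) c by (auto simp: continuous_on_eq_continuous_at intro!: continuous_intros)
    then show ?thesis
      by (rule continuous_on_eq) (use U in \<open>auto simp: D2_add_scaleR\<close>)
  qed
  show ?thesis using 1 2 3 by (simp add: numeral_2_eq_2)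
qed

lemma has_derivative_vec_iff:
  fixes f :: "'a::real_normed_vector \<Rightarrow> 'b::euclidean_space^'n"
  shows "(f has_derivative f') (at a within S) \<longleftrightarrow>
    (\<forall>i. ((\<lambda>x. f x $ i) has_derivative (\<lambda>h. f' h $ i)) (at a within S))"
  unfolding has_derivative_componentwise_within[of f] has_derivative_componentwise_within[of "\<lambda>x. f x $ _"]
  by (auto simp: Basis_vec_def inner_axis)

section \<open>Holomorphic and limiting subspaces in Darboux coordinates\<close>

text \<open>For a complexified tangent vector \<open>V\<close> the values \<open>dz V\<close> and \<open>dzbar V\<close> are independent: the two
  are conjugate to each other only if \<open>V\<close> is real.\<close>
definition dz :: "complex^('n::finite + 'n) \<Rightarrow> complex^'n" where
  "dz V = (\<chi> j. V $ Inl j + \<i> * V $ Inr j)"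

definition dzbar :: "complex^('n::finite + 'n) \<Rightarrow> complex^'n" where
  "dzbar V = (\<chi> j. V $ Inl j - \<i> * V $ Inr j)"

definition from_dz :: "complex^'n \<Rightarrow> complex^'n \<Rightarrow> complex^('n::finite + 'n)" where
  "from_dz a b = (\<chi> k. case k of Inl j \<Rightarrow> (a $ j + b $ j) / 2 | Inr j \<Rightarrow> (a $ j - b $ j) / (2 * \<i>))"

text \<open>The differential of \<open>l\<^sub>j = |z\<^sub>j|\<^sup>2 / 2\<close>.\<close>
definition dl :: "complex^'n \<Rightarrow> complex^('n::finite + 'n) \<Rightarrow> complex^'n" where
  "dl z V = (\<chi> j. complex_of_real (Re (z $ j)) * V $ Inl j + complex_of_real (Im (z $ j)) * V $ Inr j)"

definition of_real_mult :: "real^'n^'n \<Rightarrow> complex^'n \<Rightarrow> complex^'n" where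
  "of_real_mult H c = (\<chi> j. \<Sum>m\<in>UNIV. complex_of_real (H $ j $ m) * c $ m)"

text \<open>The common kernel of the differentials of \<open>cnj w\<^sub>j\<close>, where \<open>w\<^sub>j = z\<^sub>j exp (h\<^sub>j (l))\<close> and \<open>H\<close> is the
  Jacobian matrix of \<open>h\<close>.\<close>
definition holomorphic_space :: "complex^'n \<Rightarrow> real^'n^'n \<Rightarrow> (complex^('n::finite + 'n)) set" where
  "holomorphic_space z H = {V. \<forall>j. dzbar V $ j + cnj (z $ j) * of_real_mult H (dl z V) $ j = 0}"

text \<open>For \<open>z\<^sub>j \<noteq> 0\<close> the condition says \<open>dl\<^sub>j = 0\<close>. For \<open>z\<^sub>j = 0\<close> the quotient is \<open>0\<close> by convention
  and the condition says \<open>dzbar\<^sub>j = 0\<close>, which is what the limit of the holomorphic spaces requires.\<close>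
definition limit_space :: "complex^'n \<Rightarrow> (complex^('n::finite + 'n)) set" where
  "limit_space z = {V. \<forall>j. dzbar V $ j = - (cnj (z $ j) / z $ j) * dz V $ j}"

definition hermitian_form :: "real^'n^'n \<Rightarrow> complex^'n \<Rightarrow> real" where
  "hermitian_form H c = Re (\<Sum>j\<in>UNIV. cnj (c $ j) * of_real_mult H c $ j)"

definition cnj_mult :: "complex^'n \<Rightarrow> complex^'n \<Rightarrow> complex^'n" where
  "cnj_mult z k = (\<chi> j. cnj (z $ j) * k $ j)"

text \<open>The value of \<open>dz\<close> in terms of the parameter \<open>k\<close> of the holomorphic space.\<close>
definition frame_map :: "complex^'n \<Rightarrow> real^'n^'n \<Rightarrow> complex^'n \<Rightarrow> complex^'n" where
  "frame_map z H k = (\<chi> j. 2 * k $ j + z $ j * of_real_mult H (cnj_mult z k) $ j)"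

lemma dz_from_dz [simp]: "dz (from_dz a b) = a"
  by (simp add: dz_def from_dz_def vec_eq_iff field_simps)

lemma dzbar_from_dz [simp]: "dzbar (from_dz a b) = b"
  by (simp add: dzbar_def from_dz_def vec_eq_iff field_simps)

lemma from_dz_eq [simp]: "from_dz (dz V) (dzbar V) = V"
  by (auto simp: dz_def dzbar_def from_dz_def vec_eq_iff field_simps split: sum.splits)

lemma vec_eqI_dz: "dz V = dz W \<Longrightarrow> dzbar V = dzbar W \<Longrightarrow> V = W"
  by (metis from_dz_eq)

lemma dl_eq: "dl z V $ j = (cnj (z $ j) * dz V $ j + z $ j * dzbar V $ j) / 2"
  by (cases "z $ j") (simp add: dl_def dz_def dzbar_def complex_eq_iff algebra_simps)

lemma dz_add: "dz (V + W) = dz V + dz W" "dzbar (V + W) = dzbar V + dzbar W"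
  by (simp_all add: dz_def dzbar_def vec_eq_iff algebra_simps)

lemma dz_scale: "dz (c *s V) = c *s dz V" "dzbar (c *s V) = c *s dzbar V"
  by (simp_all add: dz_def dzbar_def vec_eq_iff algebra_simps)

lemma dl_linear: "dl z (V + W) = dl z V + dl z W" "dl z (c *s V) = c *s dl z V" "dl z 0 = 0"
  by (simp_all add: dl_def vec_eq_iff algebra_simps)

lemma dz_zero [simp]: "dz 0 = 0" "dzbar 0 = 0"
  by (simp_all add: dz_def dzbar_def vec_eq_iff)

lemma dz_sum: "dz (\<Sum>i\<in>A. f i) = (\<Sum>i\<in>A. dz (f i))" "dzbar (\<Sum>i\<in>A. f i) = (\<Sum>i\<in>A. dzbar (f i))"
  by (induction A rule: infinite_finite_induct) (simp_all add: dz_add)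

lemma of_real_mult_add: "of_real_mult H (a + b) = of_real_mult H a + of_real_mult H b"
  by (simp add: of_real_mult_def vec_eq_iff algebra_simps sum.distrib)

lemma of_real_mult_scale: "of_real_mult H (c *s a) = c *s of_real_mult H a"
  by (simp add: of_real_mult_def vec_eq_iff sum_distrib_left algebra_simps)

lemma of_real_mult_zero [simp]: "of_real_mult H 0 = 0"
  by (simp add: of_real_mult_def vec_eq_iff)

lemma hermitian_form_eq:
  "hermitian_form H c = (\<chi> j. Re (c $ j)) \<bullet> (H *v (\<chi> j. Re (c $ j)))
     + (\<chi> j. Im (c $ j)) \<bullet> (H *v (\<chi> j. Im (c $ j)))"
  by (simp add: hermitian_form_def of_real_mult_def inner_vec_def matrix_vector_mult_def
      sum.distrib [symmetric] sum_distrib_left algebra_simps)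

lemma hermitian_form_add_scaleR:
  "hermitian_form (H + s *\<^sub>R K) c = hermitian_form H c + s * hermitian_form K c"
  by (simp add: hermitian_form_eq matrix_vector_mult_add_rdistrib inner_add_right
      flip: scaleR_matrix_vector_assoc) (simp add: algebra_simps)

lemma subspace_holomorphic_space: "vec.subspace (holomorphic_space z H)"
proof (rule vec.subspaceI)
  show "0 \<in> holomorphic_space z H" by (simp add: holomorphic_space_def dl_linear)
  show "V + W \<in> holomorphic_space z H" if "V \<in> holomorphic_space z H" "W \<in> holomorphic_space z H" for V W
  proof -
    have "dzbar (V + W) $ j + cnj (z $ j) * of_real_mult H (dl z (V + W)) $ j
      = (dzbar V $ j + cnj (z $ j) * of_real_mult H (dl z V) $ j)
        + (dzbar W $ j + cnj (z $ j) * of_real_mult H (dl z W) $ j)" for j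
      by (simp add: dz_add dl_linear of_real_mult_add algebra_simps)
    then show ?thesis using that by (simp add: holomorphic_space_def)
  qed
  show "c *s V \<in> holomorphic_space z H" if "V \<in> holomorphic_space z H" for c V
  proof -
    have "dzbar (c *s V) $ j + cnj (z $ j) * of_real_mult H (dl z (c *s V)) $ j
      = c * (dzbar V $ j + cnj (z $ j) * of_real_mult H (dl z V) $ j)" for j
      by (simp add: dz_scale dl_linear of_real_mult_scale algebra_simps)
    then show ?thesis using that by (simp add: holomorphic_space_def)
  qed
qed

lemma subspace_limit_space: "vec.subspace (limit_space z)"
  by (rule vec.subspaceI) (auto simp: limit_space_def dz_add dz_scale algebra_simps add_divide_distrib)

text \<open>The parameter is \<open>k = (dz - z H dl) / 2\<close>. It stays meaningful where some \<open>z\<^sub>j\<close> vanishes, unlike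
  the quotient of \<open>dl\<^sub>j\<close> by \<open>cnj z\<^sub>j\<close>.\<close>
lemma holomorphic_space_parametrisation:
  assumes "V \<in> holomorphic_space z H"
  obtains k where "dl z V = cnj_mult z k"
    and "dz V = frame_map z H k"
    and "\<And>j. dzbar V $ j = - cnj (z $ j) * of_real_mult H (cnj_mult z k) $ j"
proof -
  define mu where "mu = of_real_mult H (dl z V)"
  define k where "k = (\<chi> j. (dz V $ j - z $ j * mu $ j) / 2)"
  have bar: "dzbar V $ j = - cnj (z $ j) * mu $ j" for j
    using assms by (simp add: holomorphic_space_def mu_def add_eq_0_iff2)
  have l: "dl z V = cnj_mult z k"
    by (simp add: vec_eq_iff dl_eq bar cnj_mult_def k_def algebra_simps diff_divide_distrib add_divide_distrib)
  show ?thesis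
  proof
    show "dl z V = cnj_mult z k" by fact
    show "dz V = frame_map z H k"
      by (simp add: frame_map_def vec_eq_iff flip: l mu_def) (simp add: k_def diff_divide_distrib)
    show "dzbar V $ j = - cnj (z $ j) * of_real_mult H (cnj_mult z k) $ j" for j
      by (simp add: bar flip: l mu_def)
  qed
qed

lemma parametrisation_mem_holomorphic_space:
  "from_dz (frame_map z H k) (\<chi> j. - cnj (z $ j) * of_real_mult H (cnj_mult z k) $ j)
     \<in> holomorphic_space z H" (is "?V \<in> _")
proof -
  have "dl z ?V = cnj_mult z k"
    by (simp add: vec_eq_iff dl_eq frame_map_def cnj_mult_def algebra_simps)
  then show ?thesis
    by (simp add: holomorphic_space_def)
qed

text \<open>The symplectic form \<open>\<Sum>\<^sub>j dq\<^sub>j \<and> dp\<^sub>j\<close> in Darboux coordinates.\<close>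
definition coord_omega :: "complex^('n::finite + 'n) \<Rightarrow> complex^('n + 'n) \<Rightarrow> complex" where
  "coord_omega V W = (\<Sum>j\<in>UNIV. V $ Inl j * W $ Inr j - V $ Inr j * W $ Inl j)"

lemma coord_omega_eq:
  "coord_omega V W = \<i> / 2 * (\<Sum>j\<in>UNIV. dz V $ j * dzbar W $ j - dzbar V $ j * dz W $ j)"
proof -
  have "V $ Inl j * W $ Inr j - V $ Inr j * W $ Inl j
      = \<i> / 2 * (dz V $ j * dzbar W $ j - dzbar V $ j * dz W $ j)" for j
    by (simp add: dz_def dzbar_def algebra_simps)
  then show ?thesis unfolding coord_omega_def sum_distrib_left by (intro sum.cong) auto
qed

lemma sum_of_real_mult_symmetric:
  assumes "transpose H = H"
  shows "(\<Sum>j\<in>UNIV. a $ j * of_real_mult H b $ j) = (\<Sum>j\<in>UNIV. b $ j * of_real_mult H a $ j)"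
proof -
  have s: "H $ i $ j = H $ j $ i" for i j
    using arg_cong[OF assms, of "\<lambda>M. M $ j $ i"] by (simp add: transpose_def)
  have "(\<Sum>j\<in>UNIV. a $ j * of_real_mult H b $ j) = (\<Sum>j\<in>UNIV. \<Sum>m\<in>UNIV. b $ m * (H $ m $ j * a $ j))"
    by (simp add: of_real_mult_def sum_distrib_left mult_ac s)
  also have "\<dots> = (\<Sum>m\<in>UNIV. \<Sum>j\<in>UNIV. b $ m * (H $ m $ j * a $ j))"
    by (rule sum.swap)
  finally show ?thesis
    by (simp add: of_real_mult_def sum_distrib_left)
qed

text \<open>In terms of the parameters the symplectic form becomes the antisymmetrisation of the bilinear
  form of \<open>H\<close>.\<close>
lemma holomorphic_space_isotropic:
  assumes "transpose H = H" "V \<in> holomorphic_space z H" "W \<in> holomorphic_space z H"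
  shows "coord_omega V W = 0"
proof -
  obtain k where k: "dz V = frame_map z H k"
    "\<And>j. dzbar V $ j = - cnj (z $ j) * of_real_mult H (cnj_mult z k) $ j"
    using holomorphic_space_parametrisation[OF assms(2)] by metis
  obtain l where l: "dz W = frame_map z H l"
    "\<And>j. dzbar W $ j = - cnj (z $ j) * of_real_mult H (cnj_mult z l) $ j"
    using holomorphic_space_parametrisation[OF assms(3)] by metis
  have "dz V $ j * dzbar W $ j - dzbar V $ j * dz W $ j
      = 2 * (cnj_mult z l $ j * of_real_mult H (cnj_mult z k) $ j
             - cnj_mult z k $ j * of_real_mult H (cnj_mult z l) $ j)" for j
    unfolding k l by (simp add: frame_map_def cnj_mult_def algebra_simps)
  then show ?thesis
    using sum_of_real_mult_symmetric[OF assms(1), of "cnj_mult z l" "cnj_mult z k"]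
    by (simp add: coord_omega_eq sum_subtractf flip: sum_distrib_left)
qed

text \<open>Where no \<open>z\<^sub>j\<close> vanishes, \<open>|k\<^sub>j|\<^sup>2 = |dl\<^sub>j|\<^sup>2 / (2 l\<^sub>j)\<close> for \<open>dl = cnj z k\<close>, so the energy is the Hermitian form of the full
  Hessian of the potential at \<open>dl\<close>.\<close>
definition energy :: "complex^'n \<Rightarrow> real^'n^'n \<Rightarrow> complex^'n \<Rightarrow> real" where
  "energy z H k = (\<Sum>j\<in>UNIV. (cmod (k $ j))\<^sup>2) + hermitian_form H (cnj_mult z k)"

lemma parametrisation_norms:
  assumes "dz V = frame_map z H k"
    and "\<And>j. dzbar V $ j = - cnj (z $ j) * of_real_mult H (cnj_mult z k) $ j"
  shows "(\<Sum>j\<in>UNIV. (cmod (dz V $ j))\<^sup>2 - (cmod (dzbar V $ j))\<^sup>2) = 4 * energy z H k"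
proof -
  have *: "(cmod (2 * a + b * m))\<^sup>2 - (cmod (- cnj b * m))\<^sup>2 = 4 * (cmod a)\<^sup>2 + 4 * Re (cnj (cnj b * a) * m)"
    for a b m :: complex
    by (simp only: cmod_power2) (simp add: power2_eq_square algebra_simps)
  have "(cmod (dz V $ j))\<^sup>2 - (cmod (dzbar V $ j))\<^sup>2
     = 4 * (cmod (k $ j))\<^sup>2 + 4 * Re (cnj (cnj_mult z k $ j) * of_real_mult H (cnj_mult z k) $ j)" for j
    unfolding assms using * by (simp add: frame_map_def cnj_mult_def)
  then show ?thesis
    by (simp add: energy_def hermitian_form_def sum.distrib sum_distrib_left)
qed

lemma holomorphic_space_positive:
  assumes "\<And>k. 0 \<le> energy z H k" "V \<in> holomorphic_space z H"
  shows "0 \<le> Re (- \<i> * coord_omega V (\<chi> k. cnj (V $ k)))"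
proof -
  have c: "dz (\<chi> k. cnj (V $ k)) $ j = cnj (dzbar V $ j)"
    "dzbar (\<chi> k. cnj (V $ k)) $ j = cnj (dz V $ j)" for j
    by (simp_all add: dz_def dzbar_def)
  have "- \<i> * coord_omega V (\<chi> k. cnj (V $ k))
      = of_real (1/2 * (\<Sum>j\<in>UNIV. (cmod (dz V $ j))\<^sup>2 - (cmod (dzbar V $ j))\<^sup>2))"
    by (simp add: coord_omega_eq c complex_norm_square[symmetric] flip: of_real_power)
  then have "Re (- \<i> * coord_omega V (\<chi> k. cnj (V $ k)))
      = 1/2 * (\<Sum>j\<in>UNIV. (cmod (dz V $ j))\<^sup>2 - (cmod (dzbar V $ j))\<^sup>2)"
    by (simp only: Re_complex_of_real)
  moreover obtain k where k: "dz V = frame_map z H k"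
    "\<And>j. dzbar V $ j = - cnj (z $ j) * of_real_mult H (cnj_mult z k) $ j"
    using holomorphic_space_parametrisation[OF assms(2)] by metis
  ultimately have "Re (- \<i> * coord_omega V (\<chi> k. cnj (V $ k))) = 2 * energy z H k"
    using parametrisation_norms[OF k] by linarith
  then show ?thesis using assms(1)[of k] by linarith
qed

text \<open>This identity gives both the invertibility of the frame map and the estimate for large \<open>s\<close>.\<close>
lemma frame_map_pairing:
  "Re (\<Sum>j\<in>UNIV. cnj (k $ j) * frame_map z H k $ j) = (\<Sum>j\<in>UNIV. (cmod (k $ j))\<^sup>2) + energy z H k"
proof -
  have "cnj (k $ j) * frame_map z H k $ j
      = of_real (2 * (cmod (k $ j))\<^sup>2) + cnj (cnj_mult z k $ j) * of_real_mult H (cnj_mult z k) $ j" for j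
    by (simp add: frame_map_def cnj_mult_def algebra_simps complex_norm_square flip: of_real_power)
  then show ?thesis
    by (simp add: energy_def hermitian_form_def sum.distrib sum_distrib_left)
qed

lemma linear_frame_map: "linear (frame_map z H)"
proof (rule linearI)
  have "cnj_mult z (a + b) = cnj_mult z a + cnj_mult z b" for a b
    by (simp add: cnj_mult_def vec_eq_iff algebra_simps)
  then show "frame_map z H (a + b) = frame_map z H a + frame_map z H b" for a b
    by (simp add: frame_map_def of_real_mult_add) (simp add: vec_eq_iff algebra_simps)
  have "cnj_mult z (r *\<^sub>R a) = of_real r *s cnj_mult z a" for r a
    unfolding vec_eq_iff by (simp add: cnj_mult_def scaleR_conv_of_real[where 'a=complex])
  then show "frame_map z H (r *\<^sub>R a) = r *\<^sub>R frame_map z H a" for r a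
    by (simp add: frame_map_def of_real_mult_scale) (simp add: vec_eq_iff scaleR_conv_of_real[where 'a=complex] algebra_simps)
qed

lemma norm_sq_vec: "(norm (k :: complex^'n))\<^sup>2 = (\<Sum>j\<in>UNIV. (cmod (k $ j))\<^sup>2)"
  by (simp add: norm_vec_def L2_set_def sum_nonneg)

lemma surj_frame_map:
  assumes "\<And>k. 0 \<le> energy z H k"
  shows "surj (frame_map z H)"
proof -
  have "inj (frame_map z H)"
  proof (rule linear_injective_0[OF linear_frame_map, THEN iffD2], intro allI impI)
    fix k assume "frame_map z H k = 0"
    then have "(norm k)\<^sup>2 + energy z H k = 0"
      using frame_map_pairing[of k z H] by (simp add: norm_sq_vec)
    then have "(norm k)\<^sup>2 = 0"
      using assms[of k] by (metis add_nonneg_eq_0_iff zero_le_power2)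
    then show "k = 0" by simp
  qed
  then show ?thesis
    by (simp add: linear_frame_map linear_injective_imp_surjective)
qed

text \<open>So the holomorphic space is the graph of a linear map over the values of \<open>dz\<close>.\<close>
lemma dz_determines_holomorphic_space:
  assumes "\<And>k. 0 \<le> energy z H k"
  shows "\<exists>!V. V \<in> holomorphic_space z H \<and> dz V = a"
proof -
  obtain k where "frame_map z H k = a"
    using surj_frame_map[OF assms] by (metis surj_def)
  then have "\<exists>V. V \<in> holomorphic_space z H \<and> dz V = a"
    using parametrisation_mem_holomorphic_space[of z H k] by (metis dz_from_dz)
  moreover have "V = W" if VW: "V \<in> holomorphic_space z H" "dz V = a" "W \<in> holomorphic_space z H" "dz W = a" for V W
  proof -
    obtain k where k: "dz V = frame_map z H k"
      "\<And>j. dzbar V $ j = - cnj (z $ j) * of_real_mult H (cnj_mult z k) $ j"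
      using holomorphic_space_parametrisation[OF VW(1)] by metis
    obtain l where l: "dz W = frame_map z H l"
      "\<And>j. dzbar W $ j = - cnj (z $ j) * of_real_mult H (cnj_mult z l) $ j"
      using holomorphic_space_parametrisation[OF VW(3)] by metis
    have "frame_map z H k = frame_map z H l" using k l VW by simp
    moreover have "inj (frame_map z H)"
      using surj_frame_map[OF assms] linear_frame_map linear_surjective_imp_injective by blast
    ultimately have "k = l" by (simp add: inj_eq)
    then have "dzbar V = dzbar W" by (subst vec_eq_iff) (simp only: k(2) l(2), simp)
    then show "V = W" using VW by (intro vec_eqI_dz) auto
  qed
  ultimately show ?thesis by blast
qed

text \<open>If the differentials of both \<open>w\<^sub>j\<close> and \<open>cnj w\<^sub>j\<close> vanish on \<open>V\<close>, then \<open>dz\<close> and \<open>dzbar\<close> have equal norms and the energy is zero.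
  Hence \<open>w\<close> is a local chart.\<close>
lemma complementary_to_conjugate:
  assumes pos: "\<And>k. k \<noteq> 0 \<Longrightarrow> 0 < energy z H k"
    and bar: "V \<in> holomorphic_space z H"
    and hol: "\<And>j. dz V $ j + z $ j * of_real_mult H (dl z V) $ j = 0"
  shows "V = 0"
proof -
  obtain k where k: "dl z V = cnj_mult z k" "dz V = frame_map z H k"
    "\<And>j. dzbar V $ j = - cnj (z $ j) * of_real_mult H (cnj_mult z k) $ j"
    using holomorphic_space_parametrisation[OF bar] by metis
  have "cmod (dz V $ j) = cmod (dzbar V $ j)" for j
    using hol[of j] k(1,3) by (simp add: add_eq_0_iff2 norm_mult)
  then have "4 * energy z H k = 0"
    using parametrisation_norms[OF k(2,3)] by simp
  then have "k = 0" using pos[of k] by force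
  then have "dl z V = 0" "dz V = 0" "dzbar V = 0"
    using k by (simp_all add: frame_map_def cnj_mult_def vec_eq_iff of_real_mult_def)
  then show ?thesis
    by (intro vec_eqI_dz) (auto simp: vec_eq_iff dz_def dzbar_def)
qed

lemma energy_add_scaleR:
  "energy z (H + s *\<^sub>R K) k = energy z H k + s * hermitian_form K (cnj_mult z k)"
  by (simp add: energy_def hermitian_form_add_scaleR)

text \<open>The constant is the minimum of the quadratic form on the unit sphere.\<close>
lemma positive_definite_coercive:
  fixes K :: "real^'n^'n"
  assumes "positive_definite K"
  obtains c where "c > 0" "\<And>a. c * (norm a)\<^sup>2 \<le> hermitian_form K a"
proof -
  have ne: "sphere (0 :: real^'n) 1 \<noteq> {}" by simp
  have cont: "continuous_on (sphere 0 1) (\<lambda>v :: real^'n. v \<bullet> (K *v v))"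
    by (intro continuous_intros)
  obtain v0 :: "real^'n" where v0: "v0 \<in> sphere 0 1"
    "\<And>v. v \<in> sphere 0 1 \<Longrightarrow> v0 \<bullet> (K *v v0) \<le> v \<bullet> (K *v v)"
    using continuous_attains_inf[OF compact_sphere ne cont] by blast
  define c where "c = v0 \<bullet> (K *v v0)"
  have "v0 \<noteq> 0" using v0(1) by auto
  then have c: "c > 0"
    using assms by (simp add: c_def positive_definite_def)
  have bound: "c * (norm v)\<^sup>2 \<le> v \<bullet> (K *v v)" for v :: "real^'n"
  proof (cases "v = 0")
    case False
    define u where "u = (1 / norm v) *\<^sub>R v"
    have "u \<in> sphere 0 1" using False by (simp add: u_def)
    then have "c \<le> u \<bullet> (K *v u)" using v0 c_def by blast
    moreover have "v = norm v *\<^sub>R u" using False by (simp add: u_def)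
    then have "v \<bullet> (K *v v) = (norm v)\<^sup>2 * (u \<bullet> (K *v u))"
      by (metis (no_types, lifting) inner_scaleR_left inner_scaleR_right matrix_scaleR_vector_ac
          mult.assoc power2_eq_square scaleR_matrix_vector_assoc)
    ultimately show ?thesis
      by (simp add: mult.commute mult_right_mono)
  qed simp
  have "c * (norm a)\<^sup>2 \<le> hermitian_form K a" for a
  proof -
    have "(norm a)\<^sup>2 = (norm (\<chi> j. Re (a $ j)))\<^sup>2 + (norm (\<chi> j. Im (a $ j)))\<^sup>2"
      by (simp add: norm_vec_def L2_set_def sum_nonneg cmod_power2 sum.distrib)
    then show ?thesis
      using bound[of "\<chi> j. Re (a $ j)"] bound[of "\<chi> j. Im (a $ j)"]
      by (simp add: hermitian_form_eq algebra_simps)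
  qed
  with c that show ?thesis by blast
qed

text \<open>The form of \<open>K\<close> does not see \<open>k\<close> when \<open>cnj z k = 0\<close>, but then the energy is the squared norm of
  \<open>k\<close>.\<close>
lemma energy_perturbed_pos:
  assumes nonneg: "\<And>k. 0 \<le> energy z H k" and K: "positive_definite K" and s: "s > 0" and k: "k \<noteq> 0"
  shows "0 < energy z (H + s *\<^sub>R K) k"
proof -
  obtain c where c: "c > 0" "\<And>a. c * (norm a)\<^sup>2 \<le> hermitian_form K a"
    using positive_definite_coercive[OF K] by blast
  show ?thesis
  proof (cases "cnj_mult z k = 0")
    case True
    then have "energy z (H + s *\<^sub>R K) k = (norm k)\<^sup>2"
      by (simp add: energy_def norm_sq_vec hermitian_form_def)
    then show ?thesis using k by simp
  next
    case False
    have "0 < c * (norm (cnj_mult z k))\<^sup>2" using False c by simp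
    also have "\<dots> \<le> hermitian_form K (cnj_mult z k)" by (rule c)
    finally have "0 < s * hermitian_form K (cnj_mult z k)" using s by simp
    then show ?thesis using nonneg[of k] by (simp add: energy_add_scaleR)
  qed
qed

definition holomorphic_lift :: "complex^'n \<Rightarrow> real^'n^'n \<Rightarrow> complex^'n \<Rightarrow> complex^('n::finite + 'n)" where
  "holomorphic_lift z H a = (THE V. V \<in> holomorphic_space z H \<and> dz V = a)"

lemma
  assumes "\<And>k. 0 \<le> energy z H k"
  shows holomorphic_lift_mem: "holomorphic_lift z H a \<in> holomorphic_space z H"
    and dz_holomorphic_lift: "dz (holomorphic_lift z H a) = a"
  using theI'[OF dz_determines_holomorphic_space[OF assms, of a]] unfolding holomorphic_lift_def by auto

text \<open>With \<open>dz = a\<close> fixed, the energy identity bounds \<open>s |cnj z k|\<^sup>2\<close> by a multiple of \<open>|a|\<^sup>2\<close>, so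
  \<open>dl = cnj z k\<close> tends to zero; and \<open>dzbar\<^sub>j\<close> is an affine function of \<open>dl\<^sub>j / cnj z\<^sub>j\<close> where \<open>z\<^sub>j \<noteq> 0\<close>,
  and zero where \<open>z\<^sub>j = 0\<close>.\<close>
lemma tendsto_holomorphic_lift:
  assumes nonneg: "\<And>k. 0 \<le> energy z H k" and K: "positive_definite K"
  shows "((\<lambda>s. holomorphic_lift z (H + s *\<^sub>R K) a) \<longlongrightarrow>
           from_dz a (\<chi> j. - (cnj (z $ j) / z $ j) * a $ j)) at_top"
proof -
  obtain c where c: "c > 0" "\<And>b. c * (norm b)\<^sup>2 \<le> hermitian_form K b"
    using positive_definite_coercive[OF K] by blast
  define V where "V s = holomorphic_lift z (H + s *\<^sub>R K) a" for s
  have ev: "\<forall>\<^sub>F s in at_top. (s::real) > 0" by (rule eventually_gt_at_top)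
  have key: "norm (dl z (V s)) \<le> norm a / sqrt (s * c)" 
    and bar: "dzbar (V s) $ j = (cnj (z $ j) / z $ j) * (2 * (dl z (V s) $ j / cnj (z $ j)) - a $ j)"
    if s: "s > 0" for s j
  proof -
    have nn: "0 \<le> energy z (H + s *\<^sub>R K) k" for k
    proof (cases "k = 0")
      case True
      then show ?thesis by (simp add: energy_def hermitian_form_def cnj_mult_def of_real_mult_def)
    next
      case False
      then show ?thesis using energy_perturbed_pos[OF nonneg K s] by (simp add: less_imp_le)
    qed
    obtain k where k: "dl z (V s) = cnj_mult z k" "dz (V s) = frame_map z (H + s *\<^sub>R K) k"
      "\<And>j. dzbar (V s) $ j = - cnj (z $ j) * of_real_mult (H + s *\<^sub>R K) (cnj_mult z k) $ j"
      using holomorphic_space_parametrisation holomorphic_lift_mem[OF nn, of a]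
      unfolding V_def by metis
    have a: "frame_map z (H + s *\<^sub>R K) k = a"
      using k(2) dz_holomorphic_lift[OF nn] by (simp add: V_def)
    have pairing: "Re (\<Sum>j\<in>UNIV. cnj (k $ j) * a $ j) \<le> norm k * norm a"
    proof -
      have "Re (\<Sum>j\<in>UNIV. cnj (k $ j) * a $ j) = k \<bullet> a"
        by (simp add: inner_vec_def inner_complex_def)
      then show ?thesis using norm_cauchy_schwarz[of k a] by simp
    qed
    have "(norm k)\<^sup>2 + energy z H k + s * hermitian_form K (cnj_mult z k) \<le> norm k * norm a"
      using frame_map_pairing[of k z "H + s *\<^sub>R K"] pairing a
      by (simp add: norm_sq_vec energy_add_scaleR)
    moreover have "s * (c * (norm (cnj_mult z k))\<^sup>2) \<le> s * hermitian_form K (cnj_mult z k)"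
      using c(2) s by (intro mult_left_mono) auto
    ultimately have est: "(norm k)\<^sup>2 + s * (c * (norm (cnj_mult z k))\<^sup>2) \<le> norm k * norm a"
      using nonneg[of k] by linarith
    have "norm k * norm a \<le> (norm k)\<^sup>2 + (norm a)\<^sup>2"
      using sum_squares_bound[of "norm k" "norm a"] mult_nonneg_nonneg[OF norm_ge_zero[of k] norm_ge_zero[of a]]
      by linarith
    with est have "s * c * (norm (cnj_mult z k))\<^sup>2 \<le> (norm a)\<^sup>2"
      by (simp add: mult.assoc)
    then have "(norm (cnj_mult z k))\<^sup>2 \<le> (norm a / sqrt (s * c))\<^sup>2"
      using s c by (simp add: power_divide field_simps)
    then show "norm (dl z (V s)) \<le> norm a / sqrt (s * c)"
      unfolding k by (rule power2_le_imp_le) (use s c in simp)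
    show "dzbar (V s) $ j = (cnj (z $ j) / z $ j) * (2 * (dl z (V s) $ j / cnj (z $ j)) - a $ j)"
    proof (cases "z $ j = 0")
      case True
      then show ?thesis by (simp add: k)
    next
      case False
      have "a $ j = 2 * k $ j + z $ j * of_real_mult (H + s *\<^sub>R K) (cnj_mult z k) $ j"
        using a by (auto simp: frame_map_def)
      then show ?thesis using False by (simp add: k(1,3)) (simp add: cnj_mult_def)
    qed
  qed
  have "filterlim (\<lambda>s. s * c) at_top at_top"
    using filterlim_tendsto_pos_mult_at_top[OF tendsto_const c(1) filterlim_ident] by (simp add: mult.commute)
  then have "((\<lambda>s. norm a / sqrt (s * c)) \<longlongrightarrow> 0) at_top"
    by (intro tendsto_divide_0[OF tendsto_const] filterlim_at_top_imp_at_infinity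
        filterlim_compose[OF sqrt_at_top])
  then have "((\<lambda>s. dl z (V s)) \<longlongrightarrow> 0) at_top"
    using Lim_null_comparison[OF eventually_mono[OF ev key]] by simp
  then have dl: "((\<lambda>s. dl z (V s) $ j) \<longlongrightarrow> 0) at_top" for j
    using tendsto_vec_nth by fastforce
  have "((\<lambda>s. (cnj (z $ j) / z $ j) * (2 * (dl z (V s) $ j / cnj (z $ j)) - a $ j)) \<longlongrightarrow>
      (cnj (z $ j) / z $ j) * (2 * (0 * inverse (cnj (z $ j))) - a $ j)) at_top" for j
    unfolding divide_inverse[of "dl z _ $ j"] by (intro tendsto_intros dl)
  then have "((\<lambda>s. dzbar (V s) $ j) \<longlongrightarrow> (cnj (z $ j) / z $ j) * (2 * (0 * inverse (cnj (z $ j))) - a $ j)) at_top" for j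
    by (rule Lim_transform_eventually[OF _ eventually_mono[OF ev]]) (simp add: bar)
  then have bar_lim: "((\<lambda>s. dzbar (V s) $ j) \<longlongrightarrow> - (cnj (z $ j) / z $ j) * a $ j) at_top" for j
    by simp
  have dzV: "\<forall>\<^sub>F s in at_top. dz (V s) = a"
    using ev
  proof eventually_elim
    case (elim s)
    have "0 \<le> energy z (H + s *\<^sub>R K) k" for k
      using nonneg[of k] c(2)[of "cnj_mult z k"] c(1) elim
      by (simp add: energy_add_scaleR) (smt (verit) mult_nonneg_nonneg zero_le_power2)
    then show ?case by (simp add: V_def dz_holomorphic_lift)
  qed
  define b where "b = (\<chi> j. - (cnj (z $ j) / z $ j) * a $ j)"
  have "((\<lambda>s. dzbar (V s) $ j) \<longlongrightarrow> b $ j) at_top" for j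
    using bar_lim[of j] by (simp add: b_def)
  then have "((\<lambda>s. dzbar (V s)) \<longlongrightarrow> b) at_top"
    by (rule vec_tendstoI)
  then have "((\<lambda>s. from_dz a (dzbar (V s)) $ i) \<longlongrightarrow> from_dz a b $ i) at_top" for i
    by (cases i) (auto simp: from_dz_def intro!: tendsto_intros)
  then have "((\<lambda>s. from_dz a (dzbar (V s)) $ i) \<longlongrightarrow>
      from_dz a (\<chi> j. - (cnj (z $ j) / z $ j) * a $ j) $ i) at_top" for i
    unfolding b_def .
  then have "((\<lambda>s. from_dz a (dzbar (V s))) \<longlongrightarrow> from_dz a (\<chi> j. - (cnj (z $ j) / z $ j) * a $ j)) at_top"
    by (rule vec_tendstoI)
  then have "(V \<longlongrightarrow> from_dz a (\<chi> j. - (cnj (z $ j) / z $ j) * a $ j)) at_top"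
    by (rule Lim_transform_eventually) (use dzV in \<open>auto elim!: eventually_mono dest: sym\<close>)
  then show ?thesis unfolding V_def[abs_def] .
qed

lemma limit_space_lift:
  "from_dz a (\<chi> j. - (cnj (z $ j) / z $ j) * a $ j) \<in> limit_space z"
  by (simp add: limit_space_def)

lemma limit_space_eqI:
  "V \<in> limit_space z \<Longrightarrow> W \<in> limit_space z \<Longrightarrow> dz V = dz W \<Longrightarrow> V = W"
  by (rule vec_eqI_dz) (auto simp: limit_space_def vec_eq_iff)

text \<open>The complex span of the vectors \<open>\<partial>/\<partial>\<vartheta>\<^sub>j\<close>, which vanish where \<open>z\<^sub>j = 0\<close>.\<close>
definition orbit_space :: "complex^'n \<Rightarrow> (complex^('n::finite + 'n)) set" where
  "orbit_space z = {V. \<exists>c. \<forall>j. dz V $ j = \<i> * c $ j * z $ j \<and> dzbar V $ j = - \<i> * c $ j * cnj (z $ j)}"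

lemma subspace_orbit_space: "vec.subspace (orbit_space z)"
proof (rule vec.subspaceI)
  show "0 \<in> orbit_space z" by (auto simp: orbit_space_def intro!: exI[of _ 0])
  show "V + W \<in> orbit_space z" if VW: "V \<in> orbit_space z" "W \<in> orbit_space z" for V W
  proof -
    obtain c d where "\<forall>j. dz V $ j = \<i> * c $ j * z $ j \<and> dzbar V $ j = - \<i> * c $ j * cnj (z $ j)"
      "\<forall>j. dz W $ j = \<i> * d $ j * z $ j \<and> dzbar W $ j = - \<i> * d $ j * cnj (z $ j)"
      using VW unfolding orbit_space_def by blast
    then show ?thesis by (auto simp: orbit_space_def dz_add algebra_simps intro!: exI[of _ "c + d"])
  qed
  show "a *s V \<in> orbit_space z" if V: "V \<in> orbit_space z" for a V
  proof -
    obtain c where "\<forall>j. dz V $ j = \<i> * c $ j * z $ j \<and> dzbar V $ j = - \<i> * c $ j * cnj (z $ j)"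
      using V unfolding orbit_space_def by blast
    then show ?thesis by (auto simp: orbit_space_def dz_scale algebra_simps intro!: exI[of _ "a *s c"])
  qed
qed

lemma orbit_space_subset_limit_space: "orbit_space z \<subseteq> limit_space z"
proof
  fix V assume "V \<in> orbit_space z"
  then obtain c where c: "\<And>j. dz V $ j = \<i> * c $ j * z $ j" "\<And>j. dzbar V $ j = - \<i> * c $ j * cnj (z $ j)"
    unfolding orbit_space_def by blast
  have "dzbar V $ j = - (cnj (z $ j) / z $ j) * dz V $ j" for j
    by (cases "z $ j = 0") (simp_all add: c)
  then show "V \<in> limit_space z" by (simp add: limit_space_def)
qed

section \<open>Convergence in the positive Lagrangian Grassmannian\<close>

lemma subspace_range_matrix: "vec.subspace (range ((*v) (M :: 'a::field^'n^'m)))"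
proof (rule vec.subspaceI)
  show "0 \<in> range ((*v) M)" by (metis matrix_vector_mult_0_right rangeI)
  show "x + y \<in> range ((*v) M)" if "x \<in> range ((*v) M)" "y \<in> range ((*v) M)" for x y
    using that by (auto simp flip: matrix_vector_right_distrib)
  show "c *s x \<in> range ((*v) M)" if "x \<in> range ((*v) M)" for c x
    using that by (auto simp flip: vector_scalar_commute)
qed

lemma span_columns: "vec.span (columns (M :: 'a::field^'n^'m)) = range ((*v) M)"
proof
  have "columns M \<subseteq> range ((*v) M)"
  proof
    fix x assume "x \<in> columns M"
    then obtain i where "x = column i M" by (auto simp: columns_def)
    then have "x = M *v axis i 1"
      by (simp add: vec_eq_iff column_def matrix_vector_mult_def axis_def if_distrib cong: if_cong)
    then show "x \<in> range ((*v) M)" by blast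
  qed
  then show "vec.span (columns M) \<subseteq> range ((*v) M)"
    by (rule vec.span_minimal[OF _ subspace_range_matrix])
  show "range ((*v) M) \<subseteq> vec.span (columns M)"
    by (auto simp: matrix_vector_mult_in_columnspace_gen)
qed

lemma dim_columns_eq_card_iff:
  fixes M :: "'a::field^'n^'m"
  shows "vec.dim (columns M) = CARD('n) \<longleftrightarrow> (\<forall>c. M *v c = 0 \<longrightarrow> c = 0)"
proof
  assume "\<forall>c. M *v c = 0 \<longrightarrow> c = 0"
  then have inj: "inj ((*v) M)"
    by (simp add: vec.inj_iff_eq_0)
  have "vec.dim (columns M) = vec.dim (range ((*v) M))"
    by (metis span_columns vec.dim_span)
  also have "\<dots> = vec.dim (UNIV :: ('a^'n) set)"
    by (rule vec.dim_image_eq) (use inj in auto)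
  finally show "vec.dim (columns M) = CARD('n)" by (simp only: vec_dim_card)
next
  assume dim: "vec.dim (columns M) = CARD('n)"
  show "\<forall>c. M *v c = 0 \<longrightarrow> c = 0"
  proof (intro allI impI, rule ccontr)
    fix c assume c: "M *v c = 0" "c \<noteq> 0"
    then obtain k where k: "c $ k \<noteq> 0" by (metis vec_eq_iff zero_index)
    define B where "B = (\<lambda>i. column i M) ` (UNIV - {k})"
    have "0 = (\<Sum>i\<in>UNIV. c $ i *s column i M)"
      using c by (simp add: matrix_mult_sum)
    also have "\<dots> = c $ k *s column k M + (\<Sum>i\<in>UNIV - {k}. c $ i *s column i M)"
      by (simp add: sum.remove)
    finally have "c $ k *s column k M = - (\<Sum>i\<in>UNIV - {k}. c $ i *s column i M)"
      by (simp add: eq_neg_iff_add_eq_0)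
    moreover have "- (\<Sum>i\<in>UNIV - {k}. c $ i *s column i M) \<in> vec.span B"
      by (intro vec.span_neg vec.span_sum vec.span_scale vec.span_base) (auto simp: B_def)
    ultimately have "c $ k *s column k M \<in> vec.span B" by simp
    then have "inverse (c $ k) *s (c $ k *s column k M) \<in> vec.span B"
      by (rule vec.span_scale)
    then have "column k M \<in> vec.span B"
      using k by (simp add: vector_smult_assoc)
    then have "columns M \<subseteq> vec.span B"
      unfolding columns_def by (auto simp: B_def) (metis (no_types, lifting) DiffI UNIV_I image_eqI singletonD vec.span_base)
    moreover have "finite B" by (simp add: B_def)
    ultimately have "vec.dim (columns M) \<le> card B"
      by (rule vec.dim_le_card)
    also have "\<dots> \<le> card (UNIV - {k} :: 'n set)"
      unfolding B_def by (rule card_image_le) simp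
    also have "\<dots> < CARD('n)"
      by (simp add: card_Diff_singleton)
    finally show False using dim by simp
  qed
qed

lemma scaleR_eq_complex_scale: "r *\<^sub>R x = complex_of_real r *s (x :: complex^'n)"
  unfolding vec_eq_iff by (simp add: scaleR_conv_of_real[where 'a=complex])

lemma real_subspace_if_complex_subspace:
  assumes "vec.subspace (L :: (complex^'n) set)"
  shows "subspace L"
  using assms by (auto simp: subspace_def vec.subspace_def scaleR_eq_complex_scale)

lemma bounded_bilinear_complex_matrix_vector_mult:
  "bounded_bilinear ((*v) :: complex^'n^'m \<Rightarrow> complex^'n \<Rightarrow> complex^'m)"
proof -
  have "linear (\<lambda>c. M *v c)" for M :: "complex^'n^'m"
    by (intro linearI) (simp_all add: matrix_vector_right_distrib scaleR_eq_complex_scale vector_scalar_commute)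
  moreover have "linear (\<lambda>M :: complex^'n^'m. M *v c)" for c
  proof (rule linearI)
    show "(r *\<^sub>R M) *v c = r *\<^sub>R (M *v c)" for r and M :: "complex^'n^'m"
      unfolding vec_eq_iff by (simp add: matrix_vector_mult_def scaleR_sum_right)
  qed (simp add: matrix_vector_mult_add_rdistrib)
  ultimately have "bilinear ((*v) :: complex^'n^'m \<Rightarrow> complex^'n \<Rightarrow> complex^'m)"
    by (simp add: bilinear_def)
  then show ?thesis by (simp add: bilinear_conv_bounded_bilinear)
qed

text \<open>If \<open>N c\<close> lies in the ball then \<open>c\<close> is bounded in terms of the lower bound of \<open>M\<close>, provided that
  \<open>N\<close> is close to \<open>M\<close>. Then \<open>M c\<close> is close to \<open>N c\<close>, while the range of \<open>M\<close> has positive distance from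
  the ball.\<close>
lemma range_avoids_cball_open:
  fixes M :: "complex^'n^'m"
  assumes inj: "\<forall>c. M *v c = 0 \<longrightarrow> c = 0" and avoid: "\<And>c. M *v c \<notin> cball v d"
  obtains e where "e > 0" "\<And>N c. dist N M < e \<Longrightarrow> N *v c \<notin> cball v d"
proof -
  interpret bounded_bilinear "(*v) :: complex^'n^'m \<Rightarrow> complex^'n \<Rightarrow> complex^'m"
    by (rule bounded_bilinear_complex_matrix_vector_mult)
  obtain B where B: "B > 0"
    and "\<forall>N c. norm ((N :: complex^'n^'m) *v c) \<le> norm N * norm c * B"
    using pos_bounded by (elim exE conjE)
  then have bound: "norm (N *v c) \<le> norm N * norm c * B" for N :: "complex^'n^'m" and c
    by simp
  have lin: "linear ((*v) M)"
    by (rule bounded_linear.linear[OF bounded_linear_right])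
  have "inj ((*v) M)"
    using inj by (simp add: vec.inj_iff_eq_0)
  from linear_inj_bounded_below_pos[OF lin this]
  obtain m where m: "m > 0" "\<And>c. m * norm c \<le> norm (M *v c)"
    by blast
  have sub: "subspace (range ((*v) M))"
    by (rule real_subspace_if_complex_subspace[OF subspace_range_matrix])
  have "range ((*v) M) \<inter> cball v d = {}" using avoid by auto
  then obtain g where g: "g > 0" "\<And>x y. x \<in> range ((*v) M) \<Longrightarrow> y \<in> cball v d \<Longrightarrow> g \<le> dist x y"
    using separate_closed_compact[OF closed_subspace[OF sub] compact_cball[of v d]] by blast
  define R where "R = norm v + \<bar>d\<bar> + 1"
  have R: "R > 0" by (simp add: R_def add_nonneg_pos)
  \<comment> \<open>The first bound gives \<open>norm c \<le> 2 R / m\<close>, the second then makes \<open>M c\<close> and \<open>N c\<close> closer than \<open>g\<close>.\<close>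
  define e where "e = min (m / (2 * B)) (g * m / (4 * B * R))"
  have e: "e > 0" using m B g R by (simp add: e_def)
  have "N *v c \<notin> cball v d" if N: "dist N M < e" for N c
  proof
    assume c: "N *v c \<in> cball v d"
    have "norm (N *v c) \<le> norm v + d"
      using c norm_triangle_sub[of "N *v c" v] by (simp add: dist_norm norm_minus_commute)
    then have nR: "norm (N *v c) \<le> R" by (simp add: R_def)
    have "norm ((M - N) *v c) \<le> norm (M - N) * norm c * B" by (rule bound)
    also have "\<dots> \<le> e * norm c * B"
      using N B by (intro mult_right_mono) (auto simp: dist_norm norm_minus_commute)
    finally have diff: "norm (M *v c - N *v c) \<le> e * norm c * B"
      by (simp add: diff_left)
    have "m * norm c \<le> R + e * norm c * B"
      using m(2)[of c] norm_triangle_sub[of "M *v c" "N *v c"] diff nR by linarith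
    moreover have "e * B \<le> m / 2"
      using B by (simp add: e_def min_def field_simps)
    then have "e * norm c * B \<le> m / 2 * norm c"
      using mult_right_mono[of "e * B" "m / 2" "norm c"] by (simp add: mult_ac)
    ultimately have mc: "m * norm c \<le> 2 * R" by linarith
    have "e * norm c * B \<le> g * m / (4 * B * R) * norm c * B"
      using B by (intro mult_right_mono) (auto simp: e_def)
    also have "\<dots> = g / (4 * R) * (m * norm c)"
      using B by simp
    also have "\<dots> \<le> g / (4 * R) * (2 * R)"
      using mc g R by (intro mult_left_mono) auto
    also have "\<dots> = g / 2" using R by simp
    also have "\<dots> < g" using g by simp
    finally have "dist (M *v c) (N *v c) < g"
      using diff by (simp add: dist_norm)
    then show False using g(2)[of "M *v c" "N *v c"] c by auto
  qed
  with e that show ?thesis by blast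
qed

context
  fixes nu :: "'d::finite \<Rightarrow> int^'n::finite" and lam :: "'d \<Rightarrow> int" and p :: "'n toric_point"
  assumes subspace_tangent: "vec.subspace (tangent_space nu lam p)"
begin

lemma mem_frames_iff:
  "M \<in> frames nu lam p \<longleftrightarrow> columns M \<subseteq> tangent_space nu lam p \<and> (\<forall>c. M *v c = 0 \<longrightarrow> c = 0)"
  by (simp add: frames_def dim_columns_eq_card_iff)

lemma span_frame_mem_grassmannian:
  "M \<in> frames nu lam p \<Longrightarrow> vec.span (columns M) \<in> grassmannian nu lam p"
  using subspace_tangent by (auto simp: frames_def grassmannian_def vec.dim_span dest: vec.span_minimal)

lemma topspace_grassmannian_topology: "topspace (grassmannian_topology nu lam p) = grassmannian nu lam p"
proof -
  have "{M \<in> frames nu lam p. vec.span (columns M) \<in> grassmannian nu lam p} = frames nu lam p"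
    using span_frame_mem_grassmannian by blast
  then have "openin (grassmannian_topology nu lam p) (grassmannian nu lam p)"
    by (simp add: openin_grassmannian_topology)
  moreover have "topspace (grassmannian_topology nu lam p) \<subseteq> grassmannian nu lam p"
    using openin_grassmannian_topology openin_topspace by blast
  ultimately show ?thesis
    using openin_subset by blast
qed

lemma openin_avoiding_cball:
  "openin (grassmannian_topology nu lam p) {L \<in> grassmannian nu lam p. L \<inter> cball v d = {}}"
  (is "openin _ ?W")
proof -
  have "openin (top_of_set (frames nu lam p)) {M \<in> frames nu lam p. vec.span (columns M) \<in> ?W}"
    (is "openin _ ?S")
    unfolding openin_euclidean_subtopology_iff
  proof (intro conjI ballI)
    fix M assume "M \<in> ?S"
    then have "M \<in> frames nu lam p" "range ((*v) M) \<inter> cball v d = {}"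
      by (auto simp: span_columns)
    then have M: "M \<in> frames nu lam p" "\<And>c. M *v c \<notin> cball v d"
      by blast+
    then obtain e where e: "e > 0" "\<And>N c. dist N M < e \<Longrightarrow> N *v c \<notin> cball v d"
      using range_avoids_cball_open[of M v d] mem_frames_iff by metis
    show "\<exists>e>0. \<forall>N\<in>frames nu lam p. dist N M < e \<longrightarrow> N \<in> ?S"
      using e span_frame_mem_grassmannian by (intro exI[of _ e]) (auto simp: span_columns)
  qed auto
  then show ?thesis
    by (simp add: openin_grassmannian_topology)
qed

lemma limitin_positive_lagrangian_grassmannianI:
  assumes M: "\<forall>\<^sub>F s in F. M s \<in> frames nu lam p \<and> vec.span (columns (M s)) = E s"
    and pos: "\<forall>\<^sub>F s in F. E s \<in> positive_lagrangians nu lam p"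
    and M0: "M0 \<in> frames nu lam p" "(M \<longlongrightarrow> M0) F"
    and L: "vec.span (columns M0) \<in> positive_lagrangians nu lam p"
  shows "limitin (positive_lagrangian_grassmannian nu lam p) E (vec.span (columns M0)) F"
  unfolding limitin_def
proof (intro conjI allI impI)
  show "vec.span (columns M0) \<in> topspace (positive_lagrangian_grassmannian nu lam p)"
    using L span_frame_mem_grassmannian[OF M0(1)]
    by (simp add: positive_lagrangian_grassmannian_def topspace_grassmannian_topology)
  fix W assume W: "openin (positive_lagrangian_grassmannian nu lam p) W \<and> vec.span (columns M0) \<in> W"
  then obtain T where T: "openin (grassmannian_topology nu lam p) T"
    "W = T \<inter> positive_lagrangians nu lam p"
    by (auto simp: positive_lagrangian_grassmannian_def openin_subtopology)
  obtain Q where Q: "open Q" "{M \<in> frames nu lam p. vec.span (columns M) \<in> T} = Q \<inter> frames nu lam p"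
    using T(1) by (auto simp: openin_grassmannian_topology openin_open)
  have "M0 \<in> Q" using Q W T M0 by blast
  then have "\<forall>\<^sub>F s in F. M s \<in> Q" using Q M0(2) topological_tendstoD by blast
  with M pos show "\<forall>\<^sub>F s in F. E s \<in> W"
  proof eventually_elim
    case (elim s)
    then have "M s \<in> {M \<in> frames nu lam p. vec.span (columns M) \<in> T}"
      using Q by blast
    then show ?case using elim T by auto
  qed
qed

text \<open>Otherwise a vector \<open>v = M0 c\<close> of the span of the limiting frame lies outside \<open>L\<close>, and so does a closed
  ball around it. The subspaces that miss this ball form a neighbourhood of \<open>L\<close>, which the spans of the
  frames leave because \<open>M s c\<close> tends to \<open>v\<close>.\<close>
lemma limit_in_positive_lagrangian_grassmannian_unique:
  assumes F: "F \<noteq> bot"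
    and M: "\<forall>\<^sub>F s in F. M s \<in> frames nu lam p \<and> vec.span (columns (M s)) = E s"
    and M0: "M0 \<in> frames nu lam p" "(M \<longlongrightarrow> M0) F"
    and lim: "limitin (positive_lagrangian_grassmannian nu lam p) E L F"
  shows "L = vec.span (columns M0)"
proof (rule ccontr)
  assume neq: "L \<noteq> vec.span (columns M0)"
  have L: "L \<in> positive_lagrangians nu lam p" "vec.subspace L" "vec.dim L = CARD('n)"
    using lim limitin_topspace[OF lim]
    by (auto simp: positive_lagrangian_grassmannian_def positive_lagrangians_def grassmannian_def
        topspace_grassmannian_topology)
  have "\<not> vec.span (columns M0) \<subseteq> L"
    using vec.subspace_dim_equal[OF vec.subspace_span L(2), of "columns M0"] neq L(3) M0(1)
    by (auto simp: frames_def vec.dim_span)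
  then obtain v where v: "v \<in> vec.span (columns M0)" "v \<notin> L" by blast
  have "open (- L)"
    using closed_subspace[OF real_subspace_if_complex_subspace[OF L(2)]] by blast
  then obtain d where d: "d > 0" "cball v d \<subseteq> - L"
    using v by (meson ComplI open_contains_cball)
  define W where "W = {L \<in> grassmannian nu lam p. L \<inter> cball v d = {}} \<inter> positive_lagrangians nu lam p"
  have "openin (positive_lagrangian_grassmannian nu lam p) W"
    unfolding W_def positive_lagrangian_grassmannian_def
    by (rule openin_subtopology_Int[OF openin_avoiding_cball])
  moreover have "L \<in> W"
    using L d by (auto simp: W_def positive_lagrangians_def)
  ultimately have "\<forall>\<^sub>F s in F. E s \<in> W"
    using lim by (simp add: limitin_def)
  moreover obtain c where c: "v = M0 *v c"
    using v span_columns by auto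
  interpret bounded_bilinear "(*v) :: complex^'n^(('n + 'n) \<times> ('n \<Rightarrow> 'd)) \<Rightarrow> _"
    by (rule bounded_bilinear_complex_matrix_vector_mult)
  have "((\<lambda>s. M s *v c) \<longlongrightarrow> v) F"
    unfolding c by (intro tendsto M0(2) tendsto_const)
  then have "\<forall>\<^sub>F s in F. dist (M s *v c) v < d"
    using d tendstoD by blast
  ultimately have "\<forall>\<^sub>F s in F. False"
    using M
  proof eventually_elim
    case (elim s)
    then have "M s *v c \<in> E s" by (metis rangeI span_columns)
    moreover have "M s *v c \<in> cball v d" using elim by (simp add: dist_commute)
    ultimately show False using elim by (auto simp: W_def)
  qed
  then show False using F by simp
qed

end

section \<open>Vertices of a Delzant polytope\<close>

lemma real_vec_add: "real_vec (a + b) = real_vec a + real_vec b"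
  by (simp add: real_vec_def vec_eq_iff)

lemma real_vec_diff: "real_vec (a - b) = real_vec a - real_vec b"
  by (simp add: real_vec_def vec_eq_iff)

lemma real_vec_zero [simp]: "real_vec 0 = 0"
  by (simp add: real_vec_def vec_eq_iff)

lemma real_vec_scale: "real_vec (c *s a) = real_of_int c *\<^sub>R real_vec a"
  by (simp add: real_vec_def vec_eq_iff)

lemma real_vec_sum: "real_vec (\<Sum>i\<in>A. f i) = (\<Sum>i\<in>A. real_vec (f i))"
  by (induction A rule: infinite_finite_induct) (simp_all add: real_vec_add)

lemma matrix_inv_inverse:
  assumes "invertible A"
  shows matrix_inv_right: "A ** matrix_inv A = mat 1" and matrix_inv_left: "matrix_inv A ** A = mat 1"
  using someI_ex[OF assms[unfolded invertible_def]] by (simp_all add: matrix_inv_def)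

locale delzant_polytope =
  fixes nu :: "'d::finite \<Rightarrow> int^'n::finite" and lam :: "'d \<Rightarrow> int"
  assumes delzant: "delzant nu lam"
begin

abbreviation "P \<equiv> polytope_of nu lam"
abbreviation "normal r \<equiv> real_vec (nu r)"
abbreviation "L \<equiv> ell nu lam"
abbreviation "tight_at \<equiv> tight nu lam"
abbreviation "manifold \<equiv> toric_manifold nu lam"
abbreviation "moment \<equiv> moment_map nu lam"
abbreviation "toric_pt \<equiv> toric_class nu lam"
abbreviation "angle_of \<equiv> angle nu lam"
abbreviation "stab \<equiv> stabiliser nu lam"
abbreviation "chart_dom \<equiv> chart_domain nu lam"
abbreviation "darboux \<equiv> darboux_chart nu lam"
abbreviation "darboux_inv \<equiv> chart_inverse nu lam"
abbreviation "tangent \<equiv> tangent_space nu lam"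

definition vertex_ordering :: "('n \<Rightarrow> 'd) \<Rightarrow> bool" where
  "vertex_ordering \<sigma> \<longleftrightarrow> (\<exists>v. ordered_vertex nu lam \<sigma> v)"

text \<open>The basis dual to the normals at the vertex; its members are the directions \<open>\<partial>/\<partial>l\<^sub>j\<close>.\<close>
definition dual :: "('n \<Rightarrow> 'd) \<Rightarrow> 'n \<Rightarrow> real^'n" where
  "dual \<sigma> j = matrix_inv (normal_matrix nu \<sigma>) *v axis j 1"

lemma vertex_orderingD:
  assumes "vertex_ordering \<sigma>"
  obtains v where "v extreme_point_of P" "range \<sigma> = tight_at v" "inj \<sigma>" "integral_basis nu (tight_at v)"
  using assms delzant unfolding vertex_ordering_def ordered_vertex_def delzant_def bij_betw_def by blast

text \<open>The rows of the inverse are the integral coordinates of the standard basis vectors in the basis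
  of normals.\<close>
lemma normal_matrix_integral_inverse:
  assumes "vertex_ordering \<sigma>"
  shows "invertible (normal_matrix nu \<sigma>)" "matrix_inv (normal_matrix nu \<sigma>) $ i $ j \<in> \<int>"
proof -
  obtain v where v: "range \<sigma> = tight_at v" "inj \<sigma>" "integral_basis nu (tight_at v)"
    using vertex_orderingD[OF assms] by metis
  have "\<forall>m. \<exists>c. m = (\<Sum>r\<in>tight_at v. c r *s nu r)"
    using v(3) unfolding integral_basis_def by metis
  then obtain c where c: "\<And>m. m = (\<Sum>r\<in>tight_at v. c m r *s nu r)" by metis
  define C :: "real^'n^'n" where "C = (\<chi> i j. real_of_int (c (axis i 1) (\<sigma> j)))"
  have "axis i 1 = (\<Sum>j\<in>UNIV. C $ i $ j *\<^sub>R normal (\<sigma> j))" for i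
  proof -
    have "(axis i 1 :: int^'n) = (\<Sum>j\<in>UNIV. c (axis i 1) (\<sigma> j) *s nu (\<sigma> j))"
      using c[of "axis i 1"] unfolding v(1)[symmetric] by (simp add: sum.reindex[OF v(2)])
    then have "real_vec (axis i 1) = real_vec (\<Sum>j\<in>UNIV. c (axis i 1) (\<sigma> j) *s nu (\<sigma> j))"
      by (rule arg_cong)
    then have "real_vec (axis i 1) = (\<Sum>j\<in>UNIV. C $ i $ j *\<^sub>R normal (\<sigma> j))"
      by (simp only: real_vec_sum real_vec_scale) (simp add: C_def)
    moreover have "real_vec (axis i 1) = axis i 1"
      by (simp add: real_vec_def vec_eq_iff axis_def)
    ultimately show ?thesis by simp
  qed
  note rows = this
  have "(\<Sum>j\<in>UNIV. C $ i $ j * normal (\<sigma> j) $ k) = axis i 1 $ k" for i k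
    by (subst rows[of i]) simp
  then have CA: "C ** normal_matrix nu \<sigma> = mat 1"
    by (simp add: vec_eq_iff matrix_matrix_mult_def normal_matrix_def mat_def axis_def eq_commute)
  then show inv: "invertible (normal_matrix nu \<sigma>)"
    using invertible_left_inverse by blast
  have "C = C ** (normal_matrix nu \<sigma> ** matrix_inv (normal_matrix nu \<sigma>))"
    by (simp add: matrix_inv_right[OF inv])
  also have "\<dots> = matrix_inv (normal_matrix nu \<sigma>)"
    by (simp add: matrix_mul_assoc CA)
  finally have "matrix_inv (normal_matrix nu \<sigma>) = C" by simp
  then show "matrix_inv (normal_matrix nu \<sigma>) $ i $ j \<in> \<int>"
    by (simp add: C_def)
qed

lemma dual_nth: "dual \<sigma> j $ i = matrix_inv (normal_matrix nu \<sigma>) $ i $ j"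
  by (simp add: dual_def matrix_vector_mult_basis column_def)

lemma normal_inner_dual:
  assumes "vertex_ordering \<sigma>"
  shows "normal (\<sigma> i) \<bullet> dual \<sigma> j = (if i = j then 1 else 0)"
proof -
  have "normal (\<sigma> i) \<bullet> dual \<sigma> j = (normal_matrix nu \<sigma> ** matrix_inv (normal_matrix nu \<sigma>)) $ i $ j"
    by (simp add: inner_vec_def dual_nth matrix_matrix_mult_def normal_matrix_def)
  then show ?thesis
    by (simp add: matrix_inv_right[OF normal_matrix_integral_inverse(1)[OF assms]] mat_def)
qed

lemma integral_inner_dual:
  assumes "vertex_ordering \<sigma>"
  shows "real_vec m \<bullet> dual \<sigma> j \<in> \<int>"
  unfolding inner_vec_def
  by (intro Ints_sum) (simp add: real_vec_def dual_nth normal_matrix_integral_inverse(2)[OF assms])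

lemma dual_expansion:
  assumes "vertex_ordering \<sigma>"
  shows "(\<Sum>j\<in>UNIV. (normal (\<sigma> j) \<bullet> x) *\<^sub>R dual \<sigma> j) = x"
proof -
  have "x = matrix_inv (normal_matrix nu \<sigma>) *v (normal_matrix nu \<sigma> *v x)"
    by (simp add: matrix_vector_mul_assoc matrix_inv_left[OF normal_matrix_integral_inverse(1)[OF assms]])
  also have "normal_matrix nu \<sigma> *v x = (\<chi> j. normal (\<sigma> j) \<bullet> x)"
    by (simp add: matrix_vector_mult_def normal_matrix_def inner_vec_def)
  also have "matrix_inv (normal_matrix nu \<sigma>) *v (\<chi> j. normal (\<sigma> j) \<bullet> x)
      = (\<Sum>j\<in>UNIV. (normal (\<sigma> j) \<bullet> x) *\<^sub>R dual \<sigma> j)"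
    by (simp add: vec_eq_iff matrix_vector_mult_def dual_nth mult.commute)
  finally show ?thesis by simp
qed

lemma normal_expansion:
  assumes "vertex_ordering \<sigma>"
  shows "(\<Sum>j\<in>UNIV. (dual \<sigma> j \<bullet> x) *\<^sub>R normal (\<sigma> j)) = x"
proof -
  have "y \<bullet> (\<Sum>j\<in>UNIV. (dual \<sigma> j \<bullet> x) *\<^sub>R normal (\<sigma> j)) = y \<bullet> x" for y
  proof -
    have "y \<bullet> x = (\<Sum>j\<in>UNIV. (normal (\<sigma> j) \<bullet> y) *\<^sub>R dual \<sigma> j) \<bullet> x"
      by (simp add: dual_expansion[OF assms])
    then show ?thesis
      by (simp add: inner_sum_left inner_sum_right inner_commute mult.commute)
  qed
  then show ?thesis using vector_eq_ldot by blast
qed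

lemma vertex_angle_eq: "vertex_angle nu lam \<sigma> p $ j = dual \<sigma> j \<bullet> angle_of p"
  by (simp add: vertex_angle_def matrix_vector_mult_def transpose_def inner_vec_def dual_nth)

lemma continuous_on_ell [continuous_intros]:
  "continuous_on S f \<Longrightarrow> continuous_on S (\<lambda>x. L r (f x))"
  unfolding ell_def by (intro continuous_intros)

lemma polytope_eq: "P = (\<Inter>r. {x. 0 \<le> L r x})"
  by (auto simp: polytope_of_def)

lemma convex_polytope: "convex P"
proof -
  have "{x. 0 \<le> L r x} = {x. normal r \<bullet> x \<ge> real_of_int (lam r)}" for r
    by (simp add: ell_def)
  then show ?thesis unfolding polytope_eq by (simp add: convex_INT convex_halfspace_ge)
qed

lemma compact_polytope: "compact P"
  using delzant by (simp add: delzant_def)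

lemma normal_nonzero: "normal r \<noteq> 0"
proof
  assume "normal r = 0"
  then have "nu r = 0" by (simp add: real_vec_def vec_eq_iff)
  then have "range (($) (nu r)) = {0}" by auto
  then have "Gcd (range (($) (nu r))) = 0" by (metis Gcd_empty Gcd_insert gcd_0_left normalize_0)
  moreover have "Gcd (range (($) (nu r))) = 1" using delzant unfolding delzant_def by blast
  ultimately show False by simp
qed

lemma open_positive: "open {x. \<forall>r\<in>A. 0 < L r x}"
proof -
  have "{x. \<forall>r\<in>A. 0 < L r x} = (\<Inter>r\<in>A. {x. 0 < L r x})" by auto
  moreover have "open {x. 0 < L r x}" for r
    by (intro open_Collect_less continuous_intros)
  ultimately show ?thesis by (simp add: open_INT)
qed

lemma interior_polytope: "interior P = {x. \<forall>r. 0 < L r x}"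
proof
  show "interior P \<subseteq> {x. \<forall>r. 0 < L r x}"
  proof clarify
    fix x r assume x: "x \<in> interior P"
    then obtain e where e: "e > 0" "ball x e \<subseteq> P"
      by (meson mem_interior)
    have n: "norm (normal r) > 0" using normal_nonzero[of r] by simp
    define t where "t = e / (2 * norm (normal r))"
    have t: "t > 0" using e n by (simp add: t_def)
    have "x - t *\<^sub>R normal r \<in> ball x e"
      using e n by (simp add: dist_norm t_def)
    then have "x - t *\<^sub>R normal r \<in> P" using e by blast
    then have "0 \<le> L r (x - t *\<^sub>R normal r)" by (simp add: polytope_of_def)
    also have "\<dots> = L r x - t * (norm (normal r))\<^sup>2"
      by (simp add: ell_def inner_diff_right power2_norm_eq_inner)
    also have "\<dots> < L r x" using t n by simp
    finally show "0 < L r x" .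
  qed
  have "open {x. \<forall>r. 0 < L r x}" using open_positive[of UNIV] by simp
  moreover have "{x. \<forall>r. 0 < L r x} \<subseteq> P" by (auto simp: polytope_of_def less_imp_le)
  ultimately show "{x. \<forall>r. 0 < L r x} \<subseteq> interior P" by (rule interior_maximal[rotated])
qed

lemma ell_combination: "L r ((1 - u) *\<^sub>R a + u *\<^sub>R b) = (1 - u) * L r a + u * L r b"
  by (simp add: ell_def inner_add_right algebra_simps)

text \<open>For \<open>x\<close> in the polytope, the smallest face that contains it.\<close>
definition face_through :: "real^'n \<Rightarrow> (real^'n) set" where
  "face_through x = {y \<in> P. tight_at x \<subseteq> tight_at y}"

lemma face_through_face_of: "face_through x face_of P"
  unfolding face_of_def
proof (intro conjI ballI impI)
  show "face_through x \<subseteq> P" by (auto simp: face_through_def)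
  have "face_through x = P \<inter> (\<Inter>r\<in>tight_at x. {y. normal r \<bullet> y = real_of_int (lam r)})"
    by (auto simp: face_through_def tight_def ell_def)
  then show "convex (face_through x)"
    using convex_polytope by (auto intro!: convex_Int convex_INT convex_hyperplane)
  fix a b y assume a: "a \<in> P" and b: "b \<in> P" and y: "y \<in> face_through x" "y \<in> open_segment a b"
  then obtain u where u: "0 < u" "u < 1" "y = (1 - u) *\<^sub>R a + u *\<^sub>R b"
    by (auto simp: in_segment)
  have "L r a = 0 \<and> L r b = 0" if "r \<in> tight_at x" for r
  proof -
    have "(1 - u) * L r a + u * L r b = 0"
      using that y u ell_combination by (auto simp: face_through_def tight_def)
    moreover have "0 \<le> (1 - u) * L r a" "0 \<le> u * L r b"
      using a b u by (auto simp: polytope_of_def)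
    ultimately have "(1 - u) * L r a = 0" "u * L r b = 0" by linarith+
    then show ?thesis using u by simp
  qed
  then show "a \<in> face_through x" "b \<in> face_through x"
    using a b by (auto simp: face_through_def tight_def)
qed

lemma mem_rel_interior_face_through:
  assumes "x \<in> P"
  shows "x \<in> rel_interior (face_through x)"
proof -
  let ?T = "{y. \<forall>r\<in>- tight_at x. 0 < L r y}"
  let ?H = "\<Inter>r\<in>tight_at x. {y. normal r \<bullet> y = real_of_int (lam r)}"
  have "face_through x \<subseteq> ?H" by (auto simp: face_through_def tight_def ell_def)
  moreover have "affine ?H" by (auto intro!: affine_Inter affine_hyperplane)
  ultimately have "affine hull face_through x \<subseteq> ?H" by (rule hull_minimal)
  moreover have "?T \<inter> ?H \<subseteq> face_through x"
  proof
    fix y assume y: "y \<in> ?T \<inter> ?H"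
    have "0 \<le> L r y" for r
      using y by (cases "r \<in> tight_at x") (auto simp: ell_def less_imp_le)
    then show "y \<in> face_through x"
      using y by (auto simp: face_through_def polytope_of_def tight_def ell_def)
  qed
  ultimately have "?T \<inter> affine hull face_through x \<subseteq> face_through x" by blast
  moreover have "x \<in> ?T \<inter> face_through x"
    using assms by (auto simp: face_through_def polytope_of_def tight_def less_le)
  ultimately show ?thesis
    unfolding mem_rel_interior using open_positive[of "- tight_at x"] by blast
qed

text \<open>An affine function that is nonnegative on a face and vanishes at a relative interior point
  vanishes on the face, in particular at \<open>v\<close>. Conversely, a point lies in the relative interior of the
  smallest face that contains it.\<close>
lemma vertex_star_eq: "vertex_star nu lam v = {x \<in> P. tight_at x \<subseteq> tight_at v}" if v: "v \<in> P"
proof (intro equalityI subsetI)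
  fix x assume "x \<in> vertex_star nu lam v"
  then obtain F where F: "F face_of P" "v \<in> F" "x \<in> rel_interior F"
    by (auto simp: vertex_star_def)
  have F': "convex F" "F \<subseteq> P" "x \<in> F"
    using F face_of_imp_convex face_of_imp_subset rel_interior_subset by blast+
  \<comment> \<open>The segment from \<open>v\<close> through the relative interior point \<open>x\<close> can be prolonged in \<open>F\<close>.\<close>
  obtain e where e: "e > 1" "(1 - e) *\<^sub>R v + e *\<^sub>R x \<in> F"
    using convex_rel_interior_iff[of F x] F F' by blast
  have "L r v = 0" if r: "L r x = 0" for r
  proof -
    have "(1 - e) *\<^sub>R v + e *\<^sub>R x \<in> P" using e F' by blast
    then have "0 \<le> L r ((1 - e) *\<^sub>R v + e *\<^sub>R x)" by (simp add: polytope_of_def)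
    then have "0 \<le> (1 - e) * L r v"
      using ell_combination[of r e v x] r by simp
    moreover have "0 \<le> L r v" using v by (simp add: polytope_of_def)
    ultimately show ?thesis using e by (simp add: zero_le_mult_iff)
  qed
  then show "x \<in> {x \<in> P. tight_at x \<subseteq> tight_at v}"
    using F' by (auto simp: tight_def)
next
  fix x assume "x \<in> {x \<in> P. tight_at x \<subseteq> tight_at v}"
  then have "x \<in> rel_interior (face_through x)" "v \<in> face_through x"
    using mem_rel_interior_face_through v by (auto simp: face_through_def)
  then show "x \<in> vertex_star nu lam v"
    unfolding vertex_star_def using face_through_face_of by blast
qed

lemma extreme_in_polytope: "v extreme_point_of P \<Longrightarrow> v \<in> P"
  by (simp add: extreme_point_of_def)

lemma chart_domain_eq:
  assumes "vertex_ordering \<sigma>"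
  shows "chart_dom \<sigma> = {p \<in> manifold. tight_at (moment p) \<subseteq> range \<sigma>} \<inter> {p. moment p \<in> P}"
proof -
  have "moment p \<in> vertex_star nu lam v \<longleftrightarrow> moment p \<in> P \<and> tight_at (moment p) \<subseteq> range \<sigma>"
    if "ordered_vertex nu lam \<sigma> v" for v p
    using that vertex_star_eq[of v] extreme_in_polytope
    by (auto simp: ordered_vertex_def bij_betw_def)
  then show ?thesis
    using assms unfolding chart_domain_def vertex_ordering_def by blast
qed

lemma chart_domain_vertex: "p \<in> chart_dom \<sigma> \<Longrightarrow> vertex_ordering \<sigma>"
  by (auto simp: chart_domain_def vertex_ordering_def)

text \<open>The smallest face containing \<open>x\<close> is compact and convex, hence has an extreme point, and all
  facets through \<open>x\<close> pass through it.\<close>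
lemma exists_vertex_ordering:
  assumes "x \<in> P"
  obtains \<sigma> where "vertex_ordering \<sigma>" "tight_at x \<subseteq> range \<sigma>"
proof -
  have "compact (face_through x)" "convex (face_through x)" "x \<in> face_through x"
    using face_of_imp_compact[OF convex_polytope compact_polytope face_through_face_of]
      face_of_imp_convex[OF face_through_face_of] assms
    by (auto simp: face_through_def)
  then obtain v where "v extreme_point_of (face_through x)"
    using extreme_point_exists_convex by blast
  then have v: "v extreme_point_of P" "v \<in> face_through x"
    using extreme_point_of_face[OF face_through_face_of] by auto
  have "card (tight_at v) = CARD('n)"
    using delzant v by (simp add: delzant_def)
  then obtain \<sigma> :: "'n \<Rightarrow> 'd" where "bij_betw \<sigma> UNIV (tight_at v)"
    by (metis finite_class.finite_UNIV finite_same_card_bij finite)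
  then have "ordered_vertex nu lam \<sigma> v" "tight_at x \<subseteq> range \<sigma>"
    using v by (auto simp: ordered_vertex_def face_through_def bij_betw_def)
  then show ?thesis using that vertex_ordering_def by blast
qed

section \<open>Points and Darboux charts of the toric manifold\<close>

lemma stabiliser_zero: "0 \<in> stab x"
  unfolding stabiliser_def by (rule CollectI) (rule exI[of _ 0], rule exI[of _ 0], simp add: span_zero)

lemma stabiliser_diff:
  assumes "a \<in> stab x" "b \<in> stab x"
  shows "a - b \<in> stab x"
proof -
  obtain m u m' u' where "a = (2 * pi) *\<^sub>R real_vec m + u" "b = (2 * pi) *\<^sub>R real_vec m' + u'"
    "u \<in> span (real_vec ` nu ` tight_at x)" "u' \<in> span (real_vec ` nu ` tight_at x)"
    using assms by (auto simp: stabiliser_def)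
  then have "a - b = (2 * pi) *\<^sub>R real_vec (m - m') + (u - u') \<and> u - u' \<in> span (real_vec ` nu ` tight_at x)"
    by (auto simp: real_vec_diff algebra_simps intro: span_diff)
  then show ?thesis unfolding stabiliser_def by blast
qed

lemma toric_class_eq_iff:
  "toric_pt x \<theta> = toric_pt x' \<theta>' \<longleftrightarrow> x = x' \<and> \<theta>' - \<theta> \<in> stab x"
proof
  assume eq: "toric_pt x \<theta> = toric_pt x' \<theta>'"
  have "(x', \<theta>') \<in> toric_pt x' \<theta>'"
    by (simp add: toric_class_def stabiliser_zero)
  then show "x = x' \<and> \<theta>' - \<theta> \<in> stab x"
    unfolding eq[symmetric] by (auto simp: toric_class_def)
next
  assume a: "x = x' \<and> \<theta>' - \<theta> \<in> stab x"
  then have "0 - (\<theta>' - \<theta>) \<in> stab x"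
    using a by (intro stabiliser_diff[OF stabiliser_zero]) simp
  then have neg: "\<theta> - \<theta>' \<in> stab x" by simp
  have "t - \<theta> \<in> stab x \<longleftrightarrow> t - \<theta>' \<in> stab x" for t
    using a neg stabiliser_diff[of "t - \<theta>" x "\<theta>' - \<theta>"] stabiliser_diff[of "t - \<theta>'" x "\<theta> - \<theta>'"]
    by auto
  then show "toric_pt x \<theta> = toric_pt x' \<theta>'"
    using a by (auto simp: toric_class_def)
qed

lemma moment_toric_class [simp]: "moment (toric_pt x \<theta>) = x"
  unfolding moment_map_def by (rule the_equality) (blast, auto simp: toric_class_eq_iff)

lemma toric_class_angle:
  assumes "p = toric_pt x \<theta>"
  shows "p = toric_pt (moment p) (angle_of p)"
proof -
  have "\<exists>\<theta>. p = toric_pt (moment p) \<theta>"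
    using assms by auto
  then show ?thesis unfolding angle_def by (rule someI_ex)
qed

lemma angle_toric_class: "angle_of (toric_pt x \<theta>) - \<theta> \<in> stab x"
  using toric_class_angle[OF refl, of x \<theta>] by (simp add: toric_class_eq_iff)

lemma mem_manifoldD:
  assumes "p \<in> manifold"
  shows "moment p \<in> P" "p = toric_pt (moment p) (angle_of p)"
  using assms toric_class_angle by (auto simp: toric_manifold_def)

lemma toric_class_mem_manifold [simp]: "toric_pt x \<theta> \<in> manifold \<longleftrightarrow> x \<in> P"
  unfolding toric_manifold_def by (auto dest: arg_cong[of _ _ moment])

lemma mem_chart_domain_iff:
  "vertex_ordering \<sigma> \<Longrightarrow> p \<in> chart_dom \<sigma> \<longleftrightarrow> p \<in> manifold \<and> tight_at (moment p) \<subseteq> range \<sigma>"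
  using chart_domain_eq mem_manifoldD(1) by auto

lemma exists_chart:
  assumes "p \<in> manifold" obtains \<sigma> where "p \<in> chart_dom \<sigma>"
  using exists_vertex_ordering[OF mem_manifoldD(1)[OF assms]] mem_chart_domain_iff assms by metis

text \<open>In the basis of normals at a vertex, the stabiliser of a point is given by the coordinates
  in \<open>2\<pi>\<int>\<close> along the facets that do not contain the point.\<close>
lemma stabiliser_iff:
  assumes \<sigma>: "vertex_ordering \<sigma>" and x: "tight_at x \<subseteq> range \<sigma>"
  shows "t \<in> stab x \<longleftrightarrow> (\<forall>j. \<sigma> j \<notin> tight_at x \<longrightarrow> (\<exists>m::int. dual \<sigma> j \<bullet> t = 2 * pi * of_int m))"
proof
  assume "t \<in> stab x"
  then obtain m u where t: "t = (2 * pi) *\<^sub>R real_vec m + u" and u: "u \<in> span (real_vec ` nu ` tight_at x)"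
    by (auto simp: stabiliser_def)
  show "\<forall>j. \<sigma> j \<notin> tight_at x \<longrightarrow> (\<exists>m::int. dual \<sigma> j \<bullet> t = 2 * pi * of_int m)"
  proof (intro allI impI)
    fix j assume j: "\<sigma> j \<notin> tight_at x"
    have "real_vec ` nu ` tight_at x \<subseteq> {y. dual \<sigma> j \<bullet> y = 0}"
    proof clarify
      fix r assume r: "r \<in> tight_at x"
      then obtain i where i: "r = \<sigma> i" using x by blast
      with r j have "i \<noteq> j" by auto
      then show "dual \<sigma> j \<bullet> normal r = 0"
        using normal_inner_dual[OF \<sigma>, of i j] by (simp add: i inner_commute)
    qed
    then have "dual \<sigma> j \<bullet> u = 0"
      using u span_minimal[OF _ subspace_hyperplane] by blast
    moreover obtain k where "real_vec m \<bullet> dual \<sigma> j = of_int k"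
      using integral_inner_dual[OF \<sigma>] Ints_cases by metis
    ultimately have "dual \<sigma> j \<bullet> t = 2 * pi * of_int k"
      by (simp add: t inner_add_right inner_commute)
    then show "\<exists>m::int. dual \<sigma> j \<bullet> t = 2 * pi * of_int m" by blast
  qed
next
  assume "\<forall>j. \<sigma> j \<notin> tight_at x \<longrightarrow> (\<exists>m::int. dual \<sigma> j \<bullet> t = 2 * pi * of_int m)"
  then obtain m :: "'n \<Rightarrow> int" where m: "\<And>j. \<sigma> j \<notin> tight_at x \<Longrightarrow> dual \<sigma> j \<bullet> t = 2 * pi * of_int (m j)"
    by metis
  let ?J = "{j. \<sigma> j \<in> tight_at x}"
  define u where "u = (\<Sum>j\<in>?J. (dual \<sigma> j \<bullet> t) *\<^sub>R normal (\<sigma> j))"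
  have "t = (\<Sum>j\<in>UNIV. (dual \<sigma> j \<bullet> t) *\<^sub>R normal (\<sigma> j))"
    by (simp add: normal_expansion[OF \<sigma>])
  also have "\<dots> = (\<Sum>j\<in>-?J. (dual \<sigma> j \<bullet> t) *\<^sub>R normal (\<sigma> j)) + u"
    unfolding u_def by (subst sum.union_disjoint[symmetric]) (auto intro!: sum.cong)
  also have "(\<Sum>j\<in>-?J. (dual \<sigma> j \<bullet> t) *\<^sub>R normal (\<sigma> j)) = (2 * pi) *\<^sub>R real_vec (\<Sum>j\<in>-?J. m j *s nu (\<sigma> j))"
    by (simp add: real_vec_sum real_vec_scale scaleR_sum_right m)
  finally have "t = (2 * pi) *\<^sub>R real_vec (\<Sum>j\<in>-?J. m j *s nu (\<sigma> j)) + u" .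
  moreover have "u \<in> span (real_vec ` nu ` tight_at x)"
    unfolding u_def by (intro span_sum span_scale span_base) auto
  ultimately show "t \<in> stab x" unfolding stabiliser_def by blast
qed

end

definition complex_coords :: "real^('n::finite + 'n) \<Rightarrow> complex^'n" where
  "complex_coords u = (\<chi> j. Complex (u $ Inl j) (u $ Inr j))"

lemma realify_complex_coords [simp]: "realify (complex_coords u) = u"
  by (auto simp: realify_def complex_coords_def vec_eq_iff split: sum.splits)

lemma complex_coords_realify [simp]: "complex_coords (realify z) = z"
  by (simp add: realify_def complex_coords_def vec_eq_iff)

lemma bounded_linear_complex_coords: "bounded_linear (complex_coords :: real^('n::finite + 'n) \<Rightarrow> _)"
proof -
  have "linear (complex_coords :: real^('n + 'n) \<Rightarrow> _)"
    by (auto intro!: linearI simp: complex_coords_def vec_eq_iff complex_eq_iff)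
  then show ?thesis by (simp add: linear_conv_bounded_linear)
qed

lemma bounded_linear_realify: "bounded_linear (realify :: complex^'n::finite \<Rightarrow> _)"
proof -
  have "linear (realify :: complex^'n \<Rightarrow> _)"
    by (auto intro!: linearI simp: realify_def vec_eq_iff split: sum.splits)
  then show ?thesis by (simp add: linear_conv_bounded_linear)
qed

lemma realify_nth [simp]: "realify z $ Inl j = Re (z $ j)" "realify z $ Inr j = Im (z $ j)"
  by (simp_all add: realify_def)

context delzant_polytope
begin

abbreviation "z_coord \<sigma> p \<equiv> complex_coords (darboux \<sigma> p)"

text \<open>The moment map in terms of the Darboux coordinates, obtained by solving \<open>L (\<sigma> j) x = |z\<^sub>j|\<^sup>2 / 2\<close> for
  \<open>x\<close>.\<close>
definition base_point :: "('n \<Rightarrow> 'd) \<Rightarrow> real^('n + 'n) \<Rightarrow> real^'n" where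
  "base_point \<sigma> u =
     (\<Sum>j\<in>UNIV. (((u $ Inl j)\<^sup>2 + (u $ Inr j)\<^sup>2) / 2 + real_of_int (lam (\<sigma> j))) *\<^sub>R dual \<sigma> j)"

text \<open>The facets through the vertex impose no condition, because \<open>L (\<sigma> j)\<close> is nonnegative at every base
  point.\<close>
definition chart_range :: "('n \<Rightarrow> 'd) \<Rightarrow> (real^('n + 'n)) set" where
  "chart_range \<sigma> = {u. \<forall>r\<in>- range \<sigma>. 0 < L r (base_point \<sigma> u)}"

lemma ell_base_point:
  assumes "vertex_ordering \<sigma>"
  shows "L (\<sigma> j) (base_point \<sigma> u) = ((u $ Inl j)\<^sup>2 + (u $ Inr j)\<^sup>2) / 2"
  by (simp add: ell_def base_point_def inner_sum_right normal_inner_dual[OF assms] if_distrib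
      flip: of_int_add cong: if_cong)

lemma cmod_complex_coords: "(cmod (complex_coords u $ j))\<^sup>2 = (u $ Inl j)\<^sup>2 + (u $ Inr j)\<^sup>2"
  by (simp add: complex_coords_def cmod_power2)

lemma base_point_eqI:
  assumes \<sigma>: "vertex_ordering \<sigma>" and "\<And>j. ((u $ Inl j)\<^sup>2 + (u $ Inr j)\<^sup>2) / 2 = L (\<sigma> j) x"
  shows "base_point \<sigma> u = x"
proof -
  have "base_point \<sigma> u = (\<Sum>j\<in>UNIV. (normal (\<sigma> j) \<bullet> x) *\<^sub>R dual \<sigma> j)"
    unfolding base_point_def assms(2) by (simp add: ell_def)
  then show ?thesis by (simp add: dual_expansion[OF \<sigma>])
qed

lemma complex_coords_darboux:
  "z_coord \<sigma> p $ j
     = complex_of_real (sqrt (2 * L (\<sigma> j) (moment p))) * cis (dual \<sigma> j \<bullet> angle_of p)"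
  by (simp add: darboux_chart_def vertex_angle_eq)

lemma ell_nonneg: "x \<in> P \<Longrightarrow> 0 \<le> L r x"
  by (simp add: polytope_of_def)

lemma base_point_darboux:
  assumes p: "p \<in> chart_dom \<sigma>"
  shows "base_point \<sigma> (darboux \<sigma> p) = moment p"
proof (rule base_point_eqI)
  show \<sigma>: "vertex_ordering \<sigma>" by (rule chart_domain_vertex[OF p])
  have "moment p \<in> P" using p mem_chart_domain_iff[OF \<sigma>] mem_manifoldD by blast
  then have "(cmod (z_coord \<sigma> p $ j))\<^sup>2 = 2 * L (\<sigma> j) (moment p)" for j
    by (simp add: complex_coords_darboux norm_mult power_mult_distrib ell_nonneg)
  then show "((darboux \<sigma> p $ Inl j)\<^sup>2 + (darboux \<sigma> p $ Inr j)\<^sup>2) / 2 = L (\<sigma> j) (moment p)" for j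
    by (simp add: cmod_complex_coords)
qed

lemma darboux_chart_mem_chart_range:
  assumes p: "p \<in> chart_dom \<sigma>"
  shows "darboux \<sigma> p \<in> chart_range \<sigma>"
proof -
  have \<sigma>: "vertex_ordering \<sigma>" by (rule chart_domain_vertex[OF p])
  have "moment p \<in> P" "tight_at (moment p) \<subseteq> range \<sigma>"
    using p mem_chart_domain_iff[OF \<sigma>] mem_manifoldD by blast+
  then show ?thesis
    by (auto simp: chart_range_def base_point_darboux[OF p] tight_def less_le ell_nonneg)
qed

lemma base_point_mem_polytope:
  assumes "vertex_ordering \<sigma>" "u \<in> chart_range \<sigma>"
  shows "base_point \<sigma> u \<in> P" "tight_at (base_point \<sigma> u) \<subseteq> range \<sigma>"
proof -
  have "0 \<le> L (\<sigma> j) (base_point \<sigma> u)" for j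
    unfolding ell_base_point[OF assms(1)] by simp
  then have "0 \<le> L r (base_point \<sigma> u)" for r
    using assms by (cases "r \<in> range \<sigma>") (auto simp: chart_range_def less_imp_le)
  then show "base_point \<sigma> u \<in> P" by (simp add: polytope_of_def)
  show "tight_at (base_point \<sigma> u) \<subseteq> range \<sigma>"
    using assms by (force simp: tight_def chart_range_def)
qed

text \<open>The point is given by the arguments of the \<open>z\<^sub>j\<close>. Its representative angle differs from them by an
  element of the stabiliser, which changes the angles by multiples of \<open>2\<pi>\<close> where \<open>z\<^sub>j \<noteq> 0\<close>.\<close>
lemma darboux_chart_surj:
  assumes \<sigma>: "vertex_ordering \<sigma>" and u: "u \<in> chart_range \<sigma>"
  shows "\<exists>p\<in>chart_dom \<sigma>. darboux \<sigma> p = u"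
proof -
  let ?x = "base_point \<sigma> u"
  define \<theta> where "\<theta> = (\<Sum>j\<in>UNIV. Arg (complex_coords u $ j) *\<^sub>R normal (\<sigma> j))"
  define p where "p = toric_pt ?x \<theta>"
  note x = base_point_mem_polytope[OF \<sigma> u]
  have p: "p \<in> chart_dom \<sigma>"
    using x by (simp add: mem_chart_domain_iff[OF \<sigma>] p_def)
  have "z_coord \<sigma> p $ j = complex_coords u $ j" for j
  proof -
    let ?z = "complex_coords u $ j"
    have l: "2 * L (\<sigma> j) ?x = (cmod ?z)\<^sup>2"
      by (simp add: cmod_complex_coords ell_base_point[OF \<sigma>])
    show ?thesis
    proof (cases "?z = 0")
      case True
      then show ?thesis using l by (simp add: complex_coords_darboux p_def)
    next
      case False
      then have "\<sigma> j \<notin> tight_at ?x" using l by (auto simp: tight_def)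
      then obtain m :: int where "dual \<sigma> j \<bullet> (angle_of p - \<theta>) = 2 * pi * of_int m"
        using angle_toric_class[of ?x \<theta>] stabiliser_iff[OF \<sigma> x(2)] p_def by blast
      moreover have "dual \<sigma> j \<bullet> \<theta> = Arg ?z"
        by (simp add: \<theta>_def inner_sum_right inner_commute[of "dual \<sigma> j"] normal_inner_dual[OF \<sigma>] if_distrib cong: if_cong)
      ultimately have "dual \<sigma> j \<bullet> angle_of p = Arg ?z + 2 * pi * of_int m"
        by (simp add: inner_diff_right)
      then have "cis (dual \<sigma> j \<bullet> angle_of p) = cis (Arg ?z)"
        by (simp add: cis_mult[symmetric])
      then show ?thesis
        using l rcis_cmod_Arg[of ?z] by (simp add: complex_coords_darboux p_def rcis_def)
    qed
  qed
  then have "z_coord \<sigma> p = complex_coords u" by (simp add: vec_eq_iff)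
  then have "darboux \<sigma> p = u" by (metis realify_complex_coords)
  with p show ?thesis by blast
qed

lemma inj_on_darboux_chart: "inj_on (darboux \<sigma>) (chart_dom \<sigma>)"
proof (rule inj_onI)
  fix p q assume p: "p \<in> chart_dom \<sigma>" and q: "q \<in> chart_dom \<sigma>"
    and eq: "darboux \<sigma> p = darboux \<sigma> q"
  have \<sigma>: "vertex_ordering \<sigma>" by (rule chart_domain_vertex[OF p])
  have x: "moment p = moment q" using base_point_darboux p q eq by metis
  have mem: "p \<in> manifold" "q \<in> manifold" "tight_at (moment p) \<subseteq> range \<sigma>"
    using p q mem_chart_domain_iff[OF \<sigma>] by auto
  have "\<exists>m::int. dual \<sigma> j \<bullet> (angle_of q - angle_of p) = 2 * pi * of_int m"
    if j: "\<sigma> j \<notin> tight_at (moment p)" for j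
  proof -
    have "L (\<sigma> j) (moment p) \<noteq> 0" using j by (simp add: tight_def)
    moreover have "complex_of_real (sqrt (2 * L (\<sigma> j) (moment p))) * cis (dual \<sigma> j \<bullet> angle_of p)
      = complex_of_real (sqrt (2 * L (\<sigma> j) (moment p))) * cis (dual \<sigma> j \<bullet> angle_of q)"
      using arg_cong[OF eq, of "\<lambda>u. complex_coords u $ j"] x by (simp add: complex_coords_darboux)
    ultimately have "cis (dual \<sigma> j \<bullet> angle_of q) = cis (dual \<sigma> j \<bullet> angle_of p)" by simp
    then have "cis (dual \<sigma> j \<bullet> (angle_of q - angle_of p)) = 1"
      by (simp add: inner_diff_right flip: cis_divide)
    then have "cos (dual \<sigma> j \<bullet> (angle_of q - angle_of p)) = 1"
      by (simp add: complex_eq_iff)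
    then show ?thesis
      by (auto simp: cos_one_2pi_int)
  qed
  then have "angle_of q - angle_of p \<in> stab (moment p)"
    by (simp add: stabiliser_iff[OF \<sigma> mem(3)])
  then have "toric_pt (moment p) (angle_of p) = toric_pt (moment q) (angle_of q)"
    using x by (simp add: toric_class_eq_iff)
  then show "p = q" using mem_manifoldD(2) mem by metis
qed

lemma chart_inverse_darboux [simp]:
  "p \<in> chart_dom \<sigma> \<Longrightarrow> darboux_inv \<sigma> (darboux \<sigma> p) = p"
  unfolding chart_inverse_def by (rule inv_into_f_f[OF inj_on_darboux_chart])

lemma
  assumes "vertex_ordering \<sigma>" "u \<in> chart_range \<sigma>"
  shows chart_inverse_mem: "darboux_inv \<sigma> u \<in> chart_dom \<sigma>"
    and darboux_chart_inverse: "darboux \<sigma> (darboux_inv \<sigma> u) = u"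
    and moment_chart_inverse: "moment (darboux_inv \<sigma> u) = base_point \<sigma> u"
proof -
  obtain p where p: "p \<in> chart_dom \<sigma>" "darboux \<sigma> p = u"
    using darboux_chart_surj[OF assms] by blast
  then have "darboux_inv \<sigma> u = p" using chart_inverse_darboux by blast
  with p base_point_darboux show "darboux_inv \<sigma> u \<in> chart_dom \<sigma>"
    "darboux \<sigma> (darboux_inv \<sigma> u) = u"
    "moment (darboux_inv \<sigma> u) = base_point \<sigma> u" by auto
qed

lemma has_derivative_base_point:
  "(base_point \<sigma> has_derivative
     (\<lambda>v. \<Sum>j\<in>UNIV. (u $ Inl j * v $ Inl j + u $ Inr j * v $ Inr j) *\<^sub>R dual \<sigma> j)) (at u)"
proof -
  have "((\<lambda>u. ((u $ Inl j)\<^sup>2 + (u $ Inr j)\<^sup>2) / 2 + real_of_int (lam (\<sigma> j))) has_derivative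
      (\<lambda>v. u $ Inl j * v $ Inl j + u $ Inr j * v $ Inr j)) (at u)" for j
    by (auto intro!: derivative_eq_intros bounded_linear.has_derivative[OF bounded_linear_vec_nth]
        simp: fun_eq_iff field_simps)
  then show ?thesis
    unfolding base_point_def by (intro has_derivative_sum has_derivative_scaleR_left)
qed

lemma continuous_on_base_point: "continuous_on S (base_point \<sigma>)"
  by (intro continuous_at_imp_continuous_on ballI has_derivative_continuous[OF has_derivative_base_point])

lemma open_base_point_positive: "open {u. \<forall>r\<in>A. 0 < L r (base_point \<sigma> u)}"
proof -
  have "open (base_point \<sigma> -` {x. \<forall>r\<in>A. 0 < L r x})"
    by (intro open_vimage open_positive continuous_on_base_point)
  then show ?thesis by (simp add: vimage_def)
qed

lemma open_chart_range: "open (chart_range \<sigma>)"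
  unfolding chart_range_def by (rule open_base_point_positive)

lemma mem_open_stratum_iff: "p \<in> open_stratum nu lam \<longleftrightarrow> p \<in> manifold \<and> tight_at (moment p) = {}"
proof -
  have "x \<in> interior P \<longleftrightarrow> tight_at x = {}" if "x \<in> P" for x
    using ell_nonneg[OF that] by (auto simp: interior_polytope tight_def less_le)
  then show ?thesis
    using mem_manifoldD(1) by (auto simp: open_stratum_def)
qed

lemma complex_coords_zero_iff:
  assumes "vertex_ordering \<sigma>"
  shows "complex_coords u $ j = 0 \<longleftrightarrow> \<sigma> j \<in> tight_at (base_point \<sigma> u)"
proof -
  have "complex_coords u $ j = 0 \<longleftrightarrow> (cmod (complex_coords u $ j))\<^sup>2 = 0" by simp
  also have "\<dots> \<longleftrightarrow> L (\<sigma> j) (base_point \<sigma> u) = 0"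
    unfolding cmod_complex_coords ell_base_point[OF assms] by simp
  finally show ?thesis by (simp add: tight_def)
qed

lemma darboux_image_open_stratum:
  assumes \<sigma>: "vertex_ordering \<sigma>"
  shows "darboux \<sigma> ` open_stratum nu lam = {u \<in> chart_range \<sigma>. \<forall>j. complex_coords u $ j \<noteq> 0}"
proof (intro equalityI subsetI)
  fix u assume "u \<in> darboux \<sigma> ` open_stratum nu lam"
  then obtain p where p: "p \<in> manifold" "tight_at (moment p) = {}" "u = darboux \<sigma> p"
    by (auto simp: mem_open_stratum_iff)
  then have "p \<in> chart_dom \<sigma>" by (simp add: mem_chart_domain_iff[OF \<sigma>])
  then show "u \<in> {u \<in> chart_range \<sigma>. \<forall>j. complex_coords u $ j \<noteq> 0}"
    using p by (auto simp: complex_coords_zero_iff[OF \<sigma>] base_point_darboux darboux_chart_mem_chart_range)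
next
  fix u assume u: "u \<in> {u \<in> chart_range \<sigma>. \<forall>j. complex_coords u $ j \<noteq> 0}"
  then have r: "u \<in> chart_range \<sigma>" by simp
  have "tight_at (base_point \<sigma> u) = {}"
    using u base_point_mem_polytope(2)[OF \<sigma> r] by (auto simp: complex_coords_zero_iff[OF \<sigma>])
  then have "darboux_inv \<sigma> u \<in> open_stratum nu lam"
    using chart_inverse_mem[OF \<sigma> r] mem_chart_domain_iff[OF \<sigma>]
    by (simp add: mem_open_stratum_iff moment_chart_inverse[OF \<sigma> r])
  then show "u \<in> darboux \<sigma> ` open_stratum nu lam"
    using darboux_chart_inverse[OF \<sigma> r] by (metis image_eqI)
qed

text \<open>Adding the same small real number to all coordinates \<open>z\<^sub>j\<close> makes them nonzero, except for finitely
  many choices of that number. The limit that defines the holomorphic coordinates is therefore not taken along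
  the trivial filter.\<close>
lemma open_stratum_accumulates:
  assumes \<sigma>: "vertex_ordering \<sigma>" and u: "u \<in> chart_range \<sigma>"
  shows "u islimpt (darboux \<sigma> ` open_stratum nu lam)"
  unfolding islimpt_approachable
proof (intro allI impI)
  fix e :: real assume e: "e > 0"
  obtain d where d: "d > 0" "ball u d \<subseteq> chart_range \<sigma>"
    using open_chart_range u open_contains_ball by blast
  define w :: "real^('n + 'n)" where "w = (\<chi> k. case k of Inl j \<Rightarrow> 1 | Inr j \<Rightarrow> 0)"
  define c where "c = min e d / (norm w + 1)"
  have nw: "norm w + 1 > 0" by (simp add: add_nonneg_pos)
  have c: "c > 0" using e d nw by (simp add: c_def)
  have "infinite ({0<..<c} - range (\<lambda>j. - (u $ Inl j)))"
    using infinite_Ioo[OF c] by (intro Diff_infinite_finite) auto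
  then obtain t where "t \<in> {0<..<c} - range (\<lambda>j. - (u $ Inl j))"
    using infinite_imp_nonempty by blast
  then have t: "0 < t" "t < c" "\<And>j. t \<noteq> - (u $ Inl j)" by auto
  have "t * norm w < min e d"
  proof -
    have "t * norm w \<le> t * (norm w + 1)" using t by simp
    also have "\<dots> < c * (norm w + 1)" using t nw by simp
    also have "\<dots> = min e d" using nw by (simp add: c_def)
    finally show ?thesis .
  qed
  then have dist: "dist (u + t *\<^sub>R w) u < e" "dist (u + t *\<^sub>R w) u < d" using t by (auto simp: dist_norm)
  have "complex_coords (u + t *\<^sub>R w) $ j \<noteq> 0" for j
    using t(3)[of j] by (auto simp: complex_coords_def w_def complex_eq_iff)
  then have "u + t *\<^sub>R w \<in> darboux \<sigma> ` open_stratum nu lam"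
    using d dist(2) by (auto simp: darboux_image_open_stratum[OF \<sigma>] dist_commute)
  moreover have "u + t *\<^sub>R w \<noteq> u"
  proof -
    have "w $ Inl undefined = 1" by (simp add: w_def)
    then have "w \<noteq> 0" by (metis zero_index zero_neq_one)
    then show ?thesis using t by simp
  qed
  ultimately show "\<exists>x'\<in>darboux \<sigma> ` open_stratum nu lam. x' \<noteq> u \<and> dist x' u < e"
    using dist by blast
qed

end

section \<open>Holomorphic coordinates\<close>

lemma Re_Im_vec_decomposition:
  "(V :: complex^'m) = complex_vec (\<chi> k. Re (V $ k)) + \<i> *s complex_vec (\<chi> k. Im (V $ k))"
  by (simp add: vec_eq_iff complex_vec_def complex_eq_iff)

lemma complex_jacobian_mult:
  assumes "(F has_derivative F') (at u)"
  shows "complex_jacobian F u *v V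
    = complex_vec (F' (\<chi> k. Re (V $ k))) + \<i> *s complex_vec (F' (\<chi> k. Im (V $ k)))"
proof -
  have D: "D F u = F'" using assms by (rule D_eqI)
  have lin: "F' v = matrix F' *v v" for v
    using matrix_works[OF linear_matrix_vector_mul_eq[THEN iffD2]] has_derivative_linear[OF assms]
    by (simp add: matrix_works)
  have "(complex_jacobian F u *v V) $ i
      = complex_of_real ((matrix F' *v (\<chi> k. Re (V $ k))) $ i) + \<i> * complex_of_real ((matrix F' *v (\<chi> k. Im (V $ k))) $ i)" for i
    unfolding complex_jacobian_def D
    by (simp add: matrix_vector_mult_def complex_eq_iff)
  then show ?thesis
    by (simp add: vec_eq_iff complex_vec_def flip: lin)
qed

lemma complex_jacobian_compose:
  assumes "(F has_derivative F') (at u)" "(G has_derivative G') (at (F u))"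
  shows "complex_jacobian (\<lambda>x. G (F x)) u *v V = complex_jacobian G (F u) *v (complex_jacobian F u *v V)"
proof -
  have c: "((\<lambda>x. G (F x)) has_derivative (\<lambda>h. G' (F' h))) (at u)"
    by (rule has_derivative_compose[OF assms])
  have r: "(\<chi> k. Re ((complex_jacobian F u *v V) $ k)) = F' (\<chi> k. Re (V $ k))"
    "(\<chi> k. Im ((complex_jacobian F u *v V) $ k)) = F' (\<chi> k. Im (V $ k))"
    by (simp_all add: complex_jacobian_mult[OF assms(1)] vec_eq_iff complex_vec_def)
  show ?thesis
    unfolding complex_jacobian_mult[OF c] complex_jacobian_mult[OF assms(2)] r ..
qed

lemma complex_jacobian_cong_open:
  assumes "open S" "u \<in> S" "\<And>x. x \<in> S \<Longrightarrow> F x = G x"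
  shows "complex_jacobian F u = complex_jacobian G u"
  using frechet_derivative_cong_open[OF assms] by (simp add: complex_jacobian_def)

lemma complex_jacobian_id: "complex_jacobian (\<lambda>u. u) u *v V = V"
  by (subst complex_jacobian_mult[OF has_derivative_ident]) (rule Re_Im_vec_decomposition[symmetric])

lemma dz_complex_vec:
  "dz (complex_vec u) = complex_coords u" "dzbar (complex_vec u) $ j = cnj (complex_coords u $ j)"
  by (simp_all add: dz_def dzbar_def complex_vec_def complex_coords_def vec_eq_iff complex_eq_iff)

lemma dz_jacobian:
  assumes "(w has_derivative W') (at u)"
  shows "dz (complex_jacobian (\<lambda>u. realify (w u)) u *v V) $ j
      = W' (\<chi> k. Re (V $ k)) $ j + \<i> * W' (\<chi> k. Im (V $ k)) $ j"
    and "dzbar (complex_jacobian (\<lambda>u. realify (w u)) u *v V) $ j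
      = cnj (W' (\<chi> k. Re (V $ k)) $ j) + \<i> * cnj (W' (\<chi> k. Im (V $ k)) $ j)"
  by (simp_all add: complex_jacobian_mult[OF bounded_linear.has_derivative[OF bounded_linear_realify assms]]
      dz_add dz_scale dz_complex_vec)

lemma dz_Re_Im:
  "dz V $ j = complex_coords (\<chi> k. Re (V $ k)) $ j + \<i> * complex_coords (\<chi> k. Im (V $ k)) $ j"
  "dzbar V $ j = cnj (complex_coords (\<chi> k. Re (V $ k)) $ j) + \<i> * cnj (complex_coords (\<chi> k. Im (V $ k)) $ j)"
  by (simp_all add: dz_def dzbar_def complex_coords_def complex_eq_iff)

lemma dzbar_jacobian_complex_linear:
  assumes "(E has_derivative E') (at (complex_coords u))" and lin: "\<And>y. E' (\<i> *s y) = \<i> *s E' y"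
    and V: "dzbar V = 0"
  shows "dzbar (complex_jacobian (\<lambda>u. realify (E (complex_coords u))) u *v V) = 0"
proof -
  have der: "((\<lambda>u. E (complex_coords u)) has_derivative (\<lambda>v. E' (complex_coords v))) (at u)"
    by (rule has_derivative_compose[OF bounded_linear.has_derivative[OF bounded_linear_complex_coords has_derivative_ident] assms(1)])
  have "V $ Inl j = \<i> * V $ Inr j" for j
    using arg_cong[OF V, of "\<lambda>x. x $ j"] by (simp add: dzbar_def)
  then have "complex_coords (\<chi> k. Re (V $ k)) = \<i> *s complex_coords (\<chi> k. Im (V $ k))"
    by (simp add: complex_coords_def vec_eq_iff complex_eq_iff)
  then show ?thesis
    by (subst vec_eq_iff) (simp add: dz_jacobian(2)[OF der] lin)
qed

context delzant_polytope
begin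

text \<open>The regularity of the summand \<open>\<phi> + s \<psi>\<close> of the potential on which the proof relies.\<close>
definition potential_part :: "(real^'n \<Rightarrow> real) \<Rightarrow> bool" where
  "potential_part F \<longleftrightarrow> (\<exists>U. open U \<and> P \<subseteq> U \<and> Ck_on 2 U F)"

text \<open>The derivative of the potential \<open>g\<^sub>P + F\<close> along \<open>l\<^sub>j\<close> without its singular term \<open>1/2 ln l\<^sub>j\<close>. It
  is smooth on the star of the vertex, because the facets that do not contain the vertex are away from it.\<close>
definition log_coord :: "(real^'n \<Rightarrow> real) \<Rightarrow> ('n \<Rightarrow> 'd) \<Rightarrow> 'n \<Rightarrow> real^'n \<Rightarrow> real" where
  "log_coord F \<sigma> j x =
     1/2 * (1 + (\<Sum>r\<in>- range \<sigma>. (normal r \<bullet> dual \<sigma> j) * (ln (L r x) + 1))) + D F x (dual \<sigma> j)"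

definition log_coord_deriv :: "(real^'n \<Rightarrow> real) \<Rightarrow> ('n \<Rightarrow> 'd) \<Rightarrow> 'n \<Rightarrow> real^'n \<Rightarrow> real^'n \<Rightarrow> real" where
  "log_coord_deriv F \<sigma> j x v =
     1/2 * (\<Sum>r\<in>- range \<sigma>. (normal r \<bullet> dual \<sigma> j) * (normal r \<bullet> v) / L r x) + D2 F x (dual \<sigma> j) v"

definition w_coord :: "(real^'n \<Rightarrow> real) \<Rightarrow> ('n \<Rightarrow> 'd) \<Rightarrow> real^('n + 'n) \<Rightarrow> complex^'n" where
  "w_coord F \<sigma> u = (\<chi> j. complex_coords u $ j / complex_of_real (sqrt 2)
     * complex_of_real (exp (log_coord F \<sigma> j (base_point \<sigma> u))))"

definition coord_hessian :: "(real^'n \<Rightarrow> real) \<Rightarrow> ('n \<Rightarrow> 'd) \<Rightarrow> real^'n \<Rightarrow> real^'n^'n" where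
  "coord_hessian F \<sigma> x = (\<chi> j m. log_coord_deriv F \<sigma> j x (dual \<sigma> m))"

text \<open>In the interior, the derivative of \<open>g\<^sub>P + F\<close> at \<open>x\<close> in the direction \<open>v\<close>. At boundary points
  \<open>ln 0 = 0\<close> gives a finite value that is still linear in \<open>v\<close>, so that the relations between the charts
  hold there without a separate limit argument.\<close>
definition gradient_pairing :: "(real^'n \<Rightarrow> real) \<Rightarrow> real^'n \<Rightarrow> real^'n \<Rightarrow> real" where
  "gradient_pairing F x v = 1/2 * (\<Sum>r\<in>UNIV. (normal r \<bullet> v) * (ln (L r x) + 1)) + D F x v"

lemma potential_partD:
  assumes "potential_part F" "x \<in> P"
  shows "F differentiable (at x)" "(\<lambda>y. D F y v) differentiable (at x)"
    "isCont (\<lambda>y. D2 F y v w) x" "D2 F x v w = D2 F x w v"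
    "linear (D F x)" "linear (D2 F x v)" "linear (\<lambda>v. D2 F x v w)"
proof -
  obtain U where U: "open U" "Ck_on 2 U F" "x \<in> U"
    using assms unfolding potential_part_def by auto
  show "F differentiable (at x)" "(\<lambda>y. D F y v) differentiable (at x)" "isCont (\<lambda>y. D2 F y v w) x"
    by (rule Ck_on_2D[OF U])+
  show "D2 F x v w = D2 F x w v" by (rule second_derivative_symmetric[OF U])
  show "linear (D F x)" by (rule linear_D[OF Ck_on_2D(1)[OF U]])
  show "linear (D2 F x v)" "linear (\<lambda>v. D2 F x v w)" by (rule linear_D2[OF U])+
qed

lemma potential_part_zero: "potential_part (\<lambda>_. 0)"
  unfolding potential_part_def using Ck_on_2_zero by blast

lemma has_derivative_ell: "(L r has_derivative (\<lambda>v. normal r \<bullet> v)) (at x)"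
  unfolding ell_def by (auto intro!: derivative_eq_intros)

lemma has_derivative_log_coord:
  assumes F: "potential_part F" and x: "x \<in> P" and pos: "\<And>r. r \<notin> range \<sigma> \<Longrightarrow> 0 < L r x"
  shows "(log_coord F \<sigma> j has_derivative log_coord_deriv F \<sigma> j x) (at x)"
proof -
  have "((\<lambda>x. ln (L r x)) has_derivative (\<lambda>v. (normal r \<bullet> v) / L r x)) (at x)" if "r \<in> - range \<sigma>" for r
    using pos that by (auto intro!: derivative_eq_intros has_derivative_ell simp: divide_inverse)
  then have "((\<lambda>x. \<Sum>r\<in>- range \<sigma>. (normal r \<bullet> dual \<sigma> j) * (ln (L r x) + 1)) has_derivative
      (\<lambda>v. \<Sum>r\<in>- range \<sigma>. (normal r \<bullet> dual \<sigma> j) * ((normal r \<bullet> v) / L r x + 0))) (at x)"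
    by (intro has_derivative_sum has_derivative_mult_right has_derivative_add has_derivative_const) 
  then have "((\<lambda>x. 1/2 * (1 + (\<Sum>r\<in>- range \<sigma>. (normal r \<bullet> dual \<sigma> j) * (ln (L r x) + 1))) + D F x (dual \<sigma> j))
     has_derivative (\<lambda>v. 1/2 * (0 + (\<Sum>r\<in>- range \<sigma>. (normal r \<bullet> dual \<sigma> j) * ((normal r \<bullet> v) / L r x + 0))) + D2 F x (dual \<sigma> j) v)) (at x)"
    by (intro has_derivative_mult_right has_derivative_add has_derivative_const
        has_derivative_D potential_partD(2)[OF F x])
  then show ?thesis
    unfolding log_coord_def[abs_def] log_coord_deriv_def[abs_def] by simp
qed

lemma linear_log_coord_deriv:
  assumes "potential_part F" "x \<in> P"
  shows "linear (log_coord_deriv F \<sigma> j x)"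
proof -
  note l = potential_partD(6)[OF assms]
  show ?thesis
    unfolding log_coord_deriv_def
    by (intro linearI)
       (simp_all add: linear_add[OF l] linear_cmul[OF l] inner_add_right algebra_simps add_divide_distrib sum.distrib sum_distrib_left)
qed

lemma log_coord_deriv_expansion:
  assumes "potential_part F" "x \<in> P"
  shows "log_coord_deriv F \<sigma> j x (\<Sum>m\<in>UNIV. c m *\<^sub>R dual \<sigma> m) = (\<Sum>m\<in>UNIV. coord_hessian F \<sigma> x $ j $ m * c m)"
  using linear_log_coord_deriv[OF assms, of \<sigma> j]
  by (simp add: linear_sum linear_cmul coord_hessian_def mult.commute)

lemma coord_hessian_symmetric:
  assumes "potential_part F" "x \<in> P"
  shows "transpose (coord_hessian F \<sigma> x) = coord_hessian F \<sigma> x"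
  unfolding vec_eq_iff
  by (simp add: transpose_def coord_hessian_def log_coord_deriv_def
      potential_partD(4)[OF assms, of "dual \<sigma> _" "dual \<sigma> _"] mult_ac)

lemma chart_range_pos:
  "u \<in> chart_range \<sigma> \<Longrightarrow> r \<notin> range \<sigma> \<Longrightarrow> 0 < L r (base_point \<sigma> u)"
  by (simp add: chart_range_def)

definition w_coord_deriv where
  "w_coord_deriv F \<sigma> u v = (\<chi> j. complex_of_real (exp (log_coord F \<sigma> j (base_point \<sigma> u)) / sqrt 2) *
     (complex_coords v $ j + complex_coords u $ j * complex_of_real
        (\<Sum>m\<in>UNIV. coord_hessian F \<sigma> (base_point \<sigma> u) $ j $ m * (u $ Inl m * v $ Inl m + u $ Inr m * v $ Inr m))))"

lemma has_derivative_w_coord: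
  assumes F: "potential_part F" and \<sigma>: "vertex_ordering \<sigma>" and u: "u \<in> chart_range \<sigma>"
  shows "(w_coord F \<sigma> has_derivative w_coord_deriv F \<sigma> u) (at u)"
  unfolding has_derivative_vec_iff
proof
  fix j
  let ?x = "base_point \<sigma> u"
  note x = base_point_mem_polytope(1)[OF \<sigma> u]
  have "((\<lambda>u. log_coord F \<sigma> j (base_point \<sigma> u)) has_derivative
      (\<lambda>v. log_coord_deriv F \<sigma> j ?x (\<Sum>m\<in>UNIV. (u $ Inl m * v $ Inl m + u $ Inr m * v $ Inr m) *\<^sub>R dual \<sigma> m))) (at u)"
    by (rule has_derivative_compose[OF has_derivative_base_point has_derivative_log_coord[OF F x chart_range_pos[OF u]]])
  then have "((\<lambda>u. log_coord F \<sigma> j (base_point \<sigma> u)) has_derivative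
      (\<lambda>v. \<Sum>m\<in>UNIV. coord_hessian F \<sigma> ?x $ j $ m * (u $ Inl m * v $ Inl m + u $ Inr m * v $ Inr m))) (at u)"
    (is "(_ has_derivative ?h) _")
    by (simp add: log_coord_deriv_expansion[OF F x])
  then have "((\<lambda>u. complex_of_real (exp (log_coord F \<sigma> j (base_point \<sigma> u)))) has_derivative
      (\<lambda>v. complex_of_real (exp (log_coord F \<sigma> j ?x) * ?h v))) (at u)"
    by (intro has_derivative_of_real) (auto intro!: derivative_eq_intros simp: mult.commute)
  moreover have "((\<lambda>u. complex_coords u $ j / complex_of_real (sqrt 2)) has_derivative
      (\<lambda>v. complex_coords v $ j / complex_of_real (sqrt 2))) (at u)"
    by (rule bounded_linear.has_derivative[OF bounded_linear_divide
          bounded_linear.has_derivative[OF bounded_linear_vec_nth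
            bounded_linear.has_derivative[OF bounded_linear_complex_coords has_derivative_ident]]])
  ultimately have "((\<lambda>u. complex_coords u $ j / complex_of_real (sqrt 2)
       * complex_of_real (exp (log_coord F \<sigma> j (base_point \<sigma> u)))) has_derivative
     (\<lambda>v. complex_coords u $ j / complex_of_real (sqrt 2) * complex_of_real (exp (log_coord F \<sigma> j ?x) * ?h v)
       + complex_coords v $ j / complex_of_real (sqrt 2) * complex_of_real (exp (log_coord F \<sigma> j ?x)))) (at u)"
    by (rule has_derivative_mult[rotated])
  moreover have "complex_coords u $ j / complex_of_real (sqrt 2) * complex_of_real (exp (log_coord F \<sigma> j ?x) * ?h v)
       + complex_coords v $ j / complex_of_real (sqrt 2) * complex_of_real (exp (log_coord F \<sigma> j ?x))
     = w_coord_deriv F \<sigma> u v $ j" for v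
    by (simp only: w_coord_deriv_def vec_lambda_beta of_real_mult of_real_divide) (simp add: field_simps)
  ultimately show "((\<lambda>u. w_coord F \<sigma> u $ j) has_derivative (\<lambda>v. w_coord_deriv F \<sigma> u v $ j)) (at u)"
    by (simp add: w_coord_def)
qed

text \<open>Up to nonzero factors, the differentials of \<open>w\<^sub>j\<close> and \<open>cnj w\<^sub>j\<close> are the forms that define the
  holomorphic space and its conjugate.\<close>
lemma w_jacobian:
  fixes V :: "complex^('n + 'n)"
  assumes F: "potential_part F" and \<sigma>: "vertex_ordering \<sigma>" and u: "u \<in> chart_range \<sigma>"
  defines "H \<equiv> coord_hessian F \<sigma> (base_point \<sigma> u)" and "z \<equiv> complex_coords u"
    and "c \<equiv> \<lambda>j. complex_of_real (exp (log_coord F \<sigma> j (base_point \<sigma> u)) / sqrt 2)"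
  shows "dz (complex_jacobian (\<lambda>u. realify (w_coord F \<sigma> u)) u *v V) $ j
      = c j * (dz V $ j + z $ j * of_real_mult H (dl z V) $ j)"
    and "dzbar (complex_jacobian (\<lambda>u. realify (w_coord F \<sigma> u)) u *v V) $ j
      = c j * (dzbar V $ j + cnj (z $ j) * of_real_mult H (dl z V) $ j)"
proof -
  note der = has_derivative_w_coord[OF F \<sigma> u]
  have l: "dl z V $ m = complex_of_real (u $ Inl m * Re (V $ Inl m) + u $ Inr m * Re (V $ Inr m))
      + \<i> * complex_of_real (u $ Inl m * Im (V $ Inl m) + u $ Inr m * Im (V $ Inr m))" for m
    by (simp add: dl_def z_def complex_coords_def complex_eq_iff)
  have m: "of_real_mult H (dl z V) $ j
      = complex_of_real (\<Sum>m\<in>UNIV. H $ j $ m * (u $ Inl m * Re (V $ Inl m) + u $ Inr m * Re (V $ Inr m)))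
      + \<i> * complex_of_real (\<Sum>m\<in>UNIV. H $ j $ m * (u $ Inl m * Im (V $ Inl m) + u $ Inr m * Im (V $ Inr m)))"
    by (simp add: of_real_mult_def l complex_eq_iff)
  show "dz (complex_jacobian (\<lambda>u. realify (w_coord F \<sigma> u)) u *v V) $ j
      = c j * (dz V $ j + z $ j * of_real_mult H (dl z V) $ j)"
    unfolding dz_jacobian[OF der] m dz_Re_Im(1)[of V j] w_coord_deriv_def vec_lambda_beta
    by (fold H_def z_def) (simp add: c_def algebra_simps)
  show "dzbar (complex_jacobian (\<lambda>u. realify (w_coord F \<sigma> u)) u *v V) $ j
      = c j * (dzbar V $ j + cnj (z $ j) * of_real_mult H (dl z V) $ j)"
    unfolding dz_jacobian[OF der] m dz_Re_Im(2)[of V j] w_coord_deriv_def vec_lambda_beta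
    by (fold H_def z_def) (simp add: c_def algebra_simps)
qed

lemma gradient_pairing_dual:
  assumes "vertex_ordering \<sigma>"
  shows "gradient_pairing F x (dual \<sigma> j) = 1/2 * ln (L (\<sigma> j) x) + log_coord F \<sigma> j x"
proof -
  obtain v where inj: "inj \<sigma>" using vertex_orderingD[OF assms] by metis
  have "(\<Sum>r\<in>UNIV. (normal r \<bullet> dual \<sigma> j) * (ln (L r x) + 1))
      = (\<Sum>r\<in>range \<sigma>. (normal r \<bullet> dual \<sigma> j) * (ln (L r x) + 1))
        + (\<Sum>r\<in>- range \<sigma>. (normal r \<bullet> dual \<sigma> j) * (ln (L r x) + 1))"
    by (subst sum.union_disjoint[symmetric]) (auto intro!: sum.cong)
  also have "(\<Sum>r\<in>range \<sigma>. (normal r \<bullet> dual \<sigma> j) * (ln (L r x) + 1)) = ln (L (\<sigma> j) x) + 1"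
    by (simp add: sum.reindex[OF inj] normal_inner_dual[OF assms] if_distrib[of "\<lambda>a. a * _"] cong: if_cong)
  finally show ?thesis
    by (simp add: gradient_pairing_def log_coord_def algebra_simps)
qed

lemma w_coord_darboux:
  assumes p: "p \<in> chart_dom \<sigma>"
  shows "w_coord F \<sigma> (darboux \<sigma> p) $ j =
    (if \<sigma> j \<in> tight_at (moment p) then 0
     else exp (complex_of_real (gradient_pairing F (moment p) (dual \<sigma> j))
       + \<i> * complex_of_real (dual \<sigma> j \<bullet> angle_of p)))"
proof -
  have \<sigma>: "vertex_ordering \<sigma>" by (rule chart_domain_vertex[OF p])
  let ?x = "moment p"
  have x: "?x \<in> P" using p mem_chart_domain_iff[OF \<sigma>] mem_manifoldD by blast
  show ?thesis
  proof (cases "\<sigma> j \<in> tight_at ?x")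
    case True
    then show ?thesis by (simp add: w_coord_def complex_coords_darboux tight_def)
  next
    case False
    then have pos: "0 < L (\<sigma> j) ?x" using ell_nonneg[OF x, of "\<sigma> j"] by (simp add: tight_def less_le)
    have "exp (1/2 * ln (L (\<sigma> j) ?x)) = sqrt (L (\<sigma> j) ?x)"
      using pos powr_half_sqrt[of "L (\<sigma> j) ?x"] by (simp add: powr_def)
    then have "exp (gradient_pairing F ?x (dual \<sigma> j)) = sqrt (2 * L (\<sigma> j) ?x) / sqrt 2 * exp (log_coord F \<sigma> j ?x)"
      unfolding gradient_pairing_dual[OF \<sigma>] exp_add by (simp add: real_sqrt_mult)
    then show ?thesis
      using False by (simp add: w_coord_def complex_coords_darboux base_point_darboux[OF p] exp_add cis_conv_exp
          exp_of_real flip: of_real_divide of_real_mult) (simp add: mult_ac)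
  qed
qed

lemma linear_gradient_pairing:
  assumes "potential_part F" "x \<in> P"
  shows "linear (gradient_pairing F x)"
proof -
  note l = potential_partD(5)[OF assms]
  show ?thesis
    unfolding gradient_pairing_def
    by (intro linearI)
       (simp_all add: linear_add[OF l] linear_cmul[OF l] inner_add_right algebra_simps sum.distrib sum_distrib_left)
qed

lemma has_derivative_potential:
  assumes F: "potential_part F" and x: "x \<in> interior P"
    and g: "\<And>y. y \<in> interior P \<Longrightarrow> g y = guillemin_potential nu lam y + F y"
  shows "(g has_derivative gradient_pairing F x) (at x)"
proof -
  have pos: "0 < L r x" for r using x by (simp add: interior_polytope)
  have "((\<lambda>y. L r y * ln (L r y)) has_derivative (\<lambda>v. (normal r \<bullet> v) * (ln (L r x) + 1))) (at x)" for r
    using pos[of r] by (auto intro!: derivative_eq_intros has_derivative_ell simp: fun_eq_iff field_simps)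
  then have "((\<lambda>y. 1/2 * (\<Sum>r\<in>UNIV. L r y * ln (L r y)) + F y) has_derivative
      (\<lambda>v. 1/2 * (\<Sum>r\<in>UNIV. (normal r \<bullet> v) * (ln (L r x) + 1)) + D F x v)) (at x)"
    by (intro has_derivative_add has_derivative_mult_right has_derivative_sum has_derivative_D
        potential_partD(1)[OF F]) (use x interior_subset in blast)+
  then show ?thesis
    unfolding gradient_pairing_def
    by (rule has_derivative_transform_within_open[OF _ open_interior x]) (simp add: g guillemin_potential_def)
qed

text \<open>The explicit formula is continuous on the whole chart, so it is the extension from the open
  stratum.\<close>
lemma holomorphic_coords_eq:
  assumes F: "potential_part F" and p: "p \<in> chart_dom \<sigma>"
    and g: "\<And>y. y \<in> interior P \<Longrightarrow> g y = guillemin_potential nu lam y + F y"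
  shows "holomorphic_coords nu lam g \<sigma> p = w_coord F \<sigma> (darboux \<sigma> p)"
proof -
  have \<sigma>: "vertex_ordering \<sigma>" by (rule chart_domain_vertex[OF p])
  let ?u = "darboux \<sigma> p" and ?S = "darboux \<sigma> ` open_stratum nu lam"
  note u = darboux_chart_mem_chart_range[OF p]
  have eq: "holomorphic_coords_open nu lam g \<sigma> (darboux_inv \<sigma> v) = w_coord F \<sigma> v" if v: "v \<in> ?S" for v
  proof -
    obtain q where q: "q \<in> open_stratum nu lam" "v = darboux \<sigma> q" using v by blast
    then have q': "q \<in> manifold" "tight_at (moment q) = {}" by (auto simp: mem_open_stratum_iff)
    then have qc: "q \<in> chart_dom \<sigma>" by (simp add: mem_chart_domain_iff[OF \<sigma>])
    have "moment q \<in> interior P" using q by (simp add: open_stratum_def)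
    from D_eqI[OF has_derivative_potential[OF F this g]]
    have "D g (moment q) = gradient_pairing F (moment q)" .
    then show ?thesis
      using q' by (simp add: q(2) qc holomorphic_coords_open_def vec_eq_iff w_coord_darboux[OF qc]
          vertex_angle_eq flip: dual_def)
  qed
  have "(w_coord F \<sigma> \<longlongrightarrow> w_coord F \<sigma> ?u) (at ?u within ?S)"
    using continuous_at_imp_continuous_at_within[OF has_derivative_continuous[OF has_derivative_w_coord[OF F \<sigma> u]]]
    by (simp add: continuous_within)
  then have "((\<lambda>v. holomorphic_coords_open nu lam g \<sigma> (darboux_inv \<sigma> v)) \<longlongrightarrow> w_coord F \<sigma> ?u) (at ?u within ?S)"
    by (rule Lim_transform_eventually) (simp add: eventually_at_filter eq)
  moreover have "\<not> trivial_limit (at ?u within ?S)"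
    using open_stratum_accumulates[OF \<sigma> u] by (simp add: trivial_limit_within)
  ultimately show ?thesis
    unfolding holomorphic_coords_def by (intro tendsto_Lim)
qed

end

section \<open>Transition maps\<close>

lemma power_int_complex_differentiable:
  fixes a :: complex
  assumes "a \<noteq> 0 \<or> n = 0 \<or> n = 1"
  shows "\<exists>D. ((\<lambda>x. x powi n) has_field_derivative D) (at a)"
proof -
  consider "a \<noteq> 0" | "n = 0" | "n = 1" using assms by blast
  then show ?thesis
  proof cases
    case 1
    then show ?thesis by (auto intro!: exI derivative_eq_intros)
  next
    case 2
    then show ?thesis by (auto intro!: exI[of _ 0])
  next
    case 3
    then show ?thesis by (auto intro!: exI[of _ 1])
  qed
qed

lemma monomial_map_complex_differentiable:
  fixes a :: "complex^'n" and B :: "'k::finite \<Rightarrow> 'n \<Rightarrow> int"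
  assumes "\<And>k m. a $ m \<noteq> 0 \<or> B k m = 0 \<or> B k m = 1"
  obtains E' where "((\<lambda>\<zeta>. (\<chi> k. \<Prod>m\<in>UNIV. \<zeta> $ m powi B k m) :: complex^'k) has_derivative E') (at a)"
    and "\<And>y. E' (\<i> *s y) = \<i> *s E' y"
proof -
  obtain d where d: "\<And>k m. ((\<lambda>x. x powi B k m) has_field_derivative d k m) (at (a $ m))"
    using power_int_complex_differentiable[OF assms] by metis
  define E' where "E' y = (\<chi> k. \<Sum>i\<in>UNIV. d k i * y $ i * (\<Prod>j\<in>UNIV - {i}. a $ j powi B k j))" for y :: "complex^'n"
  have f: "((\<lambda>\<zeta> :: complex^'n. \<zeta> $ m powi B k m) has_derivative (\<lambda>y. d k m * y $ m)) (at a)" for k m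
    using has_derivative_compose[OF bounded_linear.has_derivative[OF bounded_linear_vec_nth has_derivative_ident]
        d[unfolded has_field_derivative_def]] .
  have "((\<lambda>\<zeta>. (\<chi> k. \<Prod>m\<in>UNIV. \<zeta> $ m powi B k m) :: complex^'k) has_derivative E') (at a)"
    unfolding has_derivative_vec_iff E'_def vec_lambda_beta
    by (intro allI has_derivative_prod f)
  moreover have "E' (\<i> *s y) = \<i> *s E' y" for y
    by (simp add: E'_def vec_eq_iff sum_distrib_left mult_ac)
  ultimately show ?thesis by (rule that)
qed

context delzant_polytope
begin

text \<open>The floor only converts the type, as the inner product is an integer.\<close>
definition exponent :: "('n \<Rightarrow> 'd) \<Rightarrow> ('n \<Rightarrow> 'd) \<Rightarrow> 'n \<Rightarrow> 'n \<Rightarrow> int" where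
  "exponent \<sigma> \<tau> k m = \<lfloor>normal (\<sigma> m) \<bullet> dual \<tau> k\<rfloor>"

text \<open>The change of holomorphic coordinates between two vertex charts.\<close>
definition monomial_map :: "('n \<Rightarrow> 'd) \<Rightarrow> ('n \<Rightarrow> 'd) \<Rightarrow> complex^'n \<Rightarrow> complex^'n" where
  "monomial_map \<sigma> \<tau> \<zeta> = (\<chi> k. \<Prod>m\<in>UNIV. \<zeta> $ m powi exponent \<sigma> \<tau> k m)"

definition transition :: "('n \<Rightarrow> 'd) \<Rightarrow> ('n \<Rightarrow> 'd) \<Rightarrow> real^('n + 'n) \<Rightarrow> real^('n + 'n)" where
  "transition \<sigma> \<tau> u = darboux \<tau> (darboux_inv \<sigma> u)"

definition chart_overlap :: "('n \<Rightarrow> 'd) \<Rightarrow> ('n \<Rightarrow> 'd) \<Rightarrow> (real^('n + 'n)) set" where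
  "chart_overlap \<sigma> \<tau> = {u \<in> chart_range \<sigma>. \<forall>r\<in>- range \<tau>. 0 < L r (base_point \<sigma> u)}"

lemma exponent_eq:
  assumes "vertex_ordering \<tau>"
  shows "of_int (exponent \<sigma> \<tau> k m) = normal (\<sigma> m) \<bullet> dual \<tau> k"
  using integral_inner_dual[OF assms, of "nu (\<sigma> m)" k] by (auto simp: exponent_def elim: Ints_cases)

lemma exponent_common_facet:
  assumes "vertex_ordering \<tau>" "\<sigma> m = \<tau> k'"
  shows "exponent \<sigma> \<tau> k m = (if k' = k then 1 else 0)"
  by (simp add: exponent_def assms(2) normal_inner_dual[OF assms(1)])

text \<open>The logarithms of the coordinates are values of a linear form at the dual basis vectors, and
  the two dual bases are related by the matrix of exponents. The coordinate of a facet vanishes iff the facet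
  contains the point; then both vertices lie on the facet, and its exponents are \<open>0\<close> and \<open>1\<close>.\<close>
lemma w_coord_transition:
  assumes F: "potential_part F" and p: "p \<in> chart_dom \<sigma>" "p \<in> chart_dom \<tau>"
  shows "w_coord F \<tau> (darboux \<tau> p) = monomial_map \<sigma> \<tau> (w_coord F \<sigma> (darboux \<sigma> p))"
proof -
  have \<sigma>: "vertex_ordering \<sigma>" and \<tau>: "vertex_ordering \<tau>"
    using p chart_domain_vertex by auto
  let ?x = "moment p" and ?\<theta> = "angle_of p"
  have x: "?x \<in> P" and t: "tight_at ?x \<subseteq> range \<sigma>" "tight_at ?x \<subseteq> range \<tau>"
    using p mem_chart_domain_iff[OF \<sigma>] mem_chart_domain_iff[OF \<tau>] mem_manifoldD by blast+
  have "(if \<tau> k \<in> tight_at ?x then 0 else exp (complex_of_real (gradient_pairing F ?x (dual \<tau> k)) + \<i> * complex_of_real (dual \<tau> k \<bullet> ?\<theta>)))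
    = (\<Prod>m\<in>UNIV. (if \<sigma> m \<in> tight_at ?x then 0 else exp (complex_of_real (gradient_pairing F ?x (dual \<sigma> m))
        + \<i> * complex_of_real (dual \<sigma> m \<bullet> ?\<theta>))) powi exponent \<sigma> \<tau> k m)"
    (is "?l = (\<Prod>m\<in>UNIV. ?f m)") for k
  proof (cases "\<tau> k \<in> tight_at ?x")
    case True
    then have "\<tau> k \<in> range \<sigma>" using t(1) by blast
    then obtain m where "\<tau> k = \<sigma> m" by blast
    then have m: "\<sigma> m = \<tau> k" by simp
    then have "exponent \<sigma> \<tau> k m = 1" using exponent_common_facet[OF \<tau>, of \<sigma> m k k] by simp
    then have f0: "?f m = 0" using True m by simp
    have "(\<Prod>m\<in>UNIV. ?f m) = 0" by (rule prod_zero[OF finite bexI[of "\<lambda>m. ?f m = 0", OF f0 UNIV_I]])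
    then show ?thesis using True by simp
  next
    case False
    have f: "?f m = exp (complex_of_real (gradient_pairing F ?x ((normal (\<sigma> m) \<bullet> dual \<tau> k) *\<^sub>R dual \<sigma> m))
        + \<i> * complex_of_real (((normal (\<sigma> m) \<bullet> dual \<tau> k) *\<^sub>R dual \<sigma> m) \<bullet> ?\<theta>))" for m
    proof (cases "\<sigma> m \<in> tight_at ?x")
      case True
      then have "\<sigma> m \<in> range \<tau>" using t(2) by blast
      then obtain k' where k': "\<sigma> m = \<tau> k'" by blast
      then have "k' \<noteq> k" using True False by auto
      then have "exponent \<sigma> \<tau> k m = 0" "normal (\<sigma> m) \<bullet> dual \<tau> k = 0"
        using exponent_common_facet[OF \<tau>, of \<sigma> m k' k] normal_inner_dual[OF \<tau>, of k' k] by (simp_all add: k')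
      then show ?thesis using linear_0[OF linear_gradient_pairing[OF F x]] by simp
    next
      case False
      then show ?thesis
        by (simp add: exp_power_int linear_cmul[OF linear_gradient_pairing[OF F x]] algebra_simps
            flip: exponent_eq[OF \<tau>])
    qed
    have "(\<Prod>m\<in>UNIV. ?f m) = exp (complex_of_real (gradient_pairing F ?x (\<Sum>m\<in>UNIV. (normal (\<sigma> m) \<bullet> dual \<tau> k) *\<^sub>R dual \<sigma> m))
        + \<i> * complex_of_real ((\<Sum>m\<in>UNIV. (normal (\<sigma> m) \<bullet> dual \<tau> k) *\<^sub>R dual \<sigma> m) \<bullet> ?\<theta>))"
      unfolding f linear_sum[OF linear_gradient_pairing[OF F x]] inner_sum_left
      by (simp add: exp_sum[symmetric] sum.distrib sum_distrib_left)
    then show ?thesis using False by (simp add: dual_expansion[OF \<sigma>])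
  qed
  then show ?thesis
    by (simp add: vec_eq_iff monomial_map_def w_coord_darboux[OF p(1)] w_coord_darboux[OF p(2)])
qed

lemma open_chart_overlap: "open (chart_overlap \<sigma> \<tau>)"
proof -
  have "chart_overlap \<sigma> \<tau> = chart_range \<sigma> \<inter> {u. \<forall>r\<in>- range \<tau>. 0 < L r (base_point \<sigma> u)}"
    by (auto simp: chart_overlap_def)
  then show ?thesis by (simp only:) (intro open_Int open_chart_range open_base_point_positive)
qed

lemma mem_chart_overlap_iff:
  assumes \<sigma>: "vertex_ordering \<sigma>" and \<tau>: "vertex_ordering \<tau>"
  shows "u \<in> chart_overlap \<sigma> \<tau> \<longleftrightarrow> u \<in> chart_range \<sigma> \<and> darboux_inv \<sigma> u \<in> chart_dom \<tau>"
proof (cases "u \<in> chart_range \<sigma>")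
  case True
  have x: "base_point \<sigma> u \<in> P" by (rule base_point_mem_polytope(1)[OF \<sigma> True])
  have "darboux_inv \<sigma> u \<in> manifold"
    using chart_inverse_mem[OF \<sigma> True] mem_chart_domain_iff[OF \<sigma>] by blast
  then have "darboux_inv \<sigma> u \<in> chart_dom \<tau> \<longleftrightarrow> tight_at (base_point \<sigma> u) \<subseteq> range \<tau>"
    by (simp add: mem_chart_domain_iff[OF \<tau>] moment_chart_inverse[OF \<sigma> True])
  also have "\<dots> \<longleftrightarrow> (\<forall>r\<in>- range \<tau>. 0 < L r (base_point \<sigma> u))"
    using ell_nonneg[OF x] unfolding tight_def less_le by (auto 0 3)
  finally show ?thesis using True by (simp add: chart_overlap_def)
qed (simp add: chart_overlap_def)

lemma darboux_mem_chart_overlap: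
  assumes "p \<in> chart_dom \<sigma>" "p \<in> chart_dom \<tau>"
  shows "darboux \<sigma> p \<in> chart_overlap \<sigma> \<tau>"
  using assms chart_domain_vertex
  by (simp add: mem_chart_overlap_iff darboux_chart_mem_chart_range)

lemma transition_darboux [simp]:
  "p \<in> chart_dom \<sigma> \<Longrightarrow> transition \<sigma> \<tau> (darboux \<sigma> p) = darboux \<tau> p"
  by (simp add: transition_def)

lemma w_coord_of_transition:
  assumes F: "potential_part F" and \<sigma>: "vertex_ordering \<sigma>" and \<tau>: "vertex_ordering \<tau>" and u: "u \<in> chart_overlap \<sigma> \<tau>"
  shows "w_coord F \<tau> (transition \<sigma> \<tau> u) = monomial_map \<sigma> \<tau> (w_coord F \<sigma> u)"
proof -
  have u': "u \<in> chart_range \<sigma>" "darboux_inv \<sigma> u \<in> chart_dom \<tau>"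
    using u mem_chart_overlap_iff[OF \<sigma> \<tau>] by auto
  show ?thesis
    using w_coord_transition[OF F chart_inverse_mem[OF \<sigma> u'(1)] u'(2)]
    by (simp add: transition_def darboux_chart_inverse[OF \<sigma> u'(1)])
qed

lemma monomial_map_has_complex_derivative:
  assumes \<sigma>: "vertex_ordering \<sigma>" and \<tau>: "vertex_ordering \<tau>" and u: "u \<in> chart_overlap \<sigma> \<tau>"
  obtains E' where "(monomial_map \<sigma> \<tau> has_derivative E') (at (w_coord F \<sigma> u))"
    and "\<And>y. E' (\<i> *s y) = \<i> *s E' y"
proof -
  have u': "u \<in> chart_range \<sigma>" "darboux_inv \<sigma> u \<in> chart_dom \<tau>"
    using u mem_chart_overlap_iff[OF \<sigma> \<tau>] by auto
  have t: "tight_at (base_point \<sigma> u) \<subseteq> range \<tau>"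
    using u'(2) mem_chart_domain_iff[OF \<tau>] moment_chart_inverse[OF \<sigma> u'(1)] by simp
  have "w_coord F \<sigma> u $ m \<noteq> 0 \<or> exponent \<sigma> \<tau> k m = 0 \<or> exponent \<sigma> \<tau> k m = 1" for k m
  proof (cases "w_coord F \<sigma> u $ m = 0")
    case True
    then have "complex_coords u $ m = 0" by (simp add: w_coord_def)
    then have "\<sigma> m \<in> range \<tau>" using t by (auto simp: complex_coords_zero_iff[OF \<sigma>])
    then obtain k' where "\<sigma> m = \<tau> k'" by blast
    then show ?thesis using exponent_common_facet[OF \<tau>] by simp
  qed simp
  then show ?thesis
    using that unfolding monomial_map_def[abs_def] by (rule monomial_map_complex_differentiable)
qed

text \<open>The relation \<open>w' = monomial_map w\<close> is solved for the Darboux coordinates in \<open>w'\<close>. The factor between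
  \<open>z'\<close> and \<open>w'\<close> depends only on the base point, which is known in both charts. The choice
  \<open>F = 0\<close>, which stands for Guillemin's potential, makes the formula independent of \<open>\<phi>\<close> and \<open>\<psi>\<close>.\<close>
lemma transition_eq:
  assumes \<sigma>: "vertex_ordering \<sigma>" and \<tau>: "vertex_ordering \<tau>" and u: "u \<in> chart_overlap \<sigma> \<tau>"
  shows "transition \<sigma> \<tau> u = realify (\<chi> k. complex_of_real (sqrt 2 * exp (- log_coord (\<lambda>_. 0) \<tau> k (base_point \<sigma> u)))
     * monomial_map \<sigma> \<tau> (w_coord (\<lambda>_. 0) \<sigma> u) $ k)"
proof -
  have u': "u \<in> chart_range \<sigma>" "darboux_inv \<sigma> u \<in> chart_dom \<tau>"
    using u mem_chart_overlap_iff[OF \<sigma> \<tau>] by auto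
  have b: "base_point \<tau> (transition \<sigma> \<tau> u) = base_point \<sigma> u"
    by (simp add: transition_def base_point_darboux[OF u'(2)] moment_chart_inverse[OF \<sigma> u'(1)])
  have "complex_of_real (sqrt 2 * exp (- log_coord (\<lambda>_. 0) \<tau> k (base_point \<sigma> u))) * w_coord (\<lambda>_. 0) \<tau> (transition \<sigma> \<tau> u) $ k
      = complex_coords (transition \<sigma> \<tau> u) $ k" for k
    by (simp add: w_coord_def b exp_minus field_simps)
  then have "(\<chi> k. complex_of_real (sqrt 2 * exp (- log_coord (\<lambda>_. 0) \<tau> k (base_point \<sigma> u)))
     * monomial_map \<sigma> \<tau> (w_coord (\<lambda>_. 0) \<sigma> u) $ k) = complex_coords (transition \<sigma> \<tau> u)"
    by (simp only: vec_eq_iff vec_lambda_beta w_coord_of_transition[OF potential_part_zero \<sigma> \<tau> u, symmetric]) simp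
  then show ?thesis by simp
qed

lemma transition_differentiable:
  assumes \<sigma>: "vertex_ordering \<sigma>" and \<tau>: "vertex_ordering \<tau>" and u: "u \<in> chart_overlap \<sigma> \<tau>"
  shows "transition \<sigma> \<tau> differentiable (at u)"
proof -
  let ?h = "\<lambda>k u. log_coord (\<lambda>_. 0) \<tau> k (base_point \<sigma> u)"
  have u': "u \<in> chart_range \<sigma>" and pos: "\<And>r. r \<notin> range \<tau> \<Longrightarrow> 0 < L r (base_point \<sigma> u)"
    using u by (auto simp: chart_overlap_def)
  note x = base_point_mem_polytope(1)[OF \<sigma> u']
  obtain E' where E': "(monomial_map \<sigma> \<tau> has_derivative E') (at (w_coord (\<lambda>_. 0) \<sigma> u))"
    using monomial_map_has_complex_derivative[OF \<sigma> \<tau> u] by metis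
  have m: "((\<lambda>u. monomial_map \<sigma> \<tau> (w_coord (\<lambda>_. 0) \<sigma> u)) has_derivative (\<lambda>v. E' (w_coord_deriv (\<lambda>_. 0) \<sigma> u v))) (at u)"
    by (rule has_derivative_compose[OF has_derivative_w_coord[OF potential_part_zero \<sigma> u'] E'])
  then have m: "((\<lambda>u. monomial_map \<sigma> \<tau> (w_coord (\<lambda>_. 0) \<sigma> u) $ k) has_derivative (\<lambda>v. E' (w_coord_deriv (\<lambda>_. 0) \<sigma> u v) $ k)) (at u)" for k
    unfolding has_derivative_vec_iff[of "\<lambda>u. monomial_map \<sigma> \<tau> (w_coord (\<lambda>_. 0) \<sigma> u)"] by blast
  define h' where "h' k v = log_coord_deriv (\<lambda>_. 0) \<tau> k (base_point \<sigma> u)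
      (\<Sum>j\<in>UNIV. (u $ Inl j * v $ Inl j + u $ Inr j * v $ Inr j) *\<^sub>R dual \<sigma> j)" for k v
  have "(?h k has_derivative h' k) (at u)" for k
    unfolding h'_def
    by (rule has_derivative_compose[OF has_derivative_base_point has_derivative_log_coord[OF potential_part_zero x pos]])
  then have c: "((\<lambda>u. complex_of_real (sqrt 2 * exp (- ?h k u))) has_derivative
      (\<lambda>v. complex_of_real (sqrt 2 * (exp (- ?h k u) * - h' k v)))) (at u)" for k
    by (intro has_derivative_of_real has_derivative_mult_right) (auto intro!: derivative_eq_intros)
  have "((\<lambda>u. \<chi> k. complex_of_real (sqrt 2 * exp (- ?h k u)) * monomial_map \<sigma> \<tau> (w_coord (\<lambda>_. 0) \<sigma> u) $ k)
      has_derivative (\<lambda>v. \<chi> k.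
        complex_of_real (sqrt 2 * exp (- ?h k u)) * E' (w_coord_deriv (\<lambda>_. 0) \<sigma> u v) $ k
        + complex_of_real (sqrt 2 * (exp (- ?h k u) * - h' k v)) * monomial_map \<sigma> \<tau> (w_coord (\<lambda>_. 0) \<sigma> u) $ k)) (at u)"
    unfolding has_derivative_vec_iff vec_lambda_beta by (intro allI has_derivative_mult c m)
  note bounded_linear.has_derivative[OF bounded_linear_realify this]
  show ?thesis
    by (rule differentiableI, rule has_derivative_transform_within_open[OF _ open_chart_overlap u])
       (fact, simp add: transition_eq[OF \<sigma> \<tau>])
qed

section \<open>Tangent vectors\<close>

lemma has_derivative_transition:
  assumes "p \<in> chart_dom \<sigma>" "p \<in> chart_dom \<tau>"
  shows "(transition \<sigma> \<tau> has_derivative D (transition \<sigma> \<tau>) (darboux \<sigma> p)) (at (darboux \<sigma> p))"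
  using assms chart_domain_vertex
  by (intro has_derivative_D transition_differentiable darboux_mem_chart_overlap) auto

lemma differential_darboux:
  "differential nu lam \<sigma> (darboux \<tau>) p \<xi>
     = complex_jacobian (transition \<sigma> \<tau>) (darboux \<sigma> p) *v component \<sigma> \<xi>"
  by (simp add: differential_def transition_def[abs_def])

lemma jacobian_change_of_chart:
  assumes p: "p \<in> chart_dom \<sigma>" "p \<in> chart_dom \<tau>"
    and G: "((\<lambda>u. F (darboux_inv \<tau> u)) has_derivative G') (at (darboux \<tau> p))"
  shows "complex_jacobian (\<lambda>u. F (darboux_inv \<sigma> u)) (darboux \<sigma> p) *v V
    = complex_jacobian (\<lambda>u. F (darboux_inv \<tau> u)) (darboux \<tau> p)
        *v (complex_jacobian (transition \<sigma> \<tau>) (darboux \<sigma> p) *v V)"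
proof -
  have \<sigma>: "vertex_ordering \<sigma>" and \<tau>: "vertex_ordering \<tau>"
    using p chart_domain_vertex by auto
  let ?u = "darboux \<sigma> p"
  have "complex_jacobian (\<lambda>u. F (darboux_inv \<sigma> u)) ?u
      = complex_jacobian (\<lambda>u. F (darboux_inv \<tau> (transition \<sigma> \<tau> u))) ?u"
  proof (rule complex_jacobian_cong_open[OF open_chart_overlap darboux_mem_chart_overlap[OF p]])
    fix u assume "u \<in> chart_overlap \<sigma> \<tau>"
    then show "F (darboux_inv \<sigma> u) = F (darboux_inv \<tau> (transition \<sigma> \<tau> u))"
      using mem_chart_overlap_iff[OF \<sigma> \<tau>] by (simp add: transition_def)
  qed
  then show ?thesis
    using complex_jacobian_compose[OF has_derivative_transition[OF p], of "\<lambda>u. F (darboux_inv \<tau> u)" G' V] G p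
    by simp
qed

lemma tangent_spaceD:
  assumes "\<xi> \<in> tangent p" "p \<in> chart_dom \<sigma>" "p \<in> chart_dom \<tau>"
  shows "component \<tau> \<xi> = complex_jacobian (transition \<sigma> \<tau>) (darboux \<sigma> p) *v component \<sigma> \<xi>"
  using assms unfolding tangent_space_def mem_Collect_eq differential_darboux by blast

lemma tangent_space_outside_chart:
  "\<xi> \<in> tangent p \<Longrightarrow> p \<notin> chart_dom \<sigma> \<Longrightarrow> component \<sigma> \<xi> = 0"
  unfolding tangent_space_def by blast

lemma tangent_spaceI:
  assumes "\<And>\<sigma>. p \<notin> chart_dom \<sigma> \<Longrightarrow> component \<sigma> \<xi> = 0"
    and "\<And>\<sigma> \<tau>. p \<in> chart_dom \<sigma> \<Longrightarrow> p \<in> chart_dom \<tau> \<Longrightarrow>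
      component \<tau> \<xi> = complex_jacobian (transition \<sigma> \<tau>) (darboux \<sigma> p) *v component \<sigma> \<xi>"
  shows "\<xi> \<in> tangent p"
  using assms unfolding tangent_space_def mem_Collect_eq differential_darboux by blast

lemma component_add: "component \<sigma> (\<xi> + \<eta>) = component \<sigma> \<xi> + component \<sigma> \<eta>"
  by (simp add: component_def vec_eq_iff)

lemma component_scale: "component \<sigma> (c *s \<xi>) = c *s component \<sigma> \<xi>"
  by (simp add: component_def vec_eq_iff)

lemma component_zero [simp]: "component \<sigma> 0 = 0"
  by (simp add: component_def vec_eq_iff)

lemma tangent_eqI:
  assumes "\<And>\<sigma>. component \<sigma> \<xi> = component \<sigma> \<eta>" shows "\<xi> = \<eta>"
proof -
  have "\<xi> $ (k, \<sigma>) = \<eta> $ (k, \<sigma>)" for k \<sigma>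
    using arg_cong[OF assms[of \<sigma>], of "\<lambda>v. v $ k"] by (simp add: component_def)
  then show ?thesis by (simp add: vec_eq_iff)
qed

lemma subspace_tangent_space: "vec.subspace (tangent p)"
proof (rule vec.subspaceI)
  show "0 \<in> tangent p"
    by (rule tangent_spaceI) simp_all
  show "\<xi> + \<eta> \<in> tangent p" if "\<xi> \<in> tangent p" "\<eta> \<in> tangent p" for \<xi> \<eta>
  proof (rule tangent_spaceI)
    fix \<sigma> \<tau> assume "p \<in> chart_dom \<sigma>" "p \<in> chart_dom \<tau>"
    then show "component \<tau> (\<xi> + \<eta>)
        = complex_jacobian (transition \<sigma> \<tau>) (darboux \<sigma> p) *v component \<sigma> (\<xi> + \<eta>)"
      using tangent_spaceD[OF that(1)] tangent_spaceD[OF that(2)]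
      unfolding component_add matrix_vector_right_distrib by metis
  qed (use that in \<open>simp add: component_add tangent_space_outside_chart\<close>)
  show "c *s \<xi> \<in> tangent p" if "\<xi> \<in> tangent p" for c \<xi>
  proof (rule tangent_spaceI)
    fix \<sigma> \<tau> assume "p \<in> chart_dom \<sigma>" "p \<in> chart_dom \<tau>"
    then show "component \<tau> (c *s \<xi>)
        = complex_jacobian (transition \<sigma> \<tau>) (darboux \<sigma> p) *v component \<sigma> (c *s \<xi>)"
      using tangent_spaceD[OF that] unfolding component_scale vector_scalar_commute by metis
  qed (use that in \<open>simp add: component_scale tangent_space_outside_chart\<close>)
qed

lemma component_determines_tangent:
  assumes p: "p \<in> chart_dom \<sigma>" and "\<xi> \<in> tangent p" "\<eta> \<in> tangent p"
    and "component \<sigma> \<xi> = component \<sigma> \<eta>"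
  shows "\<xi> = \<eta>"
proof (rule tangent_eqI)
  fix \<tau>
  show "component \<tau> \<xi> = component \<tau> \<eta>"
  proof (cases "p \<in> chart_dom \<tau>")
    case True
    show ?thesis
      unfolding tangent_spaceD[OF assms(2) p True] tangent_spaceD[OF assms(3) p True] assms(4) ..
  next
    case False
    then show ?thesis using assms tangent_space_outside_chart by metis
  qed
qed

text \<open>The tangent vector with given component in the chart \<open>\<sigma>\<close>.\<close>
definition tangent_lift :: "('n \<Rightarrow> 'd) \<Rightarrow> 'n toric_point \<Rightarrow> complex^('n + 'n) \<Rightarrow> ('n, 'd) tangent_vector" where
  "tangent_lift \<sigma> p V = (\<chi> i. case i of (k, \<tau>) \<Rightarrow>
     if p \<in> chart_dom \<tau>
     then (complex_jacobian (transition \<sigma> \<tau>) (darboux \<sigma> p) *v V) $ k else 0)"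

lemma component_tangent_lift_general:
  "component \<tau> (tangent_lift \<sigma> p V) = (if p \<in> chart_dom \<tau>
     then complex_jacobian (transition \<sigma> \<tau>) (darboux \<sigma> p) *v V else 0)"
  by (simp add: component_def tangent_lift_def vec_eq_iff)

lemma transition_self:
  assumes p: "p \<in> chart_dom \<sigma>"
  shows "complex_jacobian (transition \<sigma> \<sigma>) (darboux \<sigma> p) *v V = V"
proof -
  have \<sigma>: "vertex_ordering \<sigma>" using p by (rule chart_domain_vertex)
  have "complex_jacobian (transition \<sigma> \<sigma>) (darboux \<sigma> p) = complex_jacobian (\<lambda>u. u) (darboux \<sigma> p)"
    by (rule complex_jacobian_cong_open[OF open_chart_range[of \<sigma>] darboux_chart_mem_chart_range[OF p]])
       (simp add: transition_def darboux_chart_inverse[OF \<sigma>])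
  then show ?thesis by (simp add: complex_jacobian_id)
qed

lemma component_tangent_lift:
  "p \<in> chart_dom \<sigma> \<Longrightarrow> component \<sigma> (tangent_lift \<sigma> p V) = V"
  by (simp add: component_tangent_lift_general transition_self)

text \<open>The compatibility of the components is the cocycle property of the transition maps.\<close>
lemma tangent_lift_mem:
  assumes p: "p \<in> chart_dom \<sigma>"
  shows "tangent_lift \<sigma> p V \<in> tangent p"
proof (rule tangent_spaceI)
  show "component \<tau> (tangent_lift \<sigma> p V) = 0" if "p \<notin> chart_dom \<tau>" for \<tau>
    using that by (simp add: component_tangent_lift_general)
  fix \<tau> \<rho> assume \<tau>: "p \<in> chart_dom \<tau>" and \<rho>: "p \<in> chart_dom \<rho>"
  have "((\<lambda>u. darboux \<rho> (darboux_inv \<tau> u)) has_derivative D (transition \<tau> \<rho>) (darboux \<tau> p))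
      (at (darboux \<tau> p))"
    using has_derivative_transition[OF \<tau> \<rho>] by (simp only: transition_def[abs_def])
  from jacobian_change_of_chart[OF p \<tau> this, of V]
  have "complex_jacobian (transition \<sigma> \<rho>) (darboux \<sigma> p) *v V
    = complex_jacobian (transition \<tau> \<rho>) (darboux \<tau> p)
        *v (complex_jacobian (transition \<sigma> \<tau>) (darboux \<sigma> p) *v V)"
    by (simp only: transition_def[abs_def])
  then show "component \<rho> (tangent_lift \<sigma> p V)
      = complex_jacobian (transition \<tau> \<rho>) (darboux \<tau> p) *v component \<tau> (tangent_lift \<sigma> p V)"
    by (simp only: component_tangent_lift_general \<tau> \<rho> if_True)
qed

lemma tangent_lift_component:
  assumes "p \<in> chart_dom \<sigma>" "\<xi> \<in> tangent p"
  shows "tangent_lift \<sigma> p (component \<sigma> \<xi>) = \<xi>"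
  using component_determines_tangent[OF assms(1) tangent_lift_mem assms(2)] component_tangent_lift assms by simp

lemma tendsto_tangent_lift:
  assumes "(V \<longlongrightarrow> V0) G"
  shows "((\<lambda>s. tangent_lift \<sigma> p (V s)) \<longlongrightarrow> tangent_lift \<sigma> p V0) G"
proof (rule vec_tendstoI)
  fix i :: "('n + 'n) \<times> ('n \<Rightarrow> 'd)"
  show "((\<lambda>s. tangent_lift \<sigma> p (V s) $ i) \<longlongrightarrow> tangent_lift \<sigma> p V0 $ i) G"
    by (cases i) (auto simp: tangent_lift_def matrix_vector_mult_def intro!: tendsto_intros assms)
qed

section \<open>The holomorphic polarizations in the Darboux charts\<close>

text \<open>The candidate for the holomorphic polarization, described in one chart.\<close>
definition hol_set :: "(real^'n \<Rightarrow> real) \<Rightarrow> ('n \<Rightarrow> 'd) \<Rightarrow> 'n toric_point \<Rightarrow> ('n, 'd) tangent_vector set" where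
  "hol_set F \<sigma> p = {\<xi> \<in> tangent p.
     component \<sigma> \<xi> \<in> holomorphic_space (z_coord \<sigma> p) (coord_hessian F \<sigma> (moment p))}"

abbreviation w_jac :: "(real^'n \<Rightarrow> real) \<Rightarrow> ('n \<Rightarrow> 'd) \<Rightarrow> 'n toric_point \<Rightarrow> complex^('n + 'n)^('n + 'n)" where
  "w_jac F \<sigma> p \<equiv> complex_jacobian (\<lambda>u. realify (w_coord F \<sigma> u)) (darboux \<sigma> p)"

lemma hol_set_iff:
  assumes F: "potential_part F" and p: "p \<in> chart_dom \<sigma>"
  shows "\<xi> \<in> hol_set F \<sigma> p \<longleftrightarrow> \<xi> \<in> tangent p \<and> dzbar (w_jac F \<sigma> p *v component \<sigma> \<xi>) = 0"
proof -
  have \<sigma>: "vertex_ordering \<sigma>" using p by (rule chart_domain_vertex)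
  note J = w_jacobian(2)[OF F \<sigma> darboux_chart_mem_chart_range[OF p], unfolded base_point_darboux[OF p]]
  show ?thesis
    by (simp add: hol_set_def holomorphic_space_def vec_eq_iff J)
qed

text \<open>The derivative of the monomial map is complex linear, so it preserves the type of the image of
  a tangent vector under the differential of \<open>w\<close>.\<close>
lemma hol_set_chart_independent_subset:
  assumes F: "potential_part F" and p: "p \<in> chart_dom \<sigma>" "p \<in> chart_dom \<tau>"
  shows "hol_set F \<sigma> p \<subseteq> hol_set F \<tau> p"
proof
  fix \<xi> assume \<xi>: "\<xi> \<in> hol_set F \<sigma> p"
  have \<sigma>: "vertex_ordering \<sigma>" and \<tau>: "vertex_ordering \<tau>"
    using p chart_domain_vertex by auto
  let ?u = "darboux \<sigma> p"
  note u = darboux_mem_chart_overlap[OF p]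
  have t: "\<xi> \<in> tangent p" and bar: "dzbar (w_jac F \<sigma> p *v component \<sigma> \<xi>) = 0"
    using \<xi> hol_set_iff[OF F p(1)] by auto
  obtain E' where E': "(monomial_map \<sigma> \<tau> has_derivative E') (at (w_coord F \<sigma> ?u))"
    "\<And>y. E' (\<i> *s y) = \<i> *s E' y"
    using monomial_map_has_complex_derivative[OF \<sigma> \<tau> u] by metis
  have wd: "((\<lambda>u. realify (w_coord F \<rho> u)) has_derivative (\<lambda>v. realify (w_coord_deriv F \<rho> (darboux \<rho> p) v)))
      (at (darboux \<rho> p))" if "p \<in> chart_dom \<rho>" for \<rho>
    by (intro bounded_linear.has_derivative[OF bounded_linear_realify] has_derivative_w_coord F
        chart_domain_vertex[OF that] darboux_chart_mem_chart_range that)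
  have E: "((\<lambda>v. realify (monomial_map \<sigma> \<tau> (complex_coords v))) has_derivative (\<lambda>v. realify (E' (complex_coords v))))
      (at (realify (w_coord F \<sigma> ?u)))"
    by (intro bounded_linear.has_derivative[OF bounded_linear_realify]
        has_derivative_compose[OF bounded_linear.has_derivative[OF bounded_linear_complex_coords has_derivative_ident]])
       (use E'(1) in simp)
  have "w_jac F \<tau> p *v component \<tau> \<xi>
      = complex_jacobian (\<lambda>u. realify (w_coord F \<tau> (transition \<sigma> \<tau> u))) ?u *v component \<sigma> \<xi>"
    using complex_jacobian_compose[OF has_derivative_transition[OF p], of "\<lambda>u. realify (w_coord F \<tau> u)" _ "component \<sigma> \<xi>"]
      wd[OF p(2)] p by (simp add: tangent_spaceD[OF t p])
  also have "complex_jacobian (\<lambda>u. realify (w_coord F \<tau> (transition \<sigma> \<tau> u))) ?u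
      = complex_jacobian (\<lambda>u. realify (monomial_map \<sigma> \<tau> (complex_coords (realify (w_coord F \<sigma> u))))) ?u"
    by (rule complex_jacobian_cong_open[OF open_chart_overlap u]) (simp add: w_coord_of_transition[OF F \<sigma> \<tau>])
  also have "\<dots> *v component \<sigma> \<xi>
      = complex_jacobian (\<lambda>v. realify (monomial_map \<sigma> \<tau> (complex_coords v))) (realify (w_coord F \<sigma> ?u)) *v (w_jac F \<sigma> p *v component \<sigma> \<xi>)"
    by (rule complex_jacobian_compose[OF wd[OF p(1)] E])
  also have "dzbar \<dots> = 0"
    by (rule dzbar_jacobian_complex_linear[where E = "monomial_map \<sigma> \<tau>" and E' = E'])
       (use E' bar in auto)
  finally show "\<xi> \<in> hol_set F \<tau> p"
    using t by (simp add: hol_set_iff[OF F p(2)])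
qed

lemma hol_set_chart_independent:
  assumes "potential_part F" "p \<in> chart_dom \<sigma>" "p \<in> chart_dom \<tau>"
  shows "hol_set F \<sigma> p = hol_set F \<tau> p"
  using hol_set_chart_independent_subset assms by blast

lemma subspace_component_preimage:
  assumes "vec.subspace S"
  shows "vec.subspace {\<xi> \<in> tangent p. component \<sigma> \<xi> \<in> S}"
  using assms subspace_tangent_space[of p]
  by (auto simp: vec.subspace_def component_add component_scale)

lemma differential_holomorphic_coords:
  assumes F: "potential_part F" and p: "p \<in> chart_dom \<sigma>"
    and g: "\<And>y. y \<in> interior P \<Longrightarrow> g y = guillemin_potential nu lam y + F y"
  shows "differential nu lam \<sigma> (\<lambda>q. realify (holomorphic_coords nu lam g \<sigma> q)) p \<xi> = w_jac F \<sigma> p *v component \<sigma> \<xi>"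
proof -
  have \<sigma>: "vertex_ordering \<sigma>" using p by (rule chart_domain_vertex)
  have "complex_jacobian (\<lambda>u. realify (holomorphic_coords nu lam g \<sigma> (darboux_inv \<sigma> u))) (darboux \<sigma> p) = w_jac F \<sigma> p"
    by (rule complex_jacobian_cong_open[OF open_chart_range darboux_chart_mem_chart_range[OF p]])
       (simp add: holomorphic_coords_eq[OF F chart_inverse_mem[OF \<sigma>] g] darboux_chart_inverse[OF \<sigma>])
  then show ?thesis by (simp add: differential_def)
qed

lemma half_axis_eq: "(1/2) *s (axis (Inl j) 1 - \<i> *s axis (Inr j) 1) = from_dz (axis j 1) 0"
proof (rule vec_eqI_dz)
  show "dz ((1/2) *s (axis (Inl j) 1 - \<i> *s axis (Inr j) 1)) = dz (from_dz (axis j 1) 0)"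
    unfolding dz_from_dz by (simp add: dz_def vec_eq_iff axis_def)
  show "dzbar ((1/2) *s (axis (Inl j) 1 - \<i> *s axis (Inr j) 1)) = dzbar (from_dz (axis j 1) 0)"
    unfolding dzbar_from_dz by (simp add: dzbar_def vec_eq_iff axis_def)
qed

definition positive_energy :: "(real^'n \<Rightarrow> real) \<Rightarrow> 'n toric_point \<Rightarrow> bool" where
  "positive_energy F p \<longleftrightarrow> (\<forall>\<sigma> k. p \<in> chart_dom \<sigma> \<longrightarrow> k \<noteq> 0 \<longrightarrow>
     0 < energy (z_coord \<sigma> p) (coord_hessian F \<sigma> (moment p)) k)"

text \<open>With positive energy, \<open>w\<close> is a local chart of the real manifold, also over the boundary.\<close>
lemma w_jac_injective:
  assumes F: "potential_part F" and p: "p \<in> chart_dom \<sigma>" and pos: "positive_energy F p"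
    and 0: "w_jac F \<sigma> p *v V = 0"
  shows "V = 0"
proof -
  have \<sigma>: "vertex_ordering \<sigma>" using p by (rule chart_domain_vertex)
  note J = w_jacobian[OF F \<sigma> darboux_chart_mem_chart_range[OF p], unfolded base_point_darboux[OF p], of V]
  show ?thesis
  proof (rule complementary_to_conjugate)
    show "0 < energy (z_coord \<sigma> p) (coord_hessian F \<sigma> (moment p)) k" if "k \<noteq> 0" for k
      using pos p that by (simp add: positive_energy_def)
    show "V \<in> holomorphic_space (z_coord \<sigma> p) (coord_hessian F \<sigma> (moment p))"
      using J(2) by (simp add: holomorphic_space_def 0)
    show "dz V $ j + z_coord \<sigma> p $ j *
         of_real_mult (coord_hessian F \<sigma> (moment p)) (dl (z_coord \<sigma> p) V) $ j = 0" for j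
      using J(1)[of j] by (simp add: 0)
  qed
qed

lemma holomorphic_coord_vector_properties:
  assumes F: "potential_part F" and p: "p \<in> chart_dom \<sigma>" and pos: "positive_energy F p"
    and g: "\<And>y. y \<in> interior P \<Longrightarrow> g y = guillemin_potential nu lam y + F y"
  shows "holomorphic_coord_vector nu lam g \<sigma> j p \<in> tangent p"
    and "w_jac F \<sigma> p *v component \<sigma> (holomorphic_coord_vector nu lam g \<sigma> j p) = from_dz (axis j 1) 0"
proof -
  have inj: "V = W" if "w_jac F \<sigma> p *v V = w_jac F \<sigma> p *v W" for V W
    using w_jac_injective[OF F p pos, of "V - W"] that by (simp add: matrix_vector_mult_diff_distrib)
  then have "inj ((*v) (w_jac F \<sigma> p))" by (auto intro: injI)
  then have "surj ((*v) (w_jac F \<sigma> p))"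
    by (intro vec.linear_injective_imp_surjective[OF matrix_vector_mul_linear_gen]) simp_all
  then obtain V where V: "w_jac F \<sigma> p *v V = from_dz (axis j 1) 0" by (metis surjD)
  have "\<exists>!\<xi>. \<xi> \<in> tangent p \<and> w_jac F \<sigma> p *v component \<sigma> \<xi> = from_dz (axis j 1) 0"
  proof (intro ex1I conjI)
    show "tangent_lift \<sigma> p V \<in> tangent p" by (rule tangent_lift_mem[OF p])
    show "w_jac F \<sigma> p *v component \<sigma> (tangent_lift \<sigma> p V) = from_dz (axis j 1) 0"
      by (simp add: component_tangent_lift[OF p] V)
    show "\<xi> = tangent_lift \<sigma> p V"
      if "\<xi> \<in> tangent p \<and> w_jac F \<sigma> p *v component \<sigma> \<xi> = from_dz (axis j 1) 0" for \<xi>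
    proof -
      have "component \<sigma> \<xi> = V" by (rule inj) (simp add: that V)
      then show ?thesis using tangent_lift_component[OF p, of \<xi>] that by simp
    qed
  qed
  note ex = this
  have d: "differential nu lam \<sigma> (\<lambda>q. realify (holomorphic_coords nu lam g \<sigma> q)) p \<xi> = w_jac F \<sigma> p *v component \<sigma> \<xi>" for \<xi>
    by (rule differential_holomorphic_coords[OF F p g])
  from theI'[OF ex]
  show "holomorphic_coord_vector nu lam g \<sigma> j p \<in> tangent p"
    "w_jac F \<sigma> p *v component \<sigma> (holomorphic_coord_vector nu lam g \<sigma> j p) = from_dz (axis j 1) 0"
    unfolding holomorphic_coord_vector_def d half_axis_eq by auto
qed

lemma component_sum: "component \<sigma> (\<Sum>i\<in>A. f i) = (\<Sum>i\<in>A. component \<sigma> (f i))"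
  by (induction A rule: infinite_finite_induct) (simp_all add: component_add)

lemma matrix_vector_mult_sum: "M *v (\<Sum>i\<in>A. f i) = (\<Sum>i\<in>A. M *v (f i :: complex^'k))"
  by (induction A rule: infinite_finite_induct) (simp_all add: matrix_vector_right_distrib)

lemma holomorphic_polarization_eq:
  assumes F: "potential_part F" and p: "p \<in> chart_dom \<sigma>" and pos: "positive_energy F p"
    and g: "\<And>y. y \<in> interior P \<Longrightarrow> g y = guillemin_potential nu lam y + F y"
  shows "holomorphic_polarization nu lam g p = hol_set F \<sigma> p"
proof
  note hcv = holomorphic_coord_vector_properties[OF F _ pos g]
  have "{holomorphic_coord_vector nu lam g \<tau> j p | \<tau> j. p \<in> chart_dom \<tau>} \<subseteq> hol_set F \<sigma> p"
  proof clarify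
    fix \<tau> j assume \<tau>: "p \<in> chart_dom \<tau>"
    have "holomorphic_coord_vector nu lam g \<tau> j p \<in> hol_set F \<tau> p"
      by (simp add: hol_set_iff[OF F \<tau>] hcv[OF \<tau>])
    then show "holomorphic_coord_vector nu lam g \<tau> j p \<in> hol_set F \<sigma> p"
      using hol_set_chart_independent[OF F p \<tau>] by simp
  qed
  moreover have "vec.subspace (hol_set F \<sigma> p)"
    unfolding hol_set_def by (rule subspace_component_preimage[OF subspace_holomorphic_space])
  ultimately show "holomorphic_polarization nu lam g p \<subseteq> hol_set F \<sigma> p"
    unfolding holomorphic_polarization_def by (rule vec.span_minimal)
  show "hol_set F \<sigma> p \<subseteq> holomorphic_polarization nu lam g p"
  proof
    fix \<xi> assume "\<xi> \<in> hol_set F \<sigma> p"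
    then have t: "\<xi> \<in> tangent p" and bar: "dzbar (w_jac F \<sigma> p *v component \<sigma> \<xi>) = 0"
      using hol_set_iff[OF F p] by auto
    define a where "a = dz (w_jac F \<sigma> p *v component \<sigma> \<xi>)"
    define \<eta> where "\<eta> = (\<Sum>j\<in>UNIV. a $ j *s holomorphic_coord_vector nu lam g \<sigma> j p)"
    have \<eta>t: "\<eta> \<in> tangent p"
      unfolding \<eta>_def using subspace_tangent_space hcv(1)[OF p]
      by (intro vec.subspace_sum vec.subspace_scale) auto
    have "w_jac F \<sigma> p *v component \<sigma> \<eta> = (\<Sum>j\<in>UNIV. a $ j *s from_dz (axis j 1) 0)"
      by (simp add: \<eta>_def component_sum component_scale matrix_vector_mult_sum vector_scalar_commute hcv(2)[OF p])
    moreover have "(\<Sum>j\<in>UNIV. a $ j *s from_dz (axis j 1) 0) = w_jac F \<sigma> p *v component \<sigma> \<xi>"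
    proof (rule vec_eqI_dz)
      show "dz (\<Sum>j\<in>UNIV. a $ j *s from_dz (axis j 1) 0) = dz (w_jac F \<sigma> p *v component \<sigma> \<xi>)"
        by (simp add: dz_sum dz_scale a_def[symmetric] basis_expansion)
    qed (simp add: dz_sum dz_scale bar)
    ultimately have "w_jac F \<sigma> p *v (component \<sigma> \<eta> - component \<sigma> \<xi>) = 0"
      by (simp add: matrix_vector_mult_diff_distrib)
    then have "component \<sigma> \<eta> - component \<sigma> \<xi> = 0" by (rule w_jac_injective[OF F p pos])
    then have "\<xi> = \<eta>" using component_determines_tangent[OF p t \<eta>t] by simp
    also have "\<eta> \<in> holomorphic_polarization nu lam g p"
      unfolding \<eta>_def holomorphic_polarization_def using p
      by (intro vec.span_sum vec.span_scale vec.span_base) blast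
    finally show "\<xi> \<in> holomorphic_polarization nu lam g p" .
  qed
qed

section \<open>Positivity of the Hessians up to the boundary\<close>

text \<open>The Hessian form of \<open>g\<^sub>P + F\<close>. On the boundary, division by zero drops the terms of the facets
  through \<open>x\<close>.\<close>
definition hessian_form :: "(real^'n \<Rightarrow> real) \<Rightarrow> real^'n \<Rightarrow> real^'n \<Rightarrow> real" where
  "hessian_form F x v = 1/2 * (\<Sum>r\<in>UNIV. (normal r \<bullet> v)\<^sup>2 / L r x) + D2 F x v v"

lemma hessian_form_pos:
  assumes F: "potential_part F" and x: "x \<in> interior P" and v: "v \<noteq> 0"
    and g: "\<And>y. y \<in> interior P \<Longrightarrow> g y = guillemin_potential nu lam y + F y"
    and pos: "positive_definite (Hess g x)"
  shows "0 < hessian_form F x v"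
proof -
  have xP: "x \<in> P" using x interior_subset by blast
  have L: "0 < L r x" for r using x by (simp add: interior_polytope)
  have e1: "D (\<lambda>y. D g y a) x = D (\<lambda>y. gradient_pairing F y a) x" for a
    by (rule frechet_derivative_cong_open[OF open_interior x]) (simp add: D_eqI[OF has_derivative_potential[OF F _ g]])
  have e2: "((\<lambda>y. gradient_pairing F y a) has_derivative
      (\<lambda>b. 1/2 * (\<Sum>r\<in>UNIV. (normal r \<bullet> a) * ((normal r \<bullet> b) / L r x + 0)) + D2 F x a b)) (at x)" for a
  proof -
    have "((\<lambda>y. ln (L r y)) has_derivative (\<lambda>b. (normal r \<bullet> b) / L r x)) (at x)" for r
      using L[of r] by (auto intro!: derivative_eq_intros has_derivative_ell simp: divide_inverse)
    then show ?thesis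
      unfolding gradient_pairing_def
      by (intro has_derivative_mult_right has_derivative_add has_derivative_const has_derivative_sum
        has_derivative_D potential_partD(2)[OF F xP])
  qed
  have D2: "D2 g x a b = 1/2 * (\<Sum>r\<in>UNIV. (normal r \<bullet> a) * (normal r \<bullet> b) / L r x) + D2 F x a b" for a b
    unfolding e1 D_eqI[OF e2] by simp
  note l = potential_partD(6,7)[OF F xP]
  have "v \<bullet> (Hess g x *v v) = D2 g x v v"
  proof (rule Hess_quadratic_form)
    show "linear (D2 g x v)" for v
      unfolding D2 by (intro linearI)
        (simp_all add: linear_add[OF l(1)] linear_cmul[OF l(1)] inner_add_right algebra_simps add_divide_distrib sum.distrib sum_distrib_left)
    show "linear (\<lambda>v. D2 g x v w)" for w
      unfolding D2 by (intro linearI)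
        (simp_all add: linear_add[OF l(2)] linear_cmul[OF l(2)] inner_add_right algebra_simps add_divide_distrib sum.distrib sum_distrib_left)
  qed
  moreover have "0 < v \<bullet> (Hess g x *v v)" using pos v by (simp add: positive_definite_def)
  ultimately show ?thesis by (simp add: D2 hessian_form_def power2_eq_square)
qed

text \<open>A segment from \<open>x\<close> to an interior point consists of interior points, apart from \<open>x\<close>, and there
  the form is positive. Along it the singular terms vanish identically by the condition on \<open>v\<close>, and the
  remaining terms converge.\<close>
lemma hessian_form_nonneg:
  assumes F: "potential_part F" and x: "x \<in> P" and v: "\<And>r. r \<in> tight_at x \<Longrightarrow> normal r \<bullet> v = 0"
    and g: "\<And>y. y \<in> interior P \<Longrightarrow> g y = guillemin_potential nu lam y + F y"
    and pos: "\<And>y. y \<in> interior P \<Longrightarrow> positive_definite (Hess g y)"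
  shows "0 \<le> hessian_form F x v"
proof (cases "v = 0")
  case True
  then show ?thesis using linear_0[OF potential_partD(6)[OF F x]] by (simp add: hessian_form_def)
next
  case False
  obtain x0 where x0: "x0 \<in> interior P" using delzant by (auto simp: delzant_def)
  define y where "y t = (1 - t) *\<^sub>R x + t *\<^sub>R x0" for t
  have yi: "y t \<in> interior P" if "0 < t" "t < 1" for t
  proof -
    have "0 < (1 - t) * L r x + t * L r x0" for r
      using that x0 ell_nonneg[OF x, of r] by (intro add_nonneg_pos) (auto simp: interior_polytope)
    then show ?thesis by (simp add: interior_polytope y_def ell_combination)
  qed
  have ylim: "(y \<longlongrightarrow> x) (at_right 0)"
  proof -
    have "((\<lambda>t. (1 - t) *\<^sub>R x + t *\<^sub>R x0) \<longlongrightarrow> (1 - 0) *\<^sub>R x + 0 *\<^sub>R x0) (at_right 0)"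
      by (intro tendsto_intros)
    then show ?thesis by (simp add: y_def[abs_def])
  qed
  have lim1: "((\<lambda>t. (normal r \<bullet> v)\<^sup>2 / L r (y t)) \<longlongrightarrow> (normal r \<bullet> v)\<^sup>2 / L r x) (at_right 0)" for r
  proof (cases "r \<in> tight_at x")
    case True
    then show ?thesis using v by simp
  next
    case False
    then have "L r x \<noteq> 0" by (simp add: tight_def)
    then show ?thesis unfolding ell_def by (intro tendsto_intros ylim) (simp add: ell_def)
  qed
  have lim2: "((\<lambda>t. D2 F (y t) v v) \<longlongrightarrow> D2 F x v v) (at_right 0)"
    by (rule isCont_tendsto_compose[OF potential_partD(3)[OF F x] ylim])
  have "((\<lambda>t. hessian_form F (y t) v) \<longlongrightarrow> hessian_form F x v) (at_right 0)"
    unfolding hessian_form_def by (intro tendsto_add tendsto_mult tendsto_const tendsto_sum lim1 lim2)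
  moreover have "\<forall>\<^sub>F t in at_right 0. 0 \<le> hessian_form F (y t) v"
    by (rule eventually_mono[OF eventually_at_right_real[OF zero_less_one]])
       (auto intro!: less_imp_le hessian_form_pos[OF F yi False g pos] yi)
  ultimately show ?thesis by (rule tendsto_lowerbound) simp
qed

lemma coord_hessian_quadratic_form:
  assumes \<sigma>: "vertex_ordering \<sigma>" and F: "potential_part F" and x: "x \<in> P"
  defines "v \<equiv> \<lambda>c :: real^'n. \<Sum>j\<in>UNIV. c $ j *\<^sub>R dual \<sigma> j"
  shows "hessian_form F x (v c) = (\<Sum>j\<in>UNIV. (c $ j)\<^sup>2 / (2 * L (\<sigma> j) x)) + c \<bullet> (coord_hessian F \<sigma> x *v c)"
proof -
  have inj: "inj \<sigma>" using vertex_orderingD[OF \<sigma>] by metis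
  have n: "normal r \<bullet> v c = (\<Sum>j\<in>UNIV. c $ j * (normal r \<bullet> dual \<sigma> j))" for r
    by (simp add: v_def inner_sum_right)
  have ns: "normal (\<sigma> j) \<bullet> v c = c $ j" for j
    by (simp add: n normal_inner_dual[OF \<sigma>] if_distrib cong: if_cong)
  have "c \<bullet> (coord_hessian F \<sigma> x *v c) = (\<Sum>j\<in>UNIV. c $ j * log_coord_deriv F \<sigma> j x (v c))"
    unfolding v_def log_coord_deriv_expansion[OF F x] by (simp add: inner_vec_def matrix_vector_mult_def)
  also have "\<dots> = 1/2 * (\<Sum>j\<in>UNIV. \<Sum>r\<in>- range \<sigma>. c $ j * (normal r \<bullet> dual \<sigma> j) * ((normal r \<bullet> v c) / L r x))
      + (\<Sum>j\<in>UNIV. c $ j * D2 F x (dual \<sigma> j) (v c))"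
    by (simp add: log_coord_deriv_def sum_distrib_left sum.distrib algebra_simps)
  also have "(\<Sum>j\<in>UNIV. c $ j * D2 F x (dual \<sigma> j) (v c)) = D2 F x (v c) (v c)"
  proof -
    note l = potential_partD(7)[OF F x]
    have "D2 F x (\<Sum>j\<in>UNIV. c $ j *\<^sub>R dual \<sigma> j) w = (\<Sum>j\<in>UNIV. c $ j * D2 F x (dual \<sigma> j) w)" for w
      by (simp add: linear_sum[OF l] linear_cmul[OF l])
    then show ?thesis by (simp add: v_def)
  qed
  also have "(\<Sum>j\<in>UNIV. \<Sum>r\<in>- range \<sigma>. c $ j * (normal r \<bullet> dual \<sigma> j) * ((normal r \<bullet> v c) / L r x))
      = (\<Sum>r\<in>- range \<sigma>. \<Sum>j\<in>UNIV. c $ j * (normal r \<bullet> dual \<sigma> j) * ((normal r \<bullet> v c) / L r x))"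
    by (rule sum.swap)
  also have "\<dots> = (\<Sum>r\<in>- range \<sigma>. (normal r \<bullet> v c)\<^sup>2 / L r x)"
    by (intro sum.cong refl) (simp only: sum_distrib_right[symmetric] n[symmetric], simp add: power2_eq_square)
  finally have H: "c \<bullet> (coord_hessian F \<sigma> x *v c) = 1/2 * (\<Sum>r\<in>- range \<sigma>. (normal r \<bullet> v c)\<^sup>2 / L r x) + D2 F x (v c) (v c)" .
  have "(\<Sum>r\<in>UNIV. (normal r \<bullet> v c)\<^sup>2 / L r x)
     = (\<Sum>r\<in>range \<sigma>. (normal r \<bullet> v c)\<^sup>2 / L r x) + (\<Sum>r\<in>- range \<sigma>. (normal r \<bullet> v c)\<^sup>2 / L r x)"
    by (subst sum.union_disjoint[symmetric]) (auto intro!: sum.cong)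
  also have "(\<Sum>r\<in>range \<sigma>. (normal r \<bullet> v c)\<^sup>2 / L r x) = (\<Sum>j\<in>UNIV. (c $ j)\<^sup>2 / L (\<sigma> j) x)"
    by (simp add: sum.reindex[OF inj] ns)
  finally show ?thesis
    unfolding hessian_form_def H by (simp add: algebra_simps sum_distrib_left)
qed

text \<open>The vector \<open>cnj z k\<close> vanishes where \<open>z\<^sub>j = 0\<close>, so its real and imaginary parts are directions
  tangent to the face. The Hessian form there is at most the energy, with equality if no \<open>z\<^sub>j\<close> vanishes.\<close>
lemma energy_nonneg:
  assumes F: "potential_part F" and p: "p \<in> chart_dom \<sigma>"
    and g: "\<And>y. y \<in> interior P \<Longrightarrow> g y = guillemin_potential nu lam y + F y"
    and pos: "\<And>y. y \<in> interior P \<Longrightarrow> positive_definite (Hess g y)"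
  shows "0 \<le> energy (z_coord \<sigma> p) (coord_hessian F \<sigma> (moment p)) k"
proof -
  have \<sigma>: "vertex_ordering \<sigma>" using p by (rule chart_domain_vertex)
  let ?x = "moment p" and ?H = "coord_hessian F \<sigma> (moment p)"
  have x: "?x \<in> P" and t: "tight_at ?x \<subseteq> range \<sigma>"
    using p mem_chart_domain_iff[OF \<sigma>] mem_manifoldD by blast+
  define z where "z = z_coord \<sigma> p"
  define b where "b = cnj_mult z k"
  have z: "2 * L (\<sigma> j) ?x = (cmod (z $ j))\<^sup>2" for j
    using ell_base_point[OF \<sigma>, of j "darboux \<sigma> p"]
    by (simp add: z_def cmod_complex_coords base_point_darboux[OF p])
  have nonneg: "0 \<le> (\<Sum>j\<in>UNIV. (c $ j)\<^sup>2 / (cmod (z $ j))\<^sup>2) + c \<bullet> (?H *v c)"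
    if c: "\<And>j. z $ j = 0 \<Longrightarrow> c $ j = 0" for c :: "real^'n"
  proof -
    have "0 \<le> hessian_form F ?x (\<Sum>j\<in>UNIV. c $ j *\<^sub>R dual \<sigma> j)"
    proof (rule hessian_form_nonneg[OF F x _ g pos])
      fix r assume r: "r \<in> tight_at ?x"
      then obtain i where i: "r = \<sigma> i" using t by blast
      then have "z $ i = 0" using r z[of i] by (simp add: tight_def)
      then show "normal r \<bullet> (\<Sum>j\<in>UNIV. c $ j *\<^sub>R dual \<sigma> j) = 0"
        using c by (simp add: i inner_sum_right normal_inner_dual[OF \<sigma>] if_distrib cong: if_cong)
    qed
    then show ?thesis by (simp add: coord_hessian_quadratic_form[OF \<sigma> F x] z)
  qed
  have b0: "z $ j = 0 \<Longrightarrow> b $ j = 0" for j by (simp add: b_def cnj_mult_def)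
  have "0 \<le> (\<Sum>j\<in>UNIV. (Re (b $ j))\<^sup>2 / (cmod (z $ j))\<^sup>2) + (\<Sum>j\<in>UNIV. (Im (b $ j))\<^sup>2 / (cmod (z $ j))\<^sup>2)
      + hermitian_form ?H b"
    using nonneg[of "\<chi> j. Re (b $ j)"] nonneg[of "\<chi> j. Im (b $ j)"] b0
    by (simp add: hermitian_form_eq)
  also have "(\<Sum>j\<in>UNIV. (Re (b $ j))\<^sup>2 / (cmod (z $ j))\<^sup>2) + (\<Sum>j\<in>UNIV. (Im (b $ j))\<^sup>2 / (cmod (z $ j))\<^sup>2)
      = (\<Sum>j\<in>UNIV. (cmod (b $ j))\<^sup>2 / (cmod (z $ j))\<^sup>2)"
    by (simp add: cmod_power2 add_divide_distrib sum.distrib)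
  also have "\<dots> \<le> (\<Sum>j\<in>UNIV. (cmod (k $ j))\<^sup>2)"
    by (intro sum_mono) (simp add: b_def cnj_mult_def norm_mult power_mult_distrib)
  finally show ?thesis by (simp add: energy_def z_def b_def)
qed

section \<open>Frames in a chart\<close>

text \<open>A frame of tangent vectors with prescribed components in one chart.\<close>
definition chart_frame :: "('n \<Rightarrow> 'd) \<Rightarrow> 'n toric_point \<Rightarrow> ('n \<Rightarrow> complex^('n + 'n)) \<Rightarrow>
    complex^'n^(('n + 'n) \<times> ('n \<Rightarrow> 'd))" where
  "chart_frame \<sigma> p f = (\<chi> i k. tangent_lift \<sigma> p (f k) $ i)"

lemma column_chart_frame: "column k (chart_frame \<sigma> p f) = tangent_lift \<sigma> p (f k)"
  by (simp add: column_def chart_frame_def)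

lemma component_chart_frame:
  assumes p: "p \<in> chart_dom \<sigma>"
  shows "component \<sigma> (chart_frame \<sigma> p f *v c) = (\<Sum>k\<in>UNIV. c $ k *s f k)"
  by (simp add: matrix_mult_sum column_chart_frame component_sum component_scale component_tangent_lift[OF p])

lemma chart_frame_mult_mem:
  assumes p: "p \<in> chart_dom \<sigma>"
  shows "chart_frame \<sigma> p f *v c \<in> tangent p"
  using subspace_tangent_space[of p] tangent_lift_mem[OF p]
  by (simp add: matrix_mult_sum column_chart_frame vec.subspace_sum vec.subspace_scale)

lemma dz_frame_combination:
  assumes "\<And>k. dz (f k) = axis k 1"
  shows "dz (\<Sum>k\<in>UNIV. c $ k *s f k) = c"
  by (simp add: dz_sum dz_scale assms basis_expansion)

lemma chart_frame_properties:
  assumes p: "p \<in> chart_dom \<sigma>" and S: "vec.subspace S" and f: "\<And>k. f k \<in> S" "\<And>k. dz (f k) = axis k 1"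
    and inj: "\<And>V W. V \<in> S \<Longrightarrow> W \<in> S \<Longrightarrow> dz V = dz W \<Longrightarrow> V = W"
  shows "chart_frame \<sigma> p f \<in> frames nu lam p"
    and "vec.span (columns (chart_frame \<sigma> p f)) = {\<xi> \<in> tangent p. component \<sigma> \<xi> \<in> S}"
proof -
  let ?M = "chart_frame \<sigma> p f"
  have "c = 0" if "?M *v c = 0" for c
    using component_chart_frame[OF p, of f c] dz_frame_combination[of f c] f(2) that by simp
  moreover have "columns ?M \<subseteq> tangent p"
    by (auto simp: columns_def column_chart_frame tangent_lift_mem[OF p])
  ultimately show "?M \<in> frames nu lam p"
    by (simp add: mem_frames_iff[OF subspace_tangent_space])
  have sum: "(\<Sum>k\<in>UNIV. c $ k *s f k) \<in> S" for c
    using S f by (intro vec.subspace_sum vec.subspace_scale) auto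
  show "vec.span (columns ?M) = {\<xi> \<in> tangent p. component \<sigma> \<xi> \<in> S}"
    unfolding span_columns
  proof (intro equalityI subsetI)
    fix \<xi> assume "\<xi> \<in> range ((*v) ?M)"
    then show "\<xi> \<in> {\<xi> \<in> tangent p. component \<sigma> \<xi> \<in> S}"
      using chart_frame_mult_mem[OF p] sum by (auto simp: component_chart_frame[OF p])
  next
    fix \<xi> assume \<xi>: "\<xi> \<in> {\<xi> \<in> tangent p. component \<sigma> \<xi> \<in> S}"
    have "component \<sigma> (?M *v dz (component \<sigma> \<xi>)) = component \<sigma> \<xi>"
      unfolding component_chart_frame[OF p]
      by (rule inj) (use sum \<xi> dz_frame_combination[OF f(2)] in auto)
    then have "?M *v dz (component \<sigma> \<xi>) = \<xi>"
      using component_determines_tangent[OF p chart_frame_mult_mem[OF p]] \<xi> by blast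
    then show "\<xi> \<in> range ((*v) ?M)" by (metis rangeI)
  qed
qed

lemma tendsto_chart_frame:
  assumes "\<And>k. ((\<lambda>s. f s k) \<longlongrightarrow> f0 k) G"
  shows "((\<lambda>s. chart_frame \<sigma> p (f s)) \<longlongrightarrow> chart_frame \<sigma> p f0) G"
  unfolding chart_frame_def
  by (intro vec_tendstoI) (simp add: tendsto_vec_nth[OF tendsto_tangent_lift[OF assms]])

text \<open>The candidate for the limit, described in one chart.\<close>
definition lim_set :: "('n \<Rightarrow> 'd) \<Rightarrow> 'n toric_point \<Rightarrow> ('n, 'd) tangent_vector set" where
  "lim_set \<sigma> p = {\<xi> \<in> tangent p. component \<sigma> \<xi> \<in> limit_space (z_coord \<sigma> p)}"

lemma omega_eq: "omega \<sigma> \<xi> \<eta> = coord_omega (component \<sigma> \<xi>) (component \<sigma> \<eta>)"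
  by (simp add: omega_def coord_omega_def)

lemma component_conjugate: "component \<sigma> (conjugate \<xi>) = (\<chi> k. cnj (component \<sigma> \<xi> $ k))"
  by (simp add: component_def conjugate_def)

lemma mem_positive_lagrangians_iff:
  "V \<in> positive_lagrangians nu lam p \<longleftrightarrow> V \<in> grassmannian nu lam p \<and> (\<forall>\<sigma>. p \<in> chart_dom \<sigma> \<longrightarrow>
      (\<forall>\<xi>\<in>V. \<forall>\<eta>\<in>V. omega \<sigma> \<xi> \<eta> = 0) \<and> (\<forall>\<xi>\<in>V. 0 \<le> Re (- \<i> * omega \<sigma> \<xi> (conjugate \<xi>))))"
  by (simp add: positive_lagrangians_def)

lemma tendsto_omega:
  assumes "(\<xi> \<longlongrightarrow> \<xi>0) G" "(\<eta> \<longlongrightarrow> \<eta>0) G"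
  shows "((\<lambda>s. omega \<sigma> (\<xi> s) (\<eta> s)) \<longlongrightarrow> omega \<sigma> \<xi>0 \<eta>0) G"
  unfolding omega_def component_def vec_lambda_beta
  by (intro tendsto_intros assms)

lemma tendsto_conjugate:
  assumes "(\<xi> \<longlongrightarrow> \<xi>0) G"
  shows "((\<lambda>s. conjugate (\<xi> s)) \<longlongrightarrow> conjugate \<xi>0) G"
  unfolding conjugate_def by (intro vec_tendstoI) (simp, intro tendsto_intros assms)

text \<open>Both conditions are closed conditions on the vectors \<open>M s c\<close>. In this way the limit is seen to be
  positive Lagrangian in all charts at once.\<close>
lemma positive_lagrangians_closed:
  assumes G: "G \<noteq> bot" and M: "\<forall>\<^sub>F s in G. vec.span (columns (M s)) \<in> positive_lagrangians nu lam p"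
    and M0: "M0 \<in> frames nu lam p" "(M \<longlongrightarrow> M0) G"
  shows "vec.span (columns M0) \<in> positive_lagrangians nu lam p"
  unfolding mem_positive_lagrangians_iff
proof (intro conjI allI impI ballI)
  show "vec.span (columns M0) \<in> grassmannian nu lam p"
    by (rule span_frame_mem_grassmannian[OF subspace_tangent_space M0(1)])
  fix \<sigma> \<xi> assume \<sigma>: "p \<in> chart_dom \<sigma>" and \<xi>: "\<xi> \<in> vec.span (columns M0)"
  have lim: "((\<lambda>s. M s *v c) \<longlongrightarrow> M0 *v c) G" for c
    by (rule bounded_bilinear.tendsto[OF bounded_bilinear_complex_matrix_vector_mult M0(2) tendsto_const])
  have mem: "M s *v c \<in> vec.span (columns (M s))" for s c by (simp add: span_columns)
  obtain c where c: "\<xi> = M0 *v c" using \<xi> by (auto simp: span_columns)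
  show "omega \<sigma> \<xi> \<eta> = 0" if "\<eta> \<in> vec.span (columns M0)" for \<eta>
  proof -
    obtain e where e: "\<eta> = M0 *v e" using \<open>\<eta> \<in> _\<close> by (auto simp: span_columns)
    have "((\<lambda>s. omega \<sigma> (M s *v c) (M s *v e)) \<longlongrightarrow> omega \<sigma> \<xi> \<eta>) G"
      unfolding c e by (intro tendsto_omega lim)
    moreover have "\<forall>\<^sub>F s in G. omega \<sigma> (M s *v c) (M s *v e) = 0"
      using M by eventually_elim (use \<sigma> mem in \<open>auto simp: mem_positive_lagrangians_iff\<close>)
    then have "((\<lambda>s. omega \<sigma> (M s *v c) (M s *v e)) \<longlongrightarrow> 0) G" by (rule tendsto_eventually)
    ultimately show ?thesis using tendsto_unique[OF G] by blast
  qed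
  have "((\<lambda>s. Re (- \<i> * omega \<sigma> (M s *v c) (conjugate (M s *v c)))) \<longlongrightarrow> Re (- \<i> * omega \<sigma> \<xi> (conjugate \<xi>))) G"
    unfolding c by (intro tendsto_intros tendsto_omega tendsto_conjugate lim)
  moreover have "\<forall>\<^sub>F s in G. 0 \<le> Re (- \<i> * omega \<sigma> (M s *v c) (conjugate (M s *v c)))"
    using M by eventually_elim (use \<sigma> mem in \<open>auto simp: mem_positive_lagrangians_iff\<close>)
  ultimately show "0 \<le> Re (- \<i> * omega \<sigma> \<xi> (conjugate \<xi>))"
    using G by (intro tendsto_lowerbound)
qed

section \<open>Positivity of the polarizations and of the perturbation\<close>

lemma hol_set_positive_lagrangian:
  assumes F: "potential_part F" and p: "p \<in> chart_dom \<sigma>" and pos: "positive_energy F p"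
    and G: "hol_set F \<sigma> p \<in> grassmannian nu lam p"
  shows "hol_set F \<sigma> p \<in> positive_lagrangians nu lam p"
  unfolding mem_positive_lagrangians_iff
proof (intro conjI allI impI ballI G)
  fix \<tau> \<xi> assume \<tau>: "p \<in> chart_dom \<tau>" and \<xi>: "\<xi> \<in> hol_set F \<sigma> p"
  have \<tau>o: "vertex_ordering \<tau>" using \<tau> by (rule chart_domain_vertex)
  have x: "moment p \<in> P" using \<tau> mem_chart_domain_iff[OF \<tau>o] mem_manifoldD by blast
  let ?z = "z_coord \<tau> p" and ?H = "coord_hessian F \<tau> (moment p)"
  have c: "component \<tau> \<eta> \<in> holomorphic_space ?z ?H" if "\<eta> \<in> hol_set F \<sigma> p" for \<eta>
  proof -
    have "\<eta> \<in> hol_set F \<tau> p" using that hol_set_chart_independent[OF F p \<tau>] by simp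
    then show ?thesis by (simp add: hol_set_def)
  qed
  show "omega \<tau> \<xi> \<eta> = 0" if "\<eta> \<in> hol_set F \<sigma> p" for \<eta>
    unfolding omega_eq
    by (rule holomorphic_space_isotropic[OF coord_hessian_symmetric[OF F x] c[OF \<xi>] c[OF that]])
  have "0 \<le> energy ?z ?H k" for k
  proof (cases "k = 0")
    case True
    then show ?thesis by (simp add: energy_def hermitian_form_def cnj_mult_def of_real_mult_def)
  qed (use pos \<tau> in \<open>auto simp: positive_energy_def less_imp_le\<close>)
  then show "0 \<le> Re (- \<i> * omega \<tau> \<xi> (conjugate \<xi>))"
    unfolding omega_eq component_conjugate by (rule holomorphic_space_positive[OF _ c[OF \<xi>]])
qed

text \<open>The Hessian of \<open>\<Psi>\<close> in the coordinates \<open>l\<close>.\<close>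
definition direction_hessian :: "(real^'n \<Rightarrow> real) \<Rightarrow> ('n \<Rightarrow> 'd) \<Rightarrow> real^'n \<Rightarrow> real^'n^'n" where
  "direction_hessian \<Psi> \<sigma> x = (\<chi> j m. D2 \<Psi> x (dual \<sigma> j) (dual \<sigma> m))"

lemma coord_hessian_add_scaleR:
  assumes U: "open U" "Ck_on 2 U \<Phi>" "Ck_on 2 U \<Psi>" "x \<in> U"
  shows "coord_hessian (\<lambda>y. \<Phi> y + s * \<Psi> y) \<sigma> x = coord_hessian \<Phi> \<sigma> x + s *\<^sub>R direction_hessian \<Psi> \<sigma> x"
  by (simp add: coord_hessian_def direction_hessian_def log_coord_deriv_def vec_eq_iff D2_add_scaleR[OF U])

lemma direction_hessian_positive_definite:
  assumes U: "open U" "Ck_on 2 U \<Psi>" "x \<in> U" and \<sigma>: "vertex_ordering \<sigma>" and pos: "positive_definite (Hess \<Psi> x)"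
  shows "positive_definite (direction_hessian \<Psi> \<sigma> x)"
  unfolding positive_definite_def
proof (intro allI impI)
  fix v :: "real^'n" assume v: "v \<noteq> 0"
  define w where "w = (\<Sum>j\<in>UNIV. v $ j *\<^sub>R dual \<sigma> j)"
  have "normal (\<sigma> j) \<bullet> w = v $ j" for j
    by (simp add: w_def inner_sum_right normal_inner_dual[OF \<sigma>] if_distrib cong: if_cong)
  then have "w \<noteq> 0" using v by (metis inner_zero_right vec_eq_iff zero_index)
  then have "0 < w \<bullet> (Hess \<Psi> x *v w)" using pos by (simp add: positive_definite_def)
  also have "\<dots> = D2 \<Psi> x w w"
    by (rule Hess_quadratic_form) (use linear_D2[OF U] in auto)
  also have "\<dots> = (\<Sum>j\<in>UNIV. \<Sum>m\<in>UNIV. v $ j * (v $ m * D2 \<Psi> x (dual \<sigma> j) (dual \<sigma> m)))"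
  proof -
    note l = linear_D2[OF U]
    have "D2 \<Psi> x w w = (\<Sum>j\<in>UNIV. v $ j * D2 \<Psi> x (dual \<sigma> j) w)"
      by (subst w_def) (simp add: linear_sum[OF l(2)] linear_cmul[OF l(2)])
    also have "\<dots> = (\<Sum>j\<in>UNIV. v $ j * (\<Sum>m\<in>UNIV. v $ m * D2 \<Psi> x (dual \<sigma> j) (dual \<sigma> m)))"
      by (simp add: w_def linear_sum[OF l(1)] linear_cmul[OF l(1)])
    finally show ?thesis by (simp add: sum_distrib_left)
  qed
  also have "\<dots> = v \<bullet> (direction_hessian \<Psi> \<sigma> x *v v)"
    by (simp add: inner_vec_def matrix_vector_mult_def direction_hessian_def sum_distrib_left mult_ac)
  finally show "0 < v \<bullet> (direction_hessian \<Psi> \<sigma> x *v v)" .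
qed

section \<open>The real polarization\<close>

lemma torus_action_toric_class:
  "torus_action t (toric_pt x \<theta>) = toric_pt x (\<theta> + t)"
proof (intro equalityI subsetI)
  fix q assume "q \<in> toric_pt x (\<theta> + t)"
  then have "q = (x, snd q)" "snd q - t - \<theta> \<in> stab x"
    by (auto simp: toric_class_def algebra_simps)
  then have "q = (\<lambda>(x, \<theta>). (x, \<theta> + t)) (x, snd q - t)" "(x, snd q - t) \<in> toric_pt x \<theta>"
    by (auto simp: toric_class_def)
  then show "q \<in> torus_action t (toric_pt x \<theta>)"
    unfolding torus_action_def by (rule image_eqI)
qed (auto simp: torus_action_def toric_class_def algebra_simps)

text \<open>The representative angle of the moved point is determined only up to the stabiliser, which acts
  trivially on the coordinates: a multiple of \<open>2\<pi>\<close> where \<open>z\<^sub>j \<noteq> 0\<close>, and anything where \<open>z\<^sub>j = 0\<close>.\<close>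
lemma torus_action_chart:
  assumes p: "p \<in> chart_dom \<sigma>"
  shows "torus_action t p \<in> chart_dom \<sigma>" "moment (torus_action t p) = moment p"
    and "complex_coords (darboux \<sigma> (torus_action t p)) $ j
      = z_coord \<sigma> p $ j * cis (dual \<sigma> j \<bullet> t)"
proof -
  have \<sigma>: "vertex_ordering \<sigma>" using p by (rule chart_domain_vertex)
  have mem: "p \<in> manifold" "tight_at (moment p) \<subseteq> range \<sigma>" using p mem_chart_domain_iff[OF \<sigma>] by auto
  define q where "q = torus_action t p"
  have q: "q = toric_pt (moment p) (angle_of p + t)"
    unfolding q_def using mem_manifoldD(2)[OF mem(1)] torus_action_toric_class by metis
  have m: "moment q = moment p" by (simp add: q)
  then show "moment (torus_action t p) = moment p" by (simp add: q_def)
  have "q \<in> chart_dom \<sigma>"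
    using mem mem_manifoldD(1)[OF mem(1)] by (simp add: mem_chart_domain_iff[OF \<sigma>] m) (simp add: q)
  then show "torus_action t p \<in> chart_dom \<sigma>" by (simp add: q_def)
  show "complex_coords (darboux \<sigma> (torus_action t p)) $ j
      = z_coord \<sigma> p $ j * cis (dual \<sigma> j \<bullet> t)"
  proof (cases "\<sigma> j \<in> tight_at (moment p)")
    case True
    then show ?thesis by (simp add: complex_coords_darboux m[unfolded q_def] tight_def)
  next
    case False
    have "angle_of q - (angle_of p + t) \<in> stab (moment p)"
      unfolding q by (rule angle_toric_class)
    then obtain k :: int where "dual \<sigma> j \<bullet> (angle_of q - (angle_of p + t)) = 2 * pi * of_int k"
      using False stabiliser_iff[OF \<sigma> mem(2)] by blast
    then have "dual \<sigma> j \<bullet> angle_of q = dual \<sigma> j \<bullet> angle_of p + dual \<sigma> j \<bullet> t + 2 * pi * of_int k"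
      by (simp add: inner_diff_right inner_add_right)
    then have "cis (dual \<sigma> j \<bullet> angle_of q) = cis (dual \<sigma> j \<bullet> angle_of p) * cis (dual \<sigma> j \<bullet> t)"
      by (simp add: cis_mult[symmetric])
    then show ?thesis by (simp add: complex_coords_darboux m flip: q_def)
  qed
qed

definition orbit_velocity :: "('n \<Rightarrow> 'd) \<Rightarrow> 'n toric_point \<Rightarrow> real^'n \<Rightarrow> real^('n + 'n)" where
  "orbit_velocity \<sigma> p \<eta> =
     realify (\<chi> j. \<i> * complex_of_real (dual \<sigma> j \<bullet> \<eta>) * z_coord \<sigma> p $ j)"

lemma has_vector_derivative_orbit:
  assumes p: "p \<in> chart_dom \<sigma>"
  shows "((\<lambda>t. darboux \<sigma> (torus_action (t *\<^sub>R \<eta>) p)) has_vector_derivative orbit_velocity \<sigma> p \<eta>) (at 0)"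
proof -
  let ?z = "z_coord \<sigma> p"
  have eq: "darboux \<sigma> (torus_action (t *\<^sub>R \<eta>) p) = realify (\<chi> j. ?z $ j * cis (t * (dual \<sigma> j \<bullet> \<eta>)))" for t
    using torus_action_chart(3)[OF p, of "t *\<^sub>R \<eta>"]
    by (metis (no_types, lifting) inner_scaleR_right realify_complex_coords vec_lambda_unique)
  have "((\<lambda>t. ?z $ j * cis (t * (dual \<sigma> j \<bullet> \<eta>))) has_derivative
      (\<lambda>h. ?z $ j * (h *\<^sub>R (\<i> * complex_of_real (dual \<sigma> j \<bullet> \<eta>))))) (at 0)" for j
  proof -
    have "((\<lambda>t. cis (t * (dual \<sigma> j \<bullet> \<eta>))) has_vector_derivative \<i> * complex_of_real (dual \<sigma> j \<bullet> \<eta>)) (at 0)"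
    proof -
      have "((\<lambda>t. \<i> * complex_of_real (t * (dual \<sigma> j \<bullet> \<eta>))) has_derivative
          (\<lambda>h. \<i> * complex_of_real (h * (dual \<sigma> j \<bullet> \<eta>)))) (at 0)"
        by (intro derivative_intros)
      from has_derivative_compose[OF this DERIV_exp[unfolded has_field_derivative_def]]
      show ?thesis
        by (simp add: cis_conv_exp has_vector_derivative_def scaleR_conv_of_real mult_ac)
    qed
    then show ?thesis unfolding has_vector_derivative_def by (rule has_derivative_mult_right)
  qed
  then have "((\<lambda>t. \<chi> j. ?z $ j * cis (t * (dual \<sigma> j \<bullet> \<eta>))) has_derivative
      (\<lambda>h. \<chi> j. ?z $ j * (h *\<^sub>R (\<i> * complex_of_real (dual \<sigma> j \<bullet> \<eta>))))) (at 0)"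
    unfolding has_derivative_vec_iff vec_lambda_beta by blast
  from bounded_linear.has_derivative[OF bounded_linear_realify this]
  have "((\<lambda>t. realify (\<chi> j. ?z $ j * cis (t * (dual \<sigma> j \<bullet> \<eta>)))) has_derivative
      (\<lambda>h. realify (\<chi> j. ?z $ j * (h *\<^sub>R (\<i> * complex_of_real (dual \<sigma> j \<bullet> \<eta>)))))) (at 0)" .
  moreover have "realify (\<chi> j. ?z $ j * (h *\<^sub>R (\<i> * complex_of_real (dual \<sigma> j \<bullet> \<eta>)))) = h *\<^sub>R orbit_velocity \<sigma> p \<eta>" for h
    unfolding orbit_velocity_def linear_cmul[OF bounded_linear.linear[OF bounded_linear_realify], symmetric]
    by (rule arg_cong[of _ _ realify]) (simp add: vec_eq_iff mult_ac)
  ultimately show ?thesis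
    unfolding has_vector_derivative_def eq by simp
qed

lemma component_velocity:
  "component \<sigma> (velocity nu lam (\<lambda>t. torus_action (t *\<^sub>R \<eta>) p))
    = (if p \<in> chart_dom \<sigma> then complex_vec (orbit_velocity \<sigma> p \<eta>) else 0)"
proof -
  have "torus_action (0 *\<^sub>R \<eta>) p = p" by (simp add: torus_action_def)
  then show ?thesis
    using vector_derivative_at[OF has_vector_derivative_orbit[of p \<sigma> \<eta>]]
    by (auto simp: component_def velocity_def vec_eq_iff complex_vec_def)
qed

lemma velocity_mem_tangent_space: "velocity nu lam (\<lambda>t. torus_action (t *\<^sub>R \<eta>) p) \<in> tangent p"
proof (rule tangent_spaceI)
  fix \<sigma> \<tau> assume p: "p \<in> chart_dom \<sigma>" "p \<in> chart_dom \<tau>"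
  let ?u = "darboux \<sigma> p"
  have z: "torus_action (0 *\<^sub>R \<eta>) p = p" by (simp add: torus_action_def)
  have T: "(transition \<sigma> \<tau> has_derivative D (transition \<sigma> \<tau>) ?u) (at (darboux \<sigma> (torus_action (0 *\<^sub>R \<eta>) p)))"
    unfolding z by (rule has_derivative_transition[OF p])
  have eq: "transition \<sigma> \<tau> (darboux \<sigma> (torus_action (t *\<^sub>R \<eta>) p)) = darboux \<tau> (torus_action (t *\<^sub>R \<eta>) p)" for t
    using torus_action_chart(1)[OF p(1)] by simp
  have "((\<lambda>t. darboux \<tau> (torus_action (t *\<^sub>R \<eta>) p)) has_derivative
      (\<lambda>h. D (transition \<sigma> \<tau>) ?u (h *\<^sub>R orbit_velocity \<sigma> p \<eta>))) (at 0)"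
    using has_derivative_compose[OF has_vector_derivative_orbit[OF p(1), of \<eta>, unfolded has_vector_derivative_def] T]
    unfolding eq .
  then have "((\<lambda>t. darboux \<tau> (torus_action (t *\<^sub>R \<eta>) p)) has_vector_derivative D (transition \<sigma> \<tau>) ?u (orbit_velocity \<sigma> p \<eta>)) (at 0)"
    by (simp add: has_vector_derivative_def linear_cmul[OF has_derivative_linear[OF has_derivative_transition[OF p]]])
  then have "orbit_velocity \<tau> p \<eta> = D (transition \<sigma> \<tau>) ?u (orbit_velocity \<sigma> p \<eta>)"
    using has_vector_derivative_orbit[OF p(2)] vector_derivative_unique_at by blast
  then show "component \<tau> (velocity nu lam (\<lambda>t. torus_action (t *\<^sub>R \<eta>) p))
      = complex_jacobian (transition \<sigma> \<tau>) ?u *v component \<sigma> (velocity nu lam (\<lambda>t. torus_action (t *\<^sub>R \<eta>) p))"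
    using p linear_0[OF has_derivative_linear[OF has_derivative_transition[OF p]]]
    by (simp add: component_velocity complex_jacobian_mult[OF has_derivative_transition[OF p]] complex_vec_def vec_eq_iff zero_vec_def[symmetric])
qed (simp add: component_velocity)

lemma dz_orbit_velocity:
  "dz (complex_vec (orbit_velocity \<sigma> p \<eta>)) $ j
     = \<i> * complex_of_real (dual \<sigma> j \<bullet> \<eta>) * z_coord \<sigma> p $ j"
  "dzbar (complex_vec (orbit_velocity \<sigma> p \<eta>)) $ j
     = - \<i> * complex_of_real (dual \<sigma> j \<bullet> \<eta>) * cnj (z_coord \<sigma> p $ j)"
  by (simp_all add: dz_complex_vec orbit_velocity_def)

text \<open>The action of the one-parameter group of the normal \<open>\<sigma> i\<close> rotates the coordinate \<open>z\<^sub>i\<close> alone,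
  because dual and normal basis are dual to each other.\<close>
lemma real_polarization_eq:
  assumes p: "p \<in> chart_dom \<sigma>"
  shows "real_polarization nu lam p =
    {\<xi> \<in> tangent p. component \<sigma> \<xi> \<in> orbit_space (z_coord \<sigma> p)}"
    (is "_ = ?R")
proof
  have \<sigma>: "vertex_ordering \<sigma>" using p by (rule chart_domain_vertex)
  let ?z = "z_coord \<sigma> p"
  let ?v = "\<lambda>\<eta>. velocity nu lam (\<lambda>t. torus_action (t *\<^sub>R \<eta>) p)"
  have "?v \<eta> \<in> ?R" for \<eta>
    using velocity_mem_tangent_space p
    by (auto simp: component_velocity orbit_space_def dz_orbit_velocity intro!: exI[of _ "\<chi> j. complex_of_real (dual \<sigma> j \<bullet> \<eta>)"])
  then have "{?v \<eta> | \<eta>. True} \<subseteq> ?R" by blast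
  then show "real_polarization nu lam p \<subseteq> ?R"
    unfolding real_polarization_def
    by (rule vec.span_minimal[OF _ subspace_component_preimage[OF subspace_orbit_space]])
  show "?R \<subseteq> real_polarization nu lam p"
  proof
    fix \<xi> assume \<xi>: "\<xi> \<in> ?R"
    then obtain c where c: "\<And>j. dz (component \<sigma> \<xi>) $ j = \<i> * c $ j * ?z $ j"
      "\<And>j. dzbar (component \<sigma> \<xi>) $ j = - \<i> * c $ j * cnj (?z $ j)"
      unfolding orbit_space_def by blast
    define \<eta> where "\<eta> = (\<Sum>i\<in>UNIV. c $ i *s ?v (normal (\<sigma> i)))"
    have d: "dual \<sigma> j \<bullet> normal (\<sigma> i) = (if i = j then 1 else 0)" for i j
      using normal_inner_dual[OF \<sigma>, of i j] by (simp add: inner_commute)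
    have "component \<sigma> \<eta> = component \<sigma> \<xi>"
    proof (rule vec_eqI_dz)
      have "dz (component \<sigma> \<eta>) $ j = (\<Sum>i\<in>UNIV. c $ i * (\<i> * complex_of_real (if i = j then 1 else 0) * ?z $ j))" for j
        by (simp add: \<eta>_def component_sum component_scale component_velocity p dz_sum dz_scale dz_orbit_velocity d)
      also have "\<dots> j = (\<Sum>i\<in>UNIV. if i = j then \<i> * c $ j * ?z $ j else 0)" for j
        by (intro sum.cong) auto
      finally show "dz (component \<sigma> \<eta>) = dz (component \<sigma> \<xi>)"
        by (simp add: vec_eq_iff c)
      have "dzbar (component \<sigma> \<eta>) $ j = (\<Sum>i\<in>UNIV. c $ i * (- \<i> * complex_of_real (if i = j then 1 else 0) * cnj (?z $ j)))" for j
        by (simp add: \<eta>_def component_sum component_scale component_velocity p dz_sum dz_scale dz_orbit_velocity d)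
      also have "\<dots> j = (\<Sum>i\<in>UNIV. if i = j then - \<i> * c $ j * cnj (?z $ j) else 0)" for j
        by (intro sum.cong) auto
      finally show "dzbar (component \<sigma> \<eta>) = dzbar (component \<sigma> \<xi>)"
        by (simp add: vec_eq_iff c)
    qed
    moreover have "\<eta> \<in> tangent p"
      unfolding \<eta>_def using subspace_tangent_space velocity_mem_tangent_space
      by (intro vec.subspace_sum vec.subspace_scale) auto
    ultimately have "\<xi> = \<eta>" using component_determines_tangent[OF p, of \<xi> \<eta>] \<xi> by simp
    also have "\<eta> \<in> real_polarization nu lam p"
      unfolding \<eta>_def real_polarization_def by (intro vec.span_sum vec.span_scale vec.span_base) blast
    finally show "\<xi> \<in> real_polarization nu lam p" .
  qed
qed

lemma real_polarization_subset_lim_set: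
  "p \<in> chart_dom \<sigma> \<Longrightarrow> real_polarization nu lam p \<subseteq> lim_set \<sigma> p"
  using orbit_space_subset_limit_space by (auto simp: real_polarization_eq lim_set_def)

section \<open>Continuous sections of the limit\<close>

text \<open>Where \<open>z\<^sub>j = 0\<close> the limit contains \<open>\<partial>/\<partial>z\<^sub>j\<close>. At the points \<open>y t\<close> with \<open>z\<^sub>j = t > 0\<close> the defining
  condition reads \<open>dzbar\<^sub>j = - dz\<^sub>j\<close>, which is the vanishing of the real component of the section; in the limit \<open>t \<rightarrow> 0\<close> this
  and \<open>dzbar\<^sub>j = 0\<close> leave no component at all.\<close>
lemma continuous_section_mem_real_polarization:
  assumes p: "p \<in> U" "p \<in> chart_dom \<sigma>"
    and U: "open (darboux \<sigma> ` (U \<inter> chart_dom \<sigma>))"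
    and X: "\<And>q. q \<in> U \<inter> chart_dom \<sigma> \<Longrightarrow> X q \<in> lim_set \<sigma> q"
    and cont: "continuous_on (darboux \<sigma> ` (U \<inter> chart_dom \<sigma>))
      (\<lambda>u. component \<sigma> (X (darboux_inv \<sigma> u)))"
  shows "X p \<in> real_polarization nu lam p"
proof -
  let ?O = "darboux \<sigma> ` (U \<inter> chart_dom \<sigma>)"
  let ?u = "darboux \<sigma> p"
  let ?f = "\<lambda>u. component \<sigma> (X (darboux_inv \<sigma> u))"
  have u: "?u \<in> ?O" using p by blast
  have f: "?f w \<in> limit_space (complex_coords w)" if "w \<in> ?O" for w
    using that X by (auto simp: lim_set_def)
  have fu: "component \<sigma> (X p) = ?f ?u" using p by simp
  have isC: "isCont ?f ?u" using cont U u continuous_on_eq_continuous_at by blast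
  have van: "dz (?f ?u) $ j = 0" if zj: "complex_coords ?u $ j = 0" for j
  proof -
    define y where "y t = ?u + t *\<^sub>R (axis (Inl j) 1 :: real^('n + 'n))" for t :: real
    have "(y \<longlongrightarrow> ?u + 0 *\<^sub>R (axis (Inl j) 1 :: real^('n + 'n))) (at_right 0)"
      unfolding y_def[abs_def] by (intro tendsto_intros)
    then have ylim: "(y \<longlongrightarrow> ?u) (at_right 0)" by simp
    then have "\<forall>\<^sub>F t in at_right 0. y t \<in> ?O" using U u topological_tendstoD by blast
    then have "\<forall>\<^sub>F t in at_right 0. ?f (y t) $ Inl j = 0"
      using eventually_at_right_less[of "0::real"]
    proof eventually_elim
      case (elim t)
      have "complex_coords (y t) $ j = complex_of_real t"
        using zj by (simp add: complex_coords_def y_def axis_def complex_eq_iff)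
      then have "dzbar (?f (y t)) $ j = - dz (?f (y t)) $ j"
        using f[OF elim(1)] elim(2) by (simp add: limit_space_def)
      then show "?f (y t) $ Inl j = 0" by (simp add: dz_def dzbar_def)
    qed
    then have "((\<lambda>t. ?f (y t) $ Inl j) \<longlongrightarrow> 0) (at_right 0)" by (rule tendsto_eventually)
    moreover have "((\<lambda>t. ?f (y t) $ Inl j) \<longlongrightarrow> ?f ?u $ Inl j) (at_right 0)"
      by (intro tendsto_vec_nth isCont_tendsto_compose[OF isC ylim])
    ultimately have "?f ?u $ Inl j = 0"
      using tendsto_unique[OF trivial_limit_at_right_real] by blast
    moreover have "dzbar (?f ?u) $ j = 0" using f[OF u] zj by (simp add: limit_space_def)
    ultimately show "dz (?f ?u) $ j = 0" by (simp add: dz_def dzbar_def)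
  qed
  let ?z = "complex_coords ?u"
  have "component \<sigma> (X p) \<in> orbit_space ?z"
    unfolding orbit_space_def fu
  proof (intro CollectI exI allI conjI)
    fix j
    show "dz (?f ?u) $ j = \<i> * (\<chi> j. dz (?f ?u) $ j / (\<i> * ?z $ j)) $ j * ?z $ j"
      using van[of j] by (cases "?z $ j = 0") simp_all
    show "dzbar (?f ?u) $ j = - \<i> * (\<chi> j. dz (?f ?u) $ j / (\<i> * ?z $ j)) $ j * cnj (?z $ j)"
      using f[OF u] by (cases "?z $ j = 0") (simp_all add: limit_space_def)
  qed
  moreover have "X p \<in> tangent p" using X[of p] p by (auto simp: lim_set_def)
  ultimately show ?thesis by (simp add: real_polarization_eq[OF p(2)])
qed

end

section \<open>The deformation of the potential\<close>

text \<open>The functions \<open>\<Phi>\<close> and \<open>\<Psi>\<close> are the smooth extensions of \<open>\<phi>\<close> and \<open>\<psi>\<close> beyond the polytope, so that derivatives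
  make sense at its boundary.\<close>
locale potential_deformation = delzant_polytope nu lam
  for nu :: "'d::finite \<Rightarrow> int^'n::finite" and lam :: "'d \<Rightarrow> int" +
  fixes \<phi> \<psi> \<Phi> \<Psi> :: "real^'n \<Rightarrow> real" and U :: "(real^'n) set"
  assumes U: "open U" "P \<subseteq> U" "Ck_on 2 U \<Phi>" "Ck_on 2 U \<Psi>"
    and ext: "\<And>x. x \<in> P \<Longrightarrow> \<Phi> x = \<phi> x" "\<And>x. x \<in> P \<Longrightarrow> \<Psi> x = \<psi> x"
    and Hess_\<phi>: "\<And>x. x \<in> interior P \<Longrightarrow> positive_definite (Hess (\<lambda>y. guillemin_potential nu lam y + \<phi> y) x)"
    and Hess_\<psi>: "\<And>x. x \<in> P \<Longrightarrow> positive_definite (Hess \<Psi> x)"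
begin

abbreviation "F s \<equiv> (\<lambda>y. \<Phi> y + s * \<Psi> y)"

lemma potential_part_F: "potential_part (F s)"
  unfolding potential_part_def using U Ck_on_2_add_scaleR by blast

lemma potential_part_\<Phi>: "potential_part \<Phi>"
  unfolding potential_part_def using U by blast

lemma coord_hessian_F:
  "x \<in> P \<Longrightarrow> coord_hessian (F s) \<sigma> x = coord_hessian \<Phi> \<sigma> x + s *\<^sub>R direction_hessian \<Psi> \<sigma> x"
  by (rule coord_hessian_add_scaleR[OF U(1,3,4) subsetD[OF U(2)]])

lemma direction_hessian_pos:
  assumes "vertex_ordering \<sigma>" "x \<in> P"
  shows "positive_definite (direction_hessian \<Psi> \<sigma> x)"
  by (rule direction_hessian_positive_definite[OF U(1,4) _ assms(1) Hess_\<psi>[OF assms(2)]]) (use U assms in auto)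

lemma energy_\<Phi>_nonneg:
  assumes "p \<in> chart_dom \<sigma>"
  shows "0 \<le> energy (z_coord \<sigma> p) (coord_hessian \<Phi> \<sigma> (moment p)) k"
  by (rule energy_nonneg[OF potential_part_\<Phi> assms _ Hess_\<phi>]) (simp add: ext(1)[OF subsetD[OF interior_subset]])

lemma chart_domain_moment:
  assumes "p \<in> chart_dom \<sigma>" shows "moment p \<in> P"
  using assms mem_chart_domain_iff[OF chart_domain_vertex[OF assms]] mem_manifoldD by blast

lemma positive_energy_F: "s > 0 \<Longrightarrow> positive_energy (F s) p"
  unfolding positive_energy_def
  by (auto simp: coord_hessian_F[OF chart_domain_moment] intro!: energy_perturbed_pos energy_\<Phi>_nonneg
      direction_hessian_pos chart_domain_vertex chart_domain_moment)

lemma potential_path_eq: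
  "y \<in> interior P \<Longrightarrow> potential_path nu lam \<phi> \<psi> s y = guillemin_potential nu lam y + F s y"
  using ext interior_subset[of P] by (auto simp: potential_path_def)

lemma holomorphic_polarization_potential_path:
  assumes "s > 0" "p \<in> chart_dom \<sigma>"
  shows "holomorphic_polarization nu lam (potential_path nu lam \<phi> \<psi> s) p = hol_set (F s) \<sigma> p"
  by (rule holomorphic_polarization_eq[OF potential_part_F assms(2) positive_energy_F[OF assms(1)] potential_path_eq])

text \<open>The frames are normalised by \<open>dz = axis k 1\<close>, which is possible for every \<open>s > 0\<close> and for the
  limit.\<close>
lemma polarization_limit:
  assumes p: "p \<in> chart_dom \<sigma>"
    and Pol: "\<And>s. s \<ge> 0 \<Longrightarrow> Pol s = holomorphic_polarization nu lam (potential_path nu lam \<phi> \<psi> s)"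
  shows "polarization_tends_to nu lam Pol p V \<longleftrightarrow> V = lim_set \<sigma> p"
proof -
  let ?z = "z_coord \<sigma> p" and ?x = "moment p"
  let ?H = "\<lambda>s. coord_hessian \<Phi> \<sigma> ?x + s *\<^sub>R direction_hessian \<Psi> \<sigma> ?x"
  have \<sigma>: "vertex_ordering \<sigma>" using p by (rule chart_domain_vertex)
  note x = chart_domain_moment[OF p]
  have H: "coord_hessian (F s) \<sigma> ?x = ?H s" for s by (rule coord_hessian_F[OF x])
  define M where "M s = chart_frame \<sigma> p (\<lambda>k. holomorphic_lift ?z (?H s) (axis k 1))" for s
  define M0 where "M0 = chart_frame \<sigma> p (\<lambda>k. from_dz (axis k 1) (\<chi> j. - (cnj (?z $ j) / ?z $ j) * axis k 1 $ j))"
  have lim: "(M \<longlongrightarrow> M0) at_top"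
    unfolding M_def[abs_def] M0_def
    by (intro tendsto_chart_frame tendsto_holomorphic_lift energy_\<Phi>_nonneg[OF p] direction_hessian_pos[OF \<sigma> x])
  have M0: "M0 \<in> frames nu lam p" "vec.span (columns M0) = lim_set \<sigma> p"
    unfolding M0_def lim_set_def
    by (rule chart_frame_properties[OF p subspace_limit_space limit_space_lift _ limit_space_eqI]; simp)+
  have M: "M s \<in> frames nu lam p" "vec.span (columns (M s)) = hol_set (F s) \<sigma> p" if s: "s > 0" for s
  proof -
    have e: "0 \<le> energy ?z (?H s) k" for k
    proof (cases "k = 0")
      case True
      then show ?thesis by (simp add: energy_def hermitian_form_def cnj_mult_def of_real_mult_def)
    next
      case False
      then show ?thesis using positive_energy_F[OF s, of p] p by (auto simp: positive_energy_def H less_imp_le)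
    qed
    note u = dz_determines_holomorphic_space[OF e]
    have inj: "W = W'" if "W \<in> holomorphic_space ?z (?H s)" "W' \<in> holomorphic_space ?z (?H s)" "dz W = dz W'" for W W'
      using u[of "dz W"] that by metis
    show "M s \<in> frames nu lam p" "vec.span (columns (M s)) = hol_set (F s) \<sigma> p"
      unfolding M_def hol_set_def H
      by (rule chart_frame_properties[OF p subspace_holomorphic_space holomorphic_lift_mem[OF e] dz_holomorphic_lift[OF e] inj]; assumption)+
  qed
  have ev: "\<forall>\<^sub>F s in at_top. (0::real) < s" by (rule eventually_gt_at_top)
  have Ms: "\<forall>\<^sub>F s in at_top. M s \<in> frames nu lam p \<and> vec.span (columns (M s)) = Pol s p"
    using ev by eventually_elim (simp add: M Pol holomorphic_polarization_potential_path[OF _ p])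
  have lag: "hol_set (F s) \<sigma> p \<in> positive_lagrangians nu lam p" if s: "s > 0" for s
    using span_frame_mem_grassmannian[OF subspace_tangent_space M(1)[OF s]]
    by (intro hol_set_positive_lagrangian potential_part_F p positive_energy_F s) (simp add: M(2)[OF s])
  have Mlag: "\<forall>\<^sub>F s in at_top. Pol s p \<in> positive_lagrangians nu lam p"
    using ev by eventually_elim (simp add: Pol holomorphic_polarization_potential_path[OF _ p] lag)
  have "\<forall>\<^sub>F s in at_top. vec.span (columns (M s)) \<in> positive_lagrangians nu lam p"
    using ev by eventually_elim (simp add: M lag)
  then have lag0: "vec.span (columns M0) \<in> positive_lagrangians nu lam p"
    by (rule positive_lagrangians_closed[OF trivial_limit_at_top_linorder _ M0(1) lim])
  show ?thesis
    unfolding polarization_tends_to_def M0(2)[symmetric]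
    using limitin_positive_lagrangian_grassmannianI[OF subspace_tangent_space Ms Mlag M0(1) lim lag0]
      limit_in_positive_lagrangian_grassmannian_unique[OF subspace_tangent_space trivial_limit_at_top_linorder Ms M0(1) lim]
    by blast
qed

end

theorem theorem1p2:
  fixes nu :: "'d::finite \<Rightarrow> int^'n::finite" and lam :: "'d \<Rightarrow> int"
    and \<phi> \<psi> :: "real^'n \<Rightarrow> real"
    and Pol :: "real \<Rightarrow> 'n toric_point \<Rightarrow> ('n, 'd) tangent_vector set"
  assumes "delzant nu lam"
    and "\<phi> \<in> admissible_functions nu lam"
    and "\<psi> \<in> smooth_Hess_pos (polytope_of nu lam)"
    and Pol: "\<And>s. s \<ge> 0 \<Longrightarrow>
      Pol s = holomorphic_polarization nu lam (potential_path nu lam \<phi> \<psi> s)"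
  shows "(\<forall>p \<in> toric_manifold nu lam. \<exists>!L. polarization_tends_to nu lam Pol p L) \<and>
    (\<forall>U. manifold_open nu lam U \<longrightarrow>
      smooth_sections nu lam (limit_polarization nu lam Pol) U
        = smooth_sections nu lam (real_polarization nu lam) U)"
proof -
  let ?P = "polytope_of nu lam"
  note adm = assms(2)[unfolded admissible_functions_def mem_Collect_eq]
  have Hess_\<phi>: "\<forall>x\<in>interior ?P. positive_definite (Hess (\<lambda>y. guillemin_potential nu lam y + \<phi> y) x)"
    by (rule conjunct1[OF conjunct2[OF adm]])
  have "\<phi> \<in> smooth_functions ?P" by (rule conjunct1[OF adm])
  then obtain \<Phi> where "smooth_extension ?P \<phi> \<Phi>"
    unfolding smooth_functions_def by blast
  then obtain U\<^sub>1 where \<Phi>: "open U\<^sub>1" "?P \<subseteq> U\<^sub>1" "smooth_on U\<^sub>1 \<Phi>" "\<forall>x\<in>?P. \<Phi> x = \<phi> x"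
    unfolding smooth_extension_def by blast
  obtain \<Psi> where "smooth_extension ?P \<psi> \<Psi>" and Hess_\<psi>: "\<forall>x\<in>?P. positive_definite (Hess \<Psi> x)"
    using assms(3) unfolding smooth_Hess_pos_def by blast
  then obtain U\<^sub>2 where \<Psi>: "open U\<^sub>2" "?P \<subseteq> U\<^sub>2" "smooth_on U\<^sub>2 \<Psi>" "\<forall>x\<in>?P. \<Psi> x = \<psi> x"
    unfolding smooth_extension_def by blast
  have "Ck_on 2 (U\<^sub>1 \<inter> U\<^sub>2) \<Phi>" "Ck_on 2 (U\<^sub>1 \<inter> U\<^sub>2) \<Psi>"
    using \<Phi>(3) \<Psi>(3) by (auto simp: smooth_on_def intro: Ck_on_subset)
  then interpret potential_deformation nu lam \<phi> \<psi> \<Phi> \<Psi> "U\<^sub>1 \<inter> U\<^sub>2"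
    using assms(1) \<Phi> \<Psi> Hess_\<phi> Hess_\<psi> by unfold_locales auto
  note lim = polarization_limit[OF _ Pol]
  have uniq: "\<exists>!L. polarization_tends_to nu lam Pol p L" if p: "p \<in> manifold" for p
    using exists_chart[OF p] lim by metis
  have limit: "limit_polarization nu lam Pol p = lim_set \<sigma> p" if "p \<in> chart_domain nu lam \<sigma>" for p \<sigma>
    unfolding limit_polarization_def by (rule the_equality) (simp_all add: lim[OF that])
  have "smooth_sections nu lam (limit_polarization nu lam Pol) U = smooth_sections nu lam (real_polarization nu lam) U"
    if U: "manifold_open nu lam U" for U
  proof (intro equalityI subsetI)
    fix X assume X: "X \<in> smooth_sections nu lam (limit_polarization nu lam Pol) U"
    have "X p \<in> real_polarization nu lam p" if p: "p \<in> U" for p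
    proof -
      have "p \<in> manifold" using U p by (auto simp: manifold_open_def)
      then obtain \<sigma> where \<sigma>: "p \<in> chart_domain nu lam \<sigma>" by (rule exists_chart)
      have "smooth_on (darboux_chart nu lam \<sigma> ` (U \<inter> chart_domain nu lam \<sigma>))
          (\<lambda>u. component \<sigma> (X (chart_inverse nu lam \<sigma> u)))"
        using X by (simp add: smooth_sections_def)
      then have "Ck_on 0 (darboux_chart nu lam \<sigma> ` (U \<inter> chart_domain nu lam \<sigma>))
          (\<lambda>u. component \<sigma> (X (chart_inverse nu lam \<sigma> u)))"
        unfolding smooth_on_def by blast
      then have cont: "continuous_on (darboux_chart nu lam \<sigma> ` (U \<inter> chart_domain nu lam \<sigma>))
          (\<lambda>u. component \<sigma> (X (chart_inverse nu lam \<sigma> u)))"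
        by simp
      show ?thesis
      proof (rule continuous_section_mem_real_polarization[OF p \<sigma> _ _ cont])
        show "open (darboux_chart nu lam \<sigma> ` (U \<inter> chart_domain nu lam \<sigma>))"
          using U by (simp add: manifold_open_def)
        show "X q \<in> lim_set \<sigma> q" if "q \<in> U \<inter> chart_domain nu lam \<sigma>" for q
          using X that limit[of q \<sigma>] by (auto simp: smooth_sections_def PiE_iff)
      qed
    qed
    then show "X \<in> smooth_sections nu lam (real_polarization nu lam) U"
      using X by (auto simp: smooth_sections_def PiE_iff)
  next
    fix X assume X: "X \<in> smooth_sections nu lam (real_polarization nu lam) U"
    have "X p \<in> limit_polarization nu lam Pol p" if p: "p \<in> U" for p
    proof -
      have "p \<in> manifold" using U p by (auto simp: manifold_open_def)
      then obtain \<sigma> where \<sigma>: "p \<in> chart_domain nu lam \<sigma>" by (rule exists_chart)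
      have "X p \<in> real_polarization nu lam p" using X p by (auto simp: smooth_sections_def PiE_iff)
      then show ?thesis using real_polarization_subset_lim_set[OF \<sigma>] limit[OF \<sigma>] by blast
    qed
    then show "X \<in> smooth_sections nu lam (limit_polarization nu lam Pol) U"
      using X by (auto simp: smooth_sections_def PiE_iff)
  qed
  then show ?thesis using uniq by blast
qed

end
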